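(* Let $(M,g)$ be a Riemannian manifold of dimension $n$ with Levi-Civita connection $\nabla$ and curvature tensor $R$, and let $\overline R$ be the curvature tensor of the Riemannian metric $\bar g$ on the frame bundle $L(M)$ defined in the context from the functions $\alpha,\beta$. Then, at every $u=(u_1,\ldots,u_n)\in L(M)$ over $x\in M$, for all $X,Y,Z\in T_xM$ and all indices $i,j,k\in\{1,\ldots,n\}$: (1) $$\begin{aligned}\overline R(X^h,Y^h)Z^h&=(R(X,Y)Z)^h+\frac12\sum_l\left((\nabla_ZR)(X,Y)u_l\right)^{v,l}\\&\quad-\frac14\sum_l\alpha_l\left(R(u_l,R(Y,Z)u_l)X-R(u_l,R(X,Z)u_l)Y-2R(u_l,R(X,Y)u_l)Z\right)^h;\end{aligned}$$ (2) $$\begin{aligned}\overline R(X^h,Y^h)Z^{v,i}&=(R(X,Y)Z)^{v,i}+\frac{\alpha_i}{2}\left((\nabla_XR)(u_i,Z)Y-(\nabla_YR)(u_i,Z)X\right)^h\\&\quad-\frac{\alpha_i}{4}\sum_l\left(R(X,R(u_i,Z)Y)u_l-R(Y,R(u_i,Z)X)u_l\right)^{v,l}\\&\quad+\frac{\alpha_i'}{\alpha_i}g(Z,u_i)(R(X,Y)u_i)^{v,i}-\frac{\beta_i-\alpha_i'}{\alpha_i+|u_i|^2\beta_i}g(R(X,Y)Z,u_i)U^i;\end{aligned}$$ (3) $$\begin{aligned}\overline R(X^h,Y^{v,i})Z^h&=\frac{\alpha_i}{2}\left((\nabla_XR)(u_i,Y)Z\right)^h-\frac12(R(Z,X)Y)^{v,i}+\frac{\alpha_i'}{2\alpha_i}g(Y,u_i)(R(X,Z)u_i)^{v,i}\\&\quad-\frac{\alpha_i}{4}\sum_l(R(X,R(u_i,Y)Z)u_l)^{v,l}-\frac{\beta_i-\alpha_i'}{2(\alpha_i+|u_i|^2\beta_i)}g(R(X,Z)Y,u_i)U^i;\end{aligned}$$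 (4) for $i\neq j$: $$\overline R(X^h,Y^{v,i})Z^{v,j}=-\frac{\alpha_i\alpha_j}{4}\left(R(u_i,Y)R(u_j,Z)X\right)^h;$$ (5) $$\begin{aligned}\overline R(X^h,Y^{v,i})Z^{v,i}&=\frac{\alpha_i'}{2}\left(g(Z,u_i)R(u_i,Y)X-g(Y,u_i)R(u_i,Z)X\right)^h\\&\quad-\frac{\alpha_i^2}{4}(R(u_i,Y)R(u_i,Z)X)^h-\frac{\alpha_i}{2}(R(Y,Z)X)^h;\end{aligned}$$ (6) $$\begin{aligned}\overline R(X^{v,i},Y^{v,i})Z^h&=\alpha_i(R(X,Y)Z)^h+\frac{\alpha_i^2}{4}\left(R(u_i,X)R(u_i,Y)Z-R(u_i,Y)R(u_i,X)Z\right)^h\\&\quad+\alpha_i'\left(g(X,u_i)(R(u_i,Y)Z)^h-g(Y,u_i)(R(u_i,X)Z)^h\right);\end{aligned}$$ (7) for $i\neq j$: $$\overline R(X^{v,i},Y^{v,j})Z^h=\frac{\alpha_i\alpha_j}{4}\left(R(u_i,X)R(u_j,Y)Z-R(u_j,Y)R(u_i,X)Z\right)^h;$$ (8) $$\begin{aligned}\overline R(X^{v,i},Y^{v,i})Z^{v,i}&=C_i\left(g(X,u_i)g(Y,Z)-g(Y,u_i)g(X,Z)\right)U^i\\&\quad+\left(A_ig(Y,u_i)g(Z,u_i)+B_ig(Y,Z)\right)X^{v,i}-\left(A_ig(X,u_i)g(Z,u_i)+B_ig(X,Z)\right)Y^{v,i};\end{aligned}$$ (9) $$\overline R(X^{v,i},Y^{v,j})Z^{v,k}=0\quad\text{if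 } \sharp\{i,j,k\}>1;$$ where $$A_i=\frac{3(\alpha_i')^2-2\alpha_i\alpha_i''}{\alpha_i^2}+\frac{(\alpha_i\beta_i'-2\alpha_i'\beta_i)(\alpha_i+|u_i|^2\alpha_i')}{\alpha_i^2(\alpha_i+|u_i|^2\beta_i)},$$ $$B_i=\frac{\alpha_i\beta_i-2\alpha_i\alpha_i'-(\alpha_i')^2|u_i|^2}{\alpha_i(\alpha_i+|u_i|^2\beta_i)},$$ $$C_i=-\frac{2\alpha_i''}{\alpha_i+|u_i|^2\beta_i}+\frac{3\alpha_i(\alpha_i')^2+2(\alpha_i')^2\beta_i|u_i|^2+\alpha_i^2\beta_i'-\alpha_i\beta_i^2+\alpha_i\alpha_i'\beta_i'|u_i|^2}{\alpha_i(\alpha_i+|u_i|^2\beta_i)^2}.$$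
   Context: $L(M)$ is the bundle of linear frames; its points over $x\in M$ are the bases $u=(u_1,\ldots,u_n)$ of $T_xM$. $X^h$ denotes the horizontal lift to $L(M)$ (with respect to $\nabla$) of a tangent vector $X$. The vertical lift $X^{v,i}$ ($i=1,\ldots,n$) is given by $X^{v,i}_u=\frac{d}{dt}\big|_{t=0}(u_1,\ldots,u_{i-1},u_i+tX,u_{i+1},\ldots,u_n)$. $U^i$ is the vector field on $L(M)$ given by $U^i_u=(u_i)^{v,i}_u$. All lifts are taken at $u$. The curvature convention is $R(X,Y)Z=\nabla_X\nabla_YZ-\nabla_Y\nabla_XZ-\nabla_{[X,Y]}Z$, and likewise for $\overline R$ with the Levi-Civita connection $\overline\nabla$ of $\bar g$. Let $\alpha,\beta:[0,\infty)\to\mathbb{R}$ be smooth functions with $\alpha(t)>0$ and $\alpha(t)+t\beta(t)>0$ for all $t\ge0$. Write $\alpha_i=\alpha(|u_i|^2)$, $\beta_i=\beta(|u_i|^2)$, $\alpha_i'=\alpha'(|u_i|^2)$, $\alpha_i''=\alpha''(|u_i|^2)$, $\beta_i'=\beta'(|u_i|^2)$, where $|u_i|^2=g(u_i,u_i)$. The Riemannian metric $\bar g$ on $L(M)$ is defined by $\bar g(X^h,Y^h)_u=g(X,Y)$; $\bar g(X^h,Y^{v,i})_u=0$; $\bar g(X^{v,i},Y^{v,j})_u=0$ for $i\ne j$; $\bar g(X^{v,i},Y^{v,i})_u=\alpha_i\,g(X,Y)+\beta_i\,g(X,u_i)g(Y,u_i)$. *)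

theory Defs
  imports "HOL-Analysis.Analysis"
begin

section \<open>Smooth maps between normed spaces\<close>

text \<open>The derivatives are taken within \<open>S\<close>. For open \<open>S\<close> these are the ordinary ones; for
  \<open>S = {0..}\<close> the derivative at the end point is one-sided.\<close>

primrec Ck_on :: "nat \<Rightarrow> 'a::real_normed_vector set \<Rightarrow> ('a \<Rightarrow> 'b::real_normed_vector) \<Rightarrow> bool" where
  "Ck_on 0 S f \<longleftrightarrow> continuous_on S f"
| "Ck_on (Suc k) S f \<longleftrightarrow> (\<forall>x\<in>S. f differentiable (at x within S)) \<and>
     (\<forall>v. Ck_on k S (\<lambda>x. frechet_derivative f (at x within S) v))"

definition smooth_on :: "'a::real_normed_vector set \<Rightarrow> ('a \<Rightarrow> 'b::real_normed_vector) \<Rightarrow> bool" where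
  "smooth_on S f \<longleftrightarrow> (\<forall>k. Ck_on k S f)"


section \<open>Smooth manifolds\<close>

record ('m, 'e) chart =
  cdom :: "'m set"
  cmap :: "'m \<Rightarrow> 'e"

definition cinv :: "('m, 'e) chart \<Rightarrow> 'e \<Rightarrow> 'm" where
  "cinv c = inv_into (cdom c) (cmap c)"

text \<open>A manifold modelled on \<open>'e\<close> is a set of points with a smooth atlas. The atlas also determines
  the topology. The component \<open>chart_at\<close> picks a chart around every point; its only role is to
  represent tangent vectors: the tangent space at \<open>p\<close> is the type \<open>'e\<close>, where a vector stands for
  its components in the chart \<open>chart_at M p\<close>.\<close>

record ('m, 'e) manifold =
  points :: "'m set"
  atlas :: "('m, 'e) chart set"
  chart_at :: "'m \<Rightarrow> ('m, 'e) chart"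

definition mopen :: "('m, 'e::euclidean_space) manifold \<Rightarrow> 'm set \<Rightarrow> bool" where
  "mopen M W \<longleftrightarrow> W \<subseteq> points M \<and> (\<forall>c\<in>atlas M. open (cmap c ` (W \<inter> cdom c)))"

definition smooth_manifold :: "('m, 'e::euclidean_space) manifold \<Rightarrow> bool" where
  "smooth_manifold M \<longleftrightarrow>
     (\<forall>c\<in>atlas M. cdom c \<subseteq> points M \<and> inj_on (cmap c) (cdom c) \<and> open (cmap c ` cdom c)) \<and>
     (\<forall>c\<in>atlas M. \<forall>c'\<in>atlas M. open (cmap c ` (cdom c \<inter> cdom c')) \<and>
        smooth_on (cmap c ` (cdom c \<inter> cdom c')) (cmap c' \<circ> cinv c)) \<and>
     (\<forall>p\<in>points M. chart_at M p \<in> atlas M \<and> p \<in> cdom (chart_at M p)) \<and>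
     Hausdorff_space (topology (mopen M)) \<and> second_countable (topology (mopen M))"

text \<open>The components in the chart \<open>c\<close> of the tangent vector \<open>v\<close> at \<open>p\<close>.\<close>

definition comps :: "('m, 'e::euclidean_space) manifold \<Rightarrow> ('m, 'e) chart \<Rightarrow> 'm \<Rightarrow> 'e \<Rightarrow> 'e" where
  "comps M c p v =
     frechet_derivative (cmap c \<circ> cinv (chart_at M p)) (at (cmap (chart_at M p) p)) v"

definition tangent_map :: "('m, 'e::euclidean_space) manifold \<Rightarrow> ('k, 'f::euclidean_space) manifold
    \<Rightarrow> ('m \<Rightarrow> 'k) \<Rightarrow> 'm \<Rightarrow> 'e \<Rightarrow> 'f" where
  "tangent_map M N F p v =
     frechet_derivative (cmap (chart_at N (F p)) \<circ> F \<circ> cinv (chart_at M p))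
       (at (cmap (chart_at M p) p)) v"

definition velocity :: "('m, 'e::euclidean_space) manifold \<Rightarrow> (real \<Rightarrow> 'm) \<Rightarrow> real \<Rightarrow> 'e" where
  "velocity M \<gamma> t = vector_derivative (cmap (chart_at M (\<gamma> t)) \<circ> \<gamma>) (at t)"

definition smooth_fun :: "('m, 'e::euclidean_space) manifold \<Rightarrow> 'm set \<Rightarrow> ('m \<Rightarrow> real) \<Rightarrow> bool" where
  "smooth_fun M W f \<longleftrightarrow> (\<forall>c\<in>atlas M. smooth_on (cmap c ` (W \<inter> cdom c)) (f \<circ> cinv c))"

text \<open>The derivative of the function \<open>f\<close> in the direction of the tangent vector \<open>v\<close> at \<open>p\<close>.\<close>

definition dir_deriv :: "('m, 'e::euclidean_space) manifold \<Rightarrow> ('m \<Rightarrow> real) \<Rightarrow> 'm \<Rightarrow> 'e \<Rightarrow> real" where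
  "dir_deriv M f p v = frechet_derivative (f \<circ> cinv (chart_at M p)) (at (cmap (chart_at M p) p)) v"

text \<open>Vector fields are total functions of which only the values on the open set under consideration
  matter.\<close>

definition local_rep :: "('m, 'e::euclidean_space) manifold \<Rightarrow> ('m, 'e) chart \<Rightarrow> ('m \<Rightarrow> 'e) \<Rightarrow> 'e \<Rightarrow> 'e" where
  "local_rep M c X y = comps M c (cinv c y) (X (cinv c y))"

definition smooth_vf :: "('m, 'e::euclidean_space) manifold \<Rightarrow> 'm set \<Rightarrow> ('m \<Rightarrow> 'e) \<Rightarrow> bool" where
  "smooth_vf M W X \<longleftrightarrow> (\<forall>c\<in>atlas M. smooth_on (cmap c ` (W \<inter> cdom c)) (local_rep M c X))"

text \<open>In local coordinates, \<open>[X,Y]\<^sup>k = X\<^sup>i \<partial>\<^sub>i Y\<^sup>k - Y\<^sup>i \<partial>\<^sub>i X\<^sup>k\<close>.\<close>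

definition lie_bracket :: "('m, 'e::euclidean_space) manifold \<Rightarrow> ('m \<Rightarrow> 'e) \<Rightarrow> ('m \<Rightarrow> 'e) \<Rightarrow> 'm \<Rightarrow> 'e" where
  "lie_bracket M X Y p = (let c = chart_at M p; y = cmap c p in
     frechet_derivative (local_rep M c Y) (at y) (X p)
     - frechet_derivative (local_rep M c X) (at y) (Y p))"


section \<open>Riemannian metrics, connections and curvature\<close>

definition riemannian_metric ::
    "('m, 'e::euclidean_space) manifold \<Rightarrow> ('m \<Rightarrow> 'e \<Rightarrow> 'e \<Rightarrow> real) \<Rightarrow> bool" where
  "riemannian_metric M g \<longleftrightarrow>
     (\<forall>p\<in>points M. bilinear (g p) \<and> (\<forall>v w. g p v w = g p w v) \<and> (\<forall>v. v \<noteq> 0 \<longrightarrow> g p v v > 0)) \<and>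
     (\<forall>W X Y. mopen M W \<and> smooth_vf M W X \<and> smooth_vf M W Y \<longrightarrow>
        smooth_fun M W (\<lambda>p. g p (X p) (Y p)))"

text \<open>An affine connection as an operator on local vector fields: \<open>D p v Y\<close> is \<open>\<nabla>\<^sub>v Y\<close>, for a tangent
  vector \<open>v\<close> at \<open>p\<close> and a vector field \<open>Y\<close> which is smooth on a neighbourhood of \<open>p\<close>. The last
  conjunct says that it depends on \<open>Y\<close> only near \<open>p\<close>.\<close>

definition affine_connection ::
    "('m, 'e::euclidean_space) manifold \<Rightarrow> ('m \<Rightarrow> 'e \<Rightarrow> ('m \<Rightarrow> 'e) \<Rightarrow> 'e) \<Rightarrow> bool" where
  "affine_connection M D \<longleftrightarrow> (\<forall>W. mopen M W \<longrightarrow>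
     (\<forall>X Y. smooth_vf M W X \<and> smooth_vf M W Y \<longrightarrow> smooth_vf M W (\<lambda>p. D p (X p) Y)) \<and>
     (\<forall>Y. smooth_vf M W Y \<longrightarrow> (\<forall>p\<in>W. linear (\<lambda>v. D p v Y))) \<and>
     (\<forall>Y Z. smooth_vf M W Y \<and> smooth_vf M W Z \<longrightarrow>
        (\<forall>p\<in>W. \<forall>v. D p v (\<lambda>q. Y q + Z q) = D p v Y + D p v Z)) \<and>
     (\<forall>f Y. smooth_fun M W f \<and> smooth_vf M W Y \<longrightarrow>
        (\<forall>p\<in>W. \<forall>v. D p v (\<lambda>q. f q *\<^sub>R Y q) = dir_deriv M f p v *\<^sub>R Y p + f p *\<^sub>R D p v Y)) \<and>
     (\<forall>Y Z. smooth_vf M W Y \<and> smooth_vf M W Z \<and> (\<forall>q\<in>W. Y q = Z q) \<longrightarrow>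
        (\<forall>p\<in>W. \<forall>v. D p v Y = D p v Z)))"

definition levi_civita :: "('m, 'e::euclidean_space) manifold \<Rightarrow> ('m \<Rightarrow> 'e \<Rightarrow> 'e \<Rightarrow> real)
    \<Rightarrow> ('m \<Rightarrow> 'e \<Rightarrow> ('m \<Rightarrow> 'e) \<Rightarrow> 'e) \<Rightarrow> bool" where
  "levi_civita M g D \<longleftrightarrow> affine_connection M D \<and>
     (\<forall>W X Y. mopen M W \<and> smooth_vf M W X \<and> smooth_vf M W Y \<longrightarrow>
        (\<forall>p\<in>W. D p (X p) Y - D p (Y p) X = lie_bracket M X Y p)) \<and>
     (\<forall>W Y Z. mopen M W \<and> smooth_vf M W Y \<and> smooth_vf M W Z \<longrightarrow>
        (\<forall>p\<in>W. \<forall>v. dir_deriv M (\<lambda>q. g q (Y q) (Z q)) p v = g p (D p v Y) (Z p) + g p (Y p) (D p v Z)))"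

text \<open>\<open>X\<close> is a smooth vector field near \<open>p\<close> with value \<open>v\<close> at \<open>p\<close>.\<close>

definition extends :: "('m, 'e::euclidean_space) manifold \<Rightarrow> 'm \<Rightarrow> 'e \<Rightarrow> ('m \<Rightarrow> 'e) \<Rightarrow> bool" where
  "extends M p v X \<longleftrightarrow> (\<exists>W. mopen M W \<and> p \<in> W \<and> smooth_vf M W X) \<and> X p = v"

text \<open>The next two expressions are tensorial, that is, they depend only on the values of the
  vector fields at \<open>p\<close>. \<open>curvature M D p x y z\<close> is \<open>R(x,y)z\<close> and \<open>curvature_deriv M D p w x y z\<close>
  is \<open>(\<nabla>\<^sub>w R)(x,y)z\<close>.\<close>

definition curvature :: "('m, 'e::euclidean_space) manifold \<Rightarrow> ('m \<Rightarrow> 'e \<Rightarrow> ('m \<Rightarrow> 'e) \<Rightarrow> 'e)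
    \<Rightarrow> 'm \<Rightarrow> 'e \<Rightarrow> 'e \<Rightarrow> 'e \<Rightarrow> 'e" where
  "curvature M D p x y z = (THE a. \<forall>X Y Z. extends M p x X \<and> extends M p y Y \<and> extends M p z Z \<longrightarrow>
     a = D p x (\<lambda>q. D q (Y q) Z) - D p y (\<lambda>q. D q (X q) Z) - D p (lie_bracket M X Y p) Z)"

definition curvature_deriv :: "('m, 'e::euclidean_space) manifold \<Rightarrow> ('m \<Rightarrow> 'e \<Rightarrow> ('m \<Rightarrow> 'e) \<Rightarrow> 'e)
    \<Rightarrow> 'm \<Rightarrow> 'e \<Rightarrow> 'e \<Rightarrow> 'e \<Rightarrow> 'e \<Rightarrow> 'e" where
  "curvature_deriv M D p w x y z =
     (THE a. \<forall>X Y Z. extends M p x X \<and> extends M p y Y \<and> extends M p z Z \<longrightarrow>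
        a = D p w (\<lambda>q. curvature M D q (X q) (Y q) (Z q))
            - curvature M D p (D p w X) y z
            - curvature M D p x (D p w Y) z
            - curvature M D p x y (D p w Z))"


section \<open>The bundle of linear frames\<close>

text \<open>A frame at \<open>x\<close> is a vector of \<open>n = CARD('n)\<close> tangent vectors \<open>u $ i\<close> at \<open>x\<close>. As with
  all tangent vectors, these are given by their components in \<open>chart_at M x\<close>.\<close>

type_synonym 'n frame = "(real^'n)^'n"

text \<open>The tangent spaces of the frame bundle: base components and the components of the \<open>n\<close> frame
  vectors.\<close>

type_synonym 'n frame_tangent = "(real^'n) \<times> 'n frame"

definition is_frame :: "'n::finite frame \<Rightarrow> bool" where
  "is_frame u \<longleftrightarrow> inj (($) u) \<and> independent (range (($) u)) \<and> span (range (($) u)) = UNIV"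

definition frame_chart :: "('m, real^'n) manifold \<Rightarrow> ('m, real^'n) chart
    \<Rightarrow> ('m \<times> 'n frame, 'n frame_tangent) chart" where
  "frame_chart M c =
     \<lparr>cdom = {(x, u). x \<in> cdom c \<and> is_frame u},
      cmap = (\<lambda>(x, u). (cmap c x, \<chi> i. comps M c x (u $ i)))\<rparr>"

definition frame_bundle :: "('m, real^'n) manifold
    \<Rightarrow> ('m \<times> 'n frame, 'n frame_tangent) manifold" where
  "frame_bundle M =
     \<lparr>points = {(x, u). x \<in> points M \<and> is_frame u},
      atlas = frame_chart M ` atlas M,
      chart_at = (\<lambda>(x, u). frame_chart M (chart_at M x))\<rparr>"

text \<open>The horizontal space at a frame consists of the vectors \<open>ds(X)\<close>, for the local frame fields
  \<open>s\<close> through the given frame that are parallel at the point in the direction of \<open>X\<close>. The vector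
  \<open>ds(X)\<close> does not depend on the choice of such \<open>s\<close>.\<close>

definition hlift :: "('m, real^'n) manifold \<Rightarrow> ('m \<Rightarrow> real^'n \<Rightarrow> ('m \<Rightarrow> real^'n) \<Rightarrow> real^'n)
    \<Rightarrow> 'm \<times> 'n frame \<Rightarrow> real^'n \<Rightarrow> 'n frame_tangent" where
  "hlift M D = (\<lambda>(x, u) X. THE a. \<forall>W s. mopen M W \<and> x \<in> W \<and>
     (\<forall>q\<in>W. is_frame (s q)) \<and> (\<forall>i. smooth_vf M W (\<lambda>q. s q $ i)) \<and>
     s x = u \<and> (\<forall>i. D x X (\<lambda>q. s q $ i) = 0) \<longrightarrow>
     a = tangent_map M (frame_bundle M) (\<lambda>q. (q, s q)) x X)"

definition vlift :: "('m, real^'n) manifold \<Rightarrow> 'm \<times> 'n frame \<Rightarrow> 'n \<Rightarrow> real^'n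
    \<Rightarrow> 'n frame_tangent" where
  "vlift M = (\<lambda>(x, u) i X.
     velocity (frame_bundle M) (\<lambda>t. (x, \<chi> k. if k = i then u $ k + t *\<^sub>R X else u $ k)) 0)"

definition frame_metric :: "('m, real^'n) manifold \<Rightarrow> ('m \<Rightarrow> real^'n \<Rightarrow> real^'n \<Rightarrow> real)
    \<Rightarrow> ('m \<Rightarrow> real^'n \<Rightarrow> ('m \<Rightarrow> real^'n) \<Rightarrow> real^'n) \<Rightarrow> (real \<Rightarrow> real) \<Rightarrow> (real \<Rightarrow> real)
    \<Rightarrow> ('m \<times> 'n frame \<Rightarrow> 'n frame_tangent \<Rightarrow> 'n frame_tangent \<Rightarrow> real) \<Rightarrow> bool" where
  "frame_metric M g D \<alpha> \<beta> gb \<longleftrightarrow> riemannian_metric (frame_bundle M) gb \<and>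
     (\<forall>(x, u)\<in>points (frame_bundle M). \<forall>X Y.
        let h = hlift M D (x, u); v = vlift M (x, u) in
        gb (x, u) (h X) (h Y) = g x X Y \<and>
        (\<forall>i. gb (x, u) (h X) (v i Y) = 0) \<and>
        (\<forall>i j. i \<noteq> j \<longrightarrow> gb (x, u) (v i X) (v j Y) = 0) \<and>
        (\<forall>i. gb (x, u) (v i X) (v i Y) =
           \<alpha> (g x (u $ i) (u $ i)) * g x X Y
           + \<beta> (g x (u $ i) (u $ i)) * g x X (u $ i) * g x Y (u $ i)))"

end

theory Submission
  imports Defs
begin

text \<open>In a chart, a vector at a frame \<open>u\<close> is given by a horizontal part and \<open>n\<close> vertical parts, and
  \<open>\<nabla>\<close> acts on each part. This connection on the bundle preserves the splitting; its torsion is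
  \<open>(X, Y) \<mapsto> \<Sum>\<^sub>l (R(X, Y) u\<^sub>l)\<^sup>v\<^sup>,\<^sup>l\<close>, and the frame vectors \<open>u\<^sub>l\<close>, as sections of the pullback of the
  tangent bundle, satisfy \<open>\<nabla>u\<^sub>l = 0\<close> along horizontal and \<open>\<nabla>u\<^sub>l = X\<close> along the vertical vector
  \<open>X\<^sup>v\<^sup>,\<^sup>l\<close>. The Levi-Civita connection of the bundle metric is \<open>\<nabla> + S\<close> for an explicit tensor \<open>S\<close>
  built from \<open>R\<close>, \<open>\<alpha>\<close>, \<open>\<beta>\<close> and the \<open>u\<^sub>l\<close>, because \<open>\<nabla> + S\<close> is torsion-free and metric. Hence
  its curvature is
  \<open>R(A, B) + (\<nabla>\<^sub>A S)(B) - (\<nabla>\<^sub>B S)(A) + [S(A), S(B)] - S(S(A) B - S(B) A)\<close>,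
  and evaluating this tensor on horizontal and vertical vectors, with the second Bianchi identity in
  the purely horizontal case, gives the nine formulas.\<close>

section \<open>Calculus of smooth maps on open sets\<close>

text \<open>Lifts and curvature are defined by definite descriptions over all extensions, and
  tangent vectors through preferred charts. So each object is first given an expression in one chart
  that involves only its arguments at the point; this also shows that the descriptions are well
  defined. From then on the argument lives on an open set of pairs (point, frame) in Euclidean
  space, where sections of the pulled-back tangent bundle are plain functions of such pairs. The
  connection \<open>Db\<close> is given and not constructed, so \<open>S\<close> has to be guessed
  and then identified by uniqueness. Its origin: the part taking two horizontal vectors to a
  vertical one is half the torsion with the opposite sign; pair symmetry of the curvature turns the
  metric condition for that part into the mixed terms; the purely vertical part is a symmetric
  ansatz built from g and u_i, whose three coefficient functions of |u_i|^2 are found from the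
  metric condition on a fibre. The constants A, B and C of the theorem are the curvature of that
  fibre metric.\<close>

abbreviation der :: "('a::real_normed_vector \<Rightarrow> 'b::real_normed_vector) \<Rightarrow> 'a \<Rightarrow> 'a \<Rightarrow> 'b" where
  "der f x \<equiv> frechet_derivative f (at x)"

lemma der_eqI: "(f has_derivative f') (at x) \<Longrightarrow> der f x = f'"
  by (rule frechet_derivative_at[symmetric])

lemma der_cong:
  assumes "open S" "x \<in> S" "\<And>y. y \<in> S \<Longrightarrow> f y = g y"
  shows "der f x = der g x"
proof -
  have "(f has_derivative f') (at x) \<longleftrightarrow> (g has_derivative f') (at x)" for f'
    using assms has_derivative_transform_within_open[of f f' x UNIV S g]
      has_derivative_transform_within_open[of g f' x UNIV S f] by auto
  then show ?thesis unfolding frechet_derivative_def by presburger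
qed

section \<open>Maps of class C^k\<close>

lemma Ck_on_cong:
  assumes "\<And>x. x \<in> S \<Longrightarrow> f x = g x"
  shows "Ck_on k S f = Ck_on k S g"
  using assms
proof (induction k arbitrary: f g)
  case 0
  then show ?case by (simp cong: continuous_on_cong)
next
  case (Suc k)
  have *: "(f has_derivative f') (at x within S) \<longleftrightarrow> (g has_derivative f') (at x within S)"
    if "x \<in> S" for x f'
    using that Suc.prems has_derivative_transform[of x S f g f'] has_derivative_transform[of x S g f f']
    by auto
  then have **: "frechet_derivative f (at x within S) = frechet_derivative g (at x within S)"
    if "x \<in> S" for x
    using that unfolding frechet_derivative_def by presburger
  have "Ck_on k S (\<lambda>x. frechet_derivative f (at x within S) v) =
      Ck_on k S (\<lambda>x. frechet_derivative g (at x within S) v)" for v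
    by (rule Suc.IH) (simp add: **)
  then show ?case using * by (simp add: differentiable_def)
qed

text \<open>At a point of the open set \<open>T\<close> both filters, within \<open>S\<close> and
  within \<open>T\<close>, are \<open>at x\<close>, whether or not \<open>S\<close> is open. In this
  way functions smooth on \<open>{0..}\<close>, with one-sided derivatives at 0, become ordinary
  smooth functions on \<open>{0<..}\<close>.\<close>

lemma Ck_on_open_subset:
  assumes "Ck_on k S f" "open T" "T \<subseteq> S"
  shows "Ck_on k T f"
  using assms(1)
proof (induction k arbitrary: f)
  case 0
  then show ?case using assms continuous_on_subset by auto
next
  case (Suc k)
  have at: "at x within S = at x within T" if "x \<in> T" for x
    using that assms by (metis at_within_open at_within_open_subset)
  have "Ck_on k T (\<lambda>x. frechet_derivative f (at x within T) v)" for v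
  proof (subst Ck_on_cong)
    show "Ck_on k T (\<lambda>x. frechet_derivative f (at x within S) v)"
      by (rule Suc.IH) (use Suc.prems in auto)
  qed (simp add: at)
  then show ?case using Suc.prems assms(3) at by (auto simp: subset_iff) (metis at)
qed

text \<open>Lets the inductions below name a derivative found by the usual rules; those rules never
  produce a \<open>frechet_derivative\<close>.\<close>

lemma Ck_on_SucI:
  assumes "open S" "\<And>x. x \<in> S \<Longrightarrow> (f has_derivative f' x) (at x)" "\<And>v. Ck_on k S (\<lambda>x. f' x v)"
  shows "Ck_on (Suc k) S f"
proof -
  have "Ck_on k S (\<lambda>x. frechet_derivative f (at x within S) v)" for v
  proof (subst Ck_on_cong)
    show "frechet_derivative f (at x within S) v = f' x v" if "x \<in> S" for x
      using that assms der_eqI by (metis at_within_open)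
  qed (rule assms)
  then show ?thesis
    using assms by (auto simp: differentiable_def intro: has_derivative_at_withinI)
qed

lemma Ck_on_Suc_has_derivative:
  assumes "Ck_on (Suc k) S f" "open S" "x \<in> S"
  shows "(f has_derivative der f x) (at x)"
  using assms by (metis Ck_on.simps(2) at_within_open frechet_derivative_works)

lemma Ck_on_der:
  assumes "Ck_on (Suc k) S f" "open S"
  shows "Ck_on k S (\<lambda>x. der f x v)"
proof (subst Ck_on_cong)
  show "Ck_on k S (\<lambda>x. frechet_derivative f (at x within S) v)" using assms by simp
qed (use assms at_within_open in metis)

lemma Ck_on_Suc_imp:
  assumes "Ck_on (Suc k) S f" "open S"
  shows "Ck_on k S f"
  using assms(1)
proof (induction k arbitrary: f)
  case 0
  then show ?case
    using Ck_on_Suc_has_derivative[OF 0 assms(2)] 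
    by (auto intro!: continuous_at_imp_continuous_on has_derivative_continuous)
next
  case (Suc k)
  show ?case
    by (rule Ck_on_SucI[OF assms(2) Ck_on_Suc_has_derivative[OF Suc.prems assms(2)] Suc.IH])
      (auto intro: Ck_on_der[OF Suc.prems assms(2)] simp del: Ck_on.simps)
qed

lemma Ck_on_const: "open S \<Longrightarrow> Ck_on k S (\<lambda>x. c)"
proof (induction k arbitrary: c)
  case (Suc k)
  then show ?case by (intro Ck_on_SucI[where f' = "\<lambda>x v. 0"]) auto
qed auto

lemma Ck_on_bounded_linear:
  assumes "open S" "bounded_linear L" "Ck_on k S f"
  shows "Ck_on k S (\<lambda>x. L (f x))"
  using assms(3)
proof (induction k arbitrary: f)
  case 0
  then show ?case using assms(2) by (auto intro: bounded_linear.continuous_on)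
next
  case (Suc k)
  note d = Ck_on_Suc_has_derivative[OF Suc.prems assms(1)]
  show ?case
  proof (rule Ck_on_SucI[OF assms(1)])
    show "((\<lambda>x. L (f x)) has_derivative (\<lambda>v. L (der f x v))) (at x)" if "x \<in> S" for x
      using d[OF that] assms(2) by (simp add: bounded_linear.has_derivative)
    show "Ck_on k S (\<lambda>x. L (der f x v))" for v
      by (rule Suc.IH) (rule Ck_on_der[OF Suc.prems assms(1)])
  qed
qed

lemma Ck_on_ident: "open S \<Longrightarrow> Ck_on k S (\<lambda>x. x)"
proof (induction k)
  case (Suc k)
  show ?case
    by (rule Ck_on_SucI[OF \<open>open S\<close> has_derivative_ident]) (rule Ck_on_const[OF \<open>open S\<close>])
qed (simp add: continuous_on_id)

lemma Ck_on_add: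
  assumes "open S" "Ck_on k S f" "Ck_on k S g"
  shows "Ck_on k S (\<lambda>x. f x + g x)"
  using assms(2,3)
proof (induction k arbitrary: f g)
  case 0
  then show ?case by (auto intro: continuous_intros)
next
  case (Suc k)
  show ?case
    by (rule Ck_on_SucI[OF assms(1) has_derivative_add[OF Ck_on_Suc_has_derivative[OF Suc.prems(1) assms(1)]
            Ck_on_Suc_has_derivative[OF Suc.prems(2) assms(1)]] Suc.IH])
      (auto intro: Ck_on_der Suc.prems assms)
qed

lemma Ck_on_bounded_bilinear:
  assumes "open S" "bounded_bilinear B" "Ck_on k S f" "Ck_on k S g"
  shows "Ck_on k S (\<lambda>x. B (f x) (g x))"
  using assms(3,4)
proof (induction k arbitrary: f g)
  case 0
  then show ?case using assms(2) by (auto intro: bounded_bilinear.continuous_on)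
next
  case (Suc k)
  have "Ck_on k S f" "Ck_on k S g" "Ck_on k S (\<lambda>x. der f x v)" "Ck_on k S (\<lambda>x. der g x v)" for v
    using Suc.prems assms(1) by (auto intro: Ck_on_Suc_imp Ck_on_der simp del: Ck_on.simps)
  then show ?case
    by (intro Ck_on_SucI[OF assms(1) bounded_bilinear.FDERIV[OF assms(2)
            Ck_on_Suc_has_derivative[OF Suc.prems(1) assms(1)]
            Ck_on_Suc_has_derivative[OF Suc.prems(2) assms(1)]]] Ck_on_add[OF assms(1)] Suc.IH)
qed

lemma Ck_on_sum:
  assumes "open S" "\<And>i. i \<in> I \<Longrightarrow> Ck_on k S (f i)"
  shows "Ck_on k S (\<lambda>x. \<Sum>i\<in>I. f i x)"
  using assms(2)
proof (induction I rule: infinite_finite_induct)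
  case (insert i I)
  then show ?case using Ck_on_add[OF assms(1), of k "f i" "\<lambda>x. \<Sum>i\<in>I. f i x"] by simp
qed (simp_all add: Ck_on_const[OF assms(1)])

lemma linear_Basis_expansion:
  fixes L :: "'a::euclidean_space \<Rightarrow> 'b::real_vector"
  assumes "linear L"
  shows "L v = (\<Sum>b\<in>Basis. (v \<bullet> b) *\<^sub>R L b)"
proof -
  have "L v = L (\<Sum>b\<in>Basis. (v \<bullet> b) *\<^sub>R b)" by (simp add: euclidean_representation)
  then show ?thesis using assms by (simp add: linear_sum linear_cmul)
qed

text \<open>In the derivative \<open>der g (f x) (der f x v)\<close> the direction varies with
  \<open>x\<close> as well. Expanding it in the basis of the middle space leaves a finite sum of
  scalar functions times \<open>der g (f x) b\<close> with \<open>b\<close> fixed, and the induction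
  hypothesis applies to each \<open>der g _ b\<close>. This is why the middle space is
  Euclidean.\<close>

lemma Ck_on_compose:
  fixes f :: "'a::real_normed_vector \<Rightarrow> 'b::euclidean_space" and g :: "'b \<Rightarrow> 'c::real_normed_vector"
  assumes "open S" "open T" "Ck_on k S f" "Ck_on k T g" "\<And>x. x \<in> S \<Longrightarrow> f x \<in> T"
  shows "Ck_on k S (\<lambda>x. g (f x))"
  using assms(3,4)
proof (induction k arbitrary: g)
  case 0
  then show ?case using assms(5) by (auto intro: continuous_on_compose2)
next
  case (Suc k)
  note df = Ck_on_Suc_has_derivative[OF Suc.prems(1) assms(1)]
  note dg = Ck_on_Suc_has_derivative[OF Suc.prems(2) assms(2)]
  show ?case
  proof (rule Ck_on_SucI[OF assms(1)])
    show "((\<lambda>x. g (f x)) has_derivative (\<lambda>v. der g (f x) (der f x v))) (at x)" if "x \<in> S" for x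
      using diff_chain_at[OF df[OF that] dg[OF assms(5)[OF that]]] by (simp add: o_def)
    fix v
    have "Ck_on k S (\<lambda>x. \<Sum>b\<in>Basis. (der f x v \<bullet> b) *\<^sub>R der g (f x) b)"
      using Suc.prems assms(1,2)
      by (intro Ck_on_sum Ck_on_bounded_bilinear[OF _ bounded_bilinear_scaleR] Suc.IH
          Ck_on_bounded_linear[OF _ bounded_linear_inner_left] Ck_on_der Ck_on_Suc_imp[of k S f])
    then show "Ck_on k S (\<lambda>x. der g (f x) (der f x v))"
      by (rule Ck_on_cong[THEN iffD1, rotated])
        (use linear_Basis_expansion has_derivative_linear[OF dg[OF assms(5)]] in metis)
  qed
qed

section \<open>Closure properties of smooth maps\<close>

lemma smooth_on_cong: "(\<And>x. x \<in> S \<Longrightarrow> f x = g x) \<Longrightarrow> smooth_on S f = smooth_on S g"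
  unfolding smooth_on_def using Ck_on_cong by metis

lemma smooth_on_open_subset: "smooth_on S f \<Longrightarrow> open T \<Longrightarrow> T \<subseteq> S \<Longrightarrow> smooth_on T f"
  unfolding smooth_on_def using Ck_on_open_subset by metis

lemma smooth_on_has_derivative: "smooth_on S f \<Longrightarrow> open S \<Longrightarrow> x \<in> S \<Longrightarrow> (f has_derivative der f x) (at x)"
  unfolding smooth_on_def using Ck_on_Suc_has_derivative by metis

lemma smooth_on_linear_der: "smooth_on S f \<Longrightarrow> open S \<Longrightarrow> x \<in> S \<Longrightarrow> linear (der f x)"
  using smooth_on_has_derivative has_derivative_linear by blast

lemma smooth_on_continuous_on: "smooth_on S f \<Longrightarrow> continuous_on S f"
  unfolding smooth_on_def using Ck_on.simps(1) by metis

lemma smooth_on_der: "smooth_on S f \<Longrightarrow> open S \<Longrightarrow> smooth_on S (\<lambda>x. der f x v)"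
  unfolding smooth_on_def using Ck_on_der by metis

lemma smooth_on_const: "open S \<Longrightarrow> smooth_on S (\<lambda>x. c)"
  unfolding smooth_on_def using Ck_on_const by metis

lemma smooth_on_ident: "open S \<Longrightarrow> smooth_on S (\<lambda>x. x)"
  unfolding smooth_on_def using Ck_on_ident by metis

lemma smooth_on_bounded_linear: "bounded_linear L \<Longrightarrow> smooth_on S f \<Longrightarrow> open S \<Longrightarrow> smooth_on S (\<lambda>x. L (f x))"
  unfolding smooth_on_def using Ck_on_bounded_linear by metis

lemma smooth_on_add: "smooth_on S f \<Longrightarrow> smooth_on S g \<Longrightarrow> open S \<Longrightarrow> smooth_on S (\<lambda>x. f x + g x)"
  unfolding smooth_on_def using Ck_on_add by metis

lemma smooth_on_minus: "smooth_on S f \<Longrightarrow> open S \<Longrightarrow> smooth_on S (\<lambda>x. - f x)"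
  using smooth_on_bounded_linear[OF bounded_linear_minus[OF bounded_linear_ident]] by auto

lemma smooth_on_diff: "smooth_on S f \<Longrightarrow> smooth_on S g \<Longrightarrow> open S \<Longrightarrow> smooth_on S (\<lambda>x. f x - g x)"
  using smooth_on_add[of S f "\<lambda>x. - g x"] smooth_on_minus[of S g] by simp

lemma smooth_on_sum: "(\<And>i. i \<in> I \<Longrightarrow> smooth_on S (f i)) \<Longrightarrow> open S \<Longrightarrow> smooth_on S (\<lambda>x. \<Sum>i\<in>I. f i x)"
  unfolding smooth_on_def using Ck_on_sum by metis

lemma smooth_on_scaleR: "smooth_on S f \<Longrightarrow> smooth_on S g \<Longrightarrow> open S \<Longrightarrow> smooth_on S (\<lambda>x. f x *\<^sub>R g x)"
  unfolding smooth_on_def using Ck_on_bounded_bilinear[OF _ bounded_bilinear_scaleR] by blast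

lemma smooth_on_compose:
  fixes f :: "'a::real_normed_vector \<Rightarrow> 'b::euclidean_space"
  assumes "smooth_on T g" "smooth_on S f" "open S" "open T" "\<And>x. x \<in> S \<Longrightarrow> f x \<in> T"
  shows "smooth_on S (\<lambda>x. g (f x))"
  using assms Ck_on_compose unfolding smooth_on_def by metis

text \<open>Tensor fields are kept as functions of a point and of vectors, never as maps into a
  space of operators. Smoothness on fixed vectors then has to be carried over to varying ones, again
  by expansion in the basis.\<close>

lemma smooth_on_linear_app:
  fixes f :: "'a::real_normed_vector \<Rightarrow> 'b::euclidean_space"
  assumes "\<And>v. smooth_on S (\<lambda>x. L x v)" "\<And>x. x \<in> S \<Longrightarrow> linear (L x)" "smooth_on S f" "open S"
  shows "smooth_on S (\<lambda>x. L x (f x))"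
proof -
  have "smooth_on S (\<lambda>x. \<Sum>b\<in>Basis. (f x \<bullet> b) *\<^sub>R L x b)"
    by (intro smooth_on_sum smooth_on_scaleR assms smooth_on_bounded_linear[OF bounded_linear_inner_left])
  then show ?thesis
    by (rule smooth_on_cong[THEN iffD1, rotated]) (use linear_Basis_expansion assms(2) in metis)
qed

lemma smooth_on_der_app:
  fixes f :: "'b::euclidean_space \<Rightarrow> 'c::real_normed_vector"
  assumes "smooth_on S f" "smooth_on S h" "open S"
  shows "smooth_on S (\<lambda>x. der f x (h x))"
  by (rule smooth_on_linear_app) (use assms in \<open>auto intro: smooth_on_der smooth_on_linear_der\<close>)

lemma smooth_on_Pair:
  assumes "smooth_on S f" "smooth_on S g" "open S"
  shows "smooth_on S (\<lambda>x. (f x, g x))"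
proof -
  have "smooth_on S (\<lambda>x. (f x, 0) + (0, g x))"
    by (intro smooth_on_add smooth_on_bounded_linear[where L = "\<lambda>a. (a, 0)"]
        smooth_on_bounded_linear[where L = "\<lambda>b. (0, b)"] assms bounded_linear_Pair bounded_linear_ident bounded_linear_zero)
  then show ?thesis by simp
qed

lemma smooth_on_fst: "open S \<Longrightarrow> smooth_on S fst"
  by (rule smooth_on_bounded_linear[OF bounded_linear_fst smooth_on_ident])

lemma bounded_linear_snd_nth: "bounded_linear (\<lambda>q. snd q $ i)"
  using bounded_linear_compose[OF bounded_linear_vec_nth bounded_linear_snd] by blast

lemma smooth_on_snd_nth: "open S \<Longrightarrow> smooth_on S (\<lambda>q. snd q $ i)"
  by (rule smooth_on_bounded_linear[OF bounded_linear_snd_nth smooth_on_ident])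

lemma bounded_linear_axis: "bounded_linear (axis i :: 'a::real_normed_vector \<Rightarrow> 'a^'n)"
proof (rule bounded_linear_intro[where K = 1])
  fix v w :: 'a and r :: real
  show "axis i (v + w) = (axis i v + axis i w :: 'a^'n)" by (simp add: vec_eq_iff axis_def)
  show "axis i (r *\<^sub>R v) = (r *\<^sub>R axis i v :: 'a^'n)" by (simp add: vec_eq_iff axis_def)
  show "norm (axis i v :: 'a^'n) \<le> norm v * 1"
    using L2_set_le_sum[of UNIV "\<lambda>j. norm ((axis i v :: 'a^'n) $ j)"]
    by (simp add: norm_vec_def axis_def if_distrib cong: if_cong)
qed

lemma vec_lambda_sum_axis: "(\<chi> i. f i) = (\<Sum>i\<in>UNIV. axis i (f i))"
  by (simp add: vec_eq_iff axis_def)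

lemma smooth_on_vec_lambda:
  fixes f :: "'a::real_normed_vector \<Rightarrow> 'n::finite \<Rightarrow> 'b::real_normed_vector"
  assumes "\<And>i. smooth_on S (\<lambda>x. f x i)" "open S"
  shows "smooth_on S (\<lambda>x. \<chi> i. f x i)"
  unfolding vec_lambda_sum_axis
  by (intro smooth_on_sum smooth_on_bounded_linear[OF bounded_linear_axis] assms)

text \<open>Two second-order difference quotients at \<open>x\<close> agree, and each of them is a mixed derivative
  at an intermediate point.\<close>

lemma mixed_difference:
  fixes f :: "'a::real_normed_vector \<Rightarrow> real"
  assumes "smooth_on S f" "open S" "0 < s"
    and S: "\<And>a b. \<lbrakk>0 \<le> a; a \<le> s; 0 \<le> b; b \<le> s\<rbrakk> \<Longrightarrow> x + a *\<^sub>R v + b *\<^sub>R w \<in> S"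
  shows "\<exists>a b. 0 < a \<and> a < s \<and> 0 < b \<and> b < s \<and>
    f (x + s *\<^sub>R v + s *\<^sub>R w) - f (x + s *\<^sub>R v) - f (x + s *\<^sub>R w) + f x
      = s * (s * der (\<lambda>y. der f y v) (x + a *\<^sub>R v + b *\<^sub>R w) w)"
proof -
  \<comment> \<open>The second difference is \<open>g s - g 0\<close>. The mean value theorem for
    \<open>g\<close>, in direction \<open>v\<close>, and then for \<open>k\<close>, in direction
    \<open>w\<close>, turns it into \<open>s * s\<close> times a mixed derivative.\<close>
  define g where "g t = f (x + t *\<^sub>R v + s *\<^sub>R w) - f (x + t *\<^sub>R v)" for t
  have df: "((\<lambda>t. f (x + t *\<^sub>R v + b *\<^sub>R w)) has_derivative (\<lambda>h. h * der f (x + t *\<^sub>R v + b *\<^sub>R w) v)) (at t)"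
    if "0 \<le> t" "t \<le> s" "0 \<le> b" "b \<le> s" for t b
  proof -
    have "((\<lambda>t. f (x + t *\<^sub>R v + b *\<^sub>R w)) has_derivative (\<lambda>h. der f (x + t *\<^sub>R v + b *\<^sub>R w) (h *\<^sub>R v))) (at t)"
      by (rule has_derivative_compose[where g = f and f = "\<lambda>t. x + t *\<^sub>R v + b *\<^sub>R w",
            OF _ smooth_on_has_derivative[OF assms(1,2) S[OF that]]])
        (auto intro!: derivative_eq_intros)
    then show ?thesis
      using smooth_on_linear_der[OF assms(1,2) S[OF that]] by (simp add: linear_cmul)
  qed
  have dg: "(g has_derivative (\<lambda>h. h * (der f (x + t *\<^sub>R v + s *\<^sub>R w) v - der f (x + t *\<^sub>R v) v))) (at t)"
    if "0 \<le> t" "t \<le> s" for t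
    unfolding g_def using df[OF that, of s] df[OF that, of 0] \<open>0 < s\<close>
    by (auto intro!: derivative_eq_intros simp: algebra_simps)
  obtain a where a: "0 < a" "a < s" "g s - g 0 = s * (der f (x + a *\<^sub>R v + s *\<^sub>R w) v - der f (x + a *\<^sub>R v) v)"
    using mvt_simple[of 0 s g "\<lambda>t h. h * (der f (x + t *\<^sub>R v + s *\<^sub>R w) v - der f (x + t *\<^sub>R v) v)"]
      has_derivative_at_withinI[OF dg] \<open>0 < s\<close> by auto
  define k where "k t = der f (x + a *\<^sub>R v + t *\<^sub>R w) v" for t
  have dk: "(k has_derivative (\<lambda>h. h * der (\<lambda>y. der f y v) (x + a *\<^sub>R v + t *\<^sub>R w) w)) (at t)"
    if "0 \<le> t" "t \<le> s" for t
  proof -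
    have sm: "smooth_on S (\<lambda>y. der f y v)" using assms(1,2) by (rule smooth_on_der)
    have S': "x + a *\<^sub>R v + t *\<^sub>R w \<in> S" using a that by (intro S) auto
    have "(k has_derivative (\<lambda>h. der (\<lambda>y. der f y v) (x + a *\<^sub>R v + t *\<^sub>R w) (h *\<^sub>R w))) (at t)"
      unfolding k_def
      by (rule has_derivative_compose[where g = "\<lambda>y. der f y v" and f = "\<lambda>t. x + a *\<^sub>R v + t *\<^sub>R w", OF _ smooth_on_has_derivative[OF sm assms(2) S']])
        (auto intro!: derivative_eq_intros)
    then show ?thesis
      using smooth_on_linear_der[OF sm assms(2) S'] by (simp add: linear_cmul)
  qed
  obtain b where b: "0 < b" "b < s" "k s - k 0 = s * der (\<lambda>y. der f y v) (x + a *\<^sub>R v + b *\<^sub>R w) w"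
    using mvt_simple[of 0 s k "\<lambda>t h. h * der (\<lambda>y. der f y v) (x + a *\<^sub>R v + t *\<^sub>R w) w"]
      has_derivative_at_withinI[OF dk] \<open>0 < s\<close> by auto
  have "g s - g 0 = s * (s * der (\<lambda>y. der f y v) (x + a *\<^sub>R v + b *\<^sub>R w) w)"
    using a b by (simp add: k_def)
  then show ?thesis using a(1,2) b(1,2) by (force simp: g_def algebra_simps)
qed

lemma der_commute_real:
  fixes f :: "'a::real_normed_vector \<Rightarrow> real"
  assumes "smooth_on S f" "open S" "x \<in> S"
  shows "der (\<lambda>y. der f y v) x w = der (\<lambda>y. der f y w) x v"
proof (rule ccontr)
  define F where "F = (\<lambda>y. der (\<lambda>y. der f y v) y w)"
  define G where "G = (\<lambda>y. der (\<lambda>y. der f y w) y v)"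
  \<comment> \<open>If the two mixed derivatives differed at \<open>x\<close>, then on a small ball
    \<open>F\<close> and \<open>G\<close> would stay within half the gap of their values at
    \<open>x\<close>. But \<open>mixed_difference\<close>, used with \<open>v\<close>,
    \<open>w\<close> and with the roles exchanged, expresses the same second difference through
    \<open>F\<close> at one point of the ball and \<open>G\<close> at another.\<close>
  assume "\<not> ?thesis"
  then have ne: "0 < \<bar>F x - G x\<bar> / 2" by (simp add: F_def G_def)
  have "isCont (\<lambda>y. der (\<lambda>y. der f y v) y w) x" for v w
    using smooth_on_continuous_on[OF smooth_on_der[OF smooth_on_der[OF assms(1,2)] assms(2)]] assms(3)
    by (simp add: continuous_on_eq_continuous_at[OF assms(2)])
  then have "isCont F x" "isCont G x" by (simp_all add: F_def G_def)
  then have "\<forall>\<^sub>F y in nhds x. dist (F y) (F x) < \<bar>F x - G x\<bar> / 2"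
    "\<forall>\<^sub>F y in nhds x. dist (G y) (G x) < \<bar>F x - G x\<bar> / 2"
    using ne by (auto simp only: isCont_def tendsto_at_iff_tendsto_nhds intro: tendstoD)
  moreover have "\<forall>\<^sub>F y in nhds x. y \<in> S"
    using assms eventually_nhds by blast
  ultimately have "\<forall>\<^sub>F y in nhds x. y \<in> S \<and> dist (F y) (F x) < \<bar>F x - G x\<bar> / 2 \<and> dist (G y) (G x) < \<bar>F x - G x\<bar> / 2"
    by eventually_elim auto
  then obtain e where e: "0 < e" "\<And>y. dist y x < e \<Longrightarrow>
      y \<in> S \<and> dist (F y) (F x) < \<bar>F x - G x\<bar> / 2 \<and> dist (G y) (G x) < \<bar>F x - G x\<bar> / 2"
    unfolding eventually_nhds_metric by blast
  \<comment> \<open>Small enough for the parallelogram with sides \<open>s *\<^sub>R v\<close> and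
    \<open>s *\<^sub>R w\<close> to lie in the ball; the \<open>+ 1\<close> keeps the denominator
    positive when both vectors are 0.\<close>
  define s where "s = e / (norm v + norm w + 1)"
  have den: "0 < norm v + norm w + 1" by (simp add: add_nonneg_pos)
  then have s: "0 < s" using e by (simp add: s_def)
  have near: "dist (x + a *\<^sub>R v + b *\<^sub>R w) x < e" if "0 \<le> a" "a \<le> s" "0 \<le> b" "b \<le> s" for a b
  proof -
    have "dist (x + a *\<^sub>R v + b *\<^sub>R w) x \<le> a * norm v + b * norm w"
      using norm_triangle_ineq[of "a *\<^sub>R v" "b *\<^sub>R w"] that by (simp add: dist_norm add.assoc)
    also have "\<dots> \<le> s * norm v + s * norm w"
      using that by (intro add_mono mult_right_mono) auto
    also have "\<dots> < s * (norm v + norm w + 1)" using s by (simp add: algebra_simps)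
    also have "\<dots> = e" using den by (simp add: s_def)
    finally show ?thesis .
  qed
  then have near': "x + a *\<^sub>R v + b *\<^sub>R w \<in> S" "x + b *\<^sub>R w + a *\<^sub>R v \<in> S"
    if "0 \<le> a" "a \<le> s" "0 \<le> b" "b \<le> s" for a b
    using e(2) that by (auto simp: add_ac)
  obtain a b where ab: "0 < a" "a < s" "0 < b" "b < s"
    "f (x + s *\<^sub>R v + s *\<^sub>R w) - f (x + s *\<^sub>R v) - f (x + s *\<^sub>R w) + f x = s * (s * F (x + a *\<^sub>R v + b *\<^sub>R w))"
    using mixed_difference[OF assms(1,2) s near'(1)] unfolding F_def by blast
  obtain c d where cd: "0 < c" "c < s" "0 < d" "d < s"
    "f (x + s *\<^sub>R w + s *\<^sub>R v) - f (x + s *\<^sub>R w) - f (x + s *\<^sub>R v) + f x = s * (s * G (x + c *\<^sub>R w + d *\<^sub>R v))"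
    using mixed_difference[OF assms(1,2) s near'(2)] unfolding G_def by blast
  have "s * (s * F (x + a *\<^sub>R v + b *\<^sub>R w)) = s * (s * G (x + d *\<^sub>R v + c *\<^sub>R w))"
    using ab(5) cd(5) add.commute[of "s *\<^sub>R v" "s *\<^sub>R w"] add.commute[of "c *\<^sub>R w" "d *\<^sub>R v"]
    by (simp only: add.assoc)
  then have "F (x + a *\<^sub>R v + b *\<^sub>R w) = G (x + d *\<^sub>R v + c *\<^sub>R w)" using s by simp
  moreover have "dist (F (x + a *\<^sub>R v + b *\<^sub>R w)) (F x) < \<bar>F x - G x\<bar> / 2"
    using e(2)[OF near] ab by auto
  moreover have "dist (G (x + d *\<^sub>R v + c *\<^sub>R w)) (G x) < \<bar>F x - G x\<bar> / 2"
    using e(2)[OF near] cd by auto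
  ultimately show False by (auto simp: dist_real_def abs_if split: if_splits)
qed

lemma der_commute:
  fixes f :: "'a::real_normed_vector \<Rightarrow> 'b::euclidean_space"
  assumes "smooth_on S f" "open S" "x \<in> S"
  shows "der (\<lambda>y. der f y v) x w = der (\<lambda>y. der f y w) x v"
proof (rule euclidean_eqI)
  fix b :: 'b assume "b \<in> Basis"
  have sm: "smooth_on S (\<lambda>y. f y \<bullet> b)"
    using assms by (intro smooth_on_bounded_linear[OF bounded_linear_inner_left])
  have inner: "der (\<lambda>y. h y \<bullet> b) y v = der h y v \<bullet> b" if "smooth_on S h" "y \<in> S" for h :: "'a \<Rightarrow> 'b" and y v
  proof -
    have "((\<lambda>y. h y \<bullet> b) has_derivative (\<lambda>v. der h y v \<bullet> b)) (at y)"
      using smooth_on_has_derivative[OF that(1) assms(2) that(2)]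
      by (rule bounded_linear.has_derivative[OF bounded_linear_inner_left])
    then show ?thesis by (simp add: der_eqI)
  qed
  have "der (\<lambda>y. der f y v) x w \<bullet> b = der (\<lambda>y. der (\<lambda>y. f y \<bullet> b) y v) x w" for v w
    using assms inner smooth_on_der
    by (subst inner[symmetric], blast, blast) (rule der_cong[THEN fun_cong], auto)
  then show "der (\<lambda>y. der f y v) x w \<bullet> b = der (\<lambda>y. der f y w) x v \<bullet> b"
    using der_commute_real[OF sm assms(2,3)] by simp
qed

lemma has_derivative_linear_app:
  fixes L :: "'a::real_normed_vector \<Rightarrow> 'b::euclidean_space \<Rightarrow> 'c::real_normed_vector"
  assumes S: "open S" "x \<in> S"
    and lin: "\<And>y. y \<in> S \<Longrightarrow> linear (L y)"
    and L: "\<And>b. ((\<lambda>y. L y b) has_derivative (\<lambda>w. L' w b)) (at x)"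
    and f: "(f has_derivative f') (at x)"
  shows "((\<lambda>y. L y (f y)) has_derivative (\<lambda>w. L' w (f x) + L x (f' w))) (at x)"
proof -
  \<comment> \<open>\<open>L'\<close> inherits linearity in its second argument from
    \<open>L\<close>, because derivatives are unique.\<close>
  have expand: "L' w v = (\<Sum>b\<in>Basis. (v \<bullet> b) *\<^sub>R L' w b)" for w v
  proof -
    have "((\<lambda>y. \<Sum>b\<in>Basis. (v \<bullet> b) *\<^sub>R L y b) has_derivative (\<lambda>w. \<Sum>b\<in>Basis. (v \<bullet> b) *\<^sub>R L' w b)) (at x)"
      by (intro derivative_intros L)
    then have "((\<lambda>y. L y v) has_derivative (\<lambda>w. \<Sum>b\<in>Basis. (v \<bullet> b) *\<^sub>R L' w b)) (at x)"
      by (rule has_derivative_transform_within_open[OF _ S]) (use linear_Basis_expansion lin in metis)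
    then show ?thesis using has_derivative_unique[OF L] by metis
  qed
  have "((\<lambda>y. \<Sum>b\<in>Basis. (f y \<bullet> b) *\<^sub>R L y b) has_derivative
      (\<lambda>w. \<Sum>b\<in>Basis. (f x \<bullet> b) *\<^sub>R L' w b + (f' w \<bullet> b) *\<^sub>R L x b)) (at x)"
    by (intro derivative_intros L f)
  moreover have "(\<Sum>b\<in>Basis. (f x \<bullet> b) *\<^sub>R L' w b + (f' w \<bullet> b) *\<^sub>R L x b) = L' w (f x) + L x (f' w)" for w
    by (simp add: sum.distrib expand[of w "f x"] linear_Basis_expansion[OF lin[OF S(2)], of "f' w"])
  ultimately have "((\<lambda>y. \<Sum>b\<in>Basis. (f y \<bullet> b) *\<^sub>R L y b) has_derivative (\<lambda>w. L' w (f x) + L x (f' w))) (at x)"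
    by simp
  then show ?thesis
    by (rule has_derivative_transform_within_open[OF _ S]) (use linear_Basis_expansion lin in metis)
qed

section \<open>Torsion-free connections on open sets of Euclidean space\<close>

definition cov_der :: "('e \<Rightarrow> 'e \<Rightarrow> 'e \<Rightarrow> 'e) \<Rightarrow> 'e::real_normed_vector \<Rightarrow> 'e \<Rightarrow> ('e \<Rightarrow> 'e) \<Rightarrow> 'e" where
  "cov_der \<Gamma> y v F = der F y v + \<Gamma> y v (F y)"

definition coord_curv :: "('e \<Rightarrow> 'e \<Rightarrow> 'e \<Rightarrow> 'e) \<Rightarrow> 'e::real_normed_vector \<Rightarrow> 'e \<Rightarrow> 'e \<Rightarrow> 'e \<Rightarrow> 'e" where
  "coord_curv \<Gamma> y a b c = der (\<lambda>z. \<Gamma> z b c) y a - der (\<lambda>z. \<Gamma> z a c) y b + \<Gamma> y a (\<Gamma> y b c) - \<Gamma> y b (\<Gamma> y a c)"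

definition coord_curv_deriv ::
    "('e \<Rightarrow> 'e \<Rightarrow> 'e \<Rightarrow> 'e) \<Rightarrow> 'e::real_normed_vector \<Rightarrow> 'e \<Rightarrow> 'e \<Rightarrow> 'e \<Rightarrow> 'e \<Rightarrow> 'e" where
  "coord_curv_deriv \<Gamma> y w a b c = der (\<lambda>z. coord_curv \<Gamma> z a b c) y w + \<Gamma> y w (coord_curv \<Gamma> y a b c)
     - coord_curv \<Gamma> y (\<Gamma> y w a) b c - coord_curv \<Gamma> y a (\<Gamma> y w b) c - coord_curv \<Gamma> y a b (\<Gamma> y w c)"

lemmas linear_rules = linear_add linear_diff linear_neg linear_0 linear_cmul

text \<open>Christoffel symbols on an open set; \<open>sym\<close> is the vanishing of the torsion.
  The base chart and the chart of the frame bundle are both instances.\<close>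

locale coord_connection =
  fixes S :: "'e::euclidean_space set" and \<Gamma> :: "'e \<Rightarrow> 'e \<Rightarrow> 'e \<Rightarrow> 'e"
  assumes open_S: "open S"
    and smooth: "\<And>a b. smooth_on S (\<lambda>y. \<Gamma> y a b)"
    and lin1: "\<And>y b. y \<in> S \<Longrightarrow> linear (\<lambda>a. \<Gamma> y a b)"
    and lin2: "\<And>y a. y \<in> S \<Longrightarrow> linear (\<Gamma> y a)"
    and sym: "\<And>y a b. y \<in> S \<Longrightarrow> \<Gamma> y a b = \<Gamma> y b a"
begin

abbreviation "R \<equiv> coord_curv \<Gamma>"
abbreviation "dR \<equiv> coord_curv_deriv \<Gamma>"
abbreviation "d\<Gamma> y w a b \<equiv> der (\<lambda>z. \<Gamma> z a b) y w"

lemma Gamma_simps: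
  assumes "y \<in> S"
  shows "\<Gamma> y (a + b) c = \<Gamma> y a c + \<Gamma> y b c" "\<Gamma> y c (a + b) = \<Gamma> y c a + \<Gamma> y c b"
    "\<Gamma> y (a - b) c = \<Gamma> y a c - \<Gamma> y b c" "\<Gamma> y c (a - b) = \<Gamma> y c a - \<Gamma> y c b"
    "\<Gamma> y (- a) c = - \<Gamma> y a c" "\<Gamma> y c (- a) = - \<Gamma> y c a"
    "\<Gamma> y 0 c = 0" "\<Gamma> y c 0 = 0"
    "\<Gamma> y (r *\<^sub>R a) c = r *\<^sub>R \<Gamma> y a c" "\<Gamma> y c (r *\<^sub>R a) = r *\<^sub>R \<Gamma> y c a"
  using linear_rules[OF lin1[OF assms]] linear_rules[OF lin2[OF assms]] by simp_all

lemma Gamma_has_derivative: "y \<in> S \<Longrightarrow> ((\<lambda>z. \<Gamma> z a b) has_derivative (\<lambda>w. d\<Gamma> y w a b)) (at y)"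
  using smooth_on_has_derivative[OF smooth open_S] by simp

text \<open>Stated along a map \<open>\<pi>\<close> because on the bundle the symbols of the base
  are evaluated at the foot point of a frame, with \<open>\<pi> = fst\<close>. The identity map
  gives the version on the base.\<close>

lemma Gamma_along_has_derivative:
  assumes N: "open N" "x \<in> N" "\<And>z. z \<in> N \<Longrightarrow> \<pi> z \<in> S" and \<pi>: "(\<pi> has_derivative \<pi>') (at x)"
    and f: "(f has_derivative f') (at x)" and h: "(h has_derivative h') (at x)"
  shows "((\<lambda>z. \<Gamma> (\<pi> z) (f z) (h z)) has_derivative
    (\<lambda>w. d\<Gamma> (\<pi> x) (\<pi>' w) (f x) (h x) + \<Gamma> (\<pi> x) (f x) (h' w) + \<Gamma> (\<pi> x) (f' w) (h x))) (at x)"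
proof -
  have 0: "((\<lambda>z. \<Gamma> (\<pi> z) a b) has_derivative (\<lambda>w. d\<Gamma> (\<pi> x) (\<pi>' w) a b)) (at x)" for a b
    by (rule has_derivative_compose[OF \<pi> Gamma_has_derivative[OF N(3)[OF N(2)]]])
  have 1: "((\<lambda>z. \<Gamma> (\<pi> z) a (h z)) has_derivative (\<lambda>w. d\<Gamma> (\<pi> x) (\<pi>' w) a (h x) + \<Gamma> (\<pi> x) a (h' w))) (at x)" for a
    by (rule has_derivative_linear_app[OF N(1,2) lin2[OF N(3)] 0 h])
  show ?thesis by (rule has_derivative_linear_app[OF N(1,2) lin1[OF N(3)] 1 f])
qed

lemmas Gamma_app_has_derivative =
  Gamma_along_has_derivative[OF open_S _ _ has_derivative_ident, simplified]

lemma linear_dGamma: "y \<in> S \<Longrightarrow> linear (\<lambda>w. d\<Gamma> y w a b)"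
  using smooth_on_linear_der[OF smooth open_S] by simp

lemma linear_dGamma2: "y \<in> S \<Longrightarrow> linear (\<lambda>a. d\<Gamma> y w a b)"
proof
  fix a a' and r :: real assume y: "y \<in> S"
  note d = Gamma_has_derivative[OF y]
  have "((\<lambda>z. \<Gamma> z (a + a') b) has_derivative (\<lambda>w. d\<Gamma> y w a b + d\<Gamma> y w a' b)) (at y)"
    by (rule has_derivative_transform_within_open[OF has_derivative_add[OF d d] open_S y])
      (simp add: Gamma_simps)
  then show "d\<Gamma> y w (a + a') b = d\<Gamma> y w a b + d\<Gamma> y w a' b" by (simp add: der_eqI)
  have "((\<lambda>z. \<Gamma> z (r *\<^sub>R a) b) has_derivative (\<lambda>w. r *\<^sub>R d\<Gamma> y w a b)) (at y)"
    by (rule has_derivative_transform_within_open[OF has_derivative_scaleR_right[OF d] open_S y])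
      (simp add: Gamma_simps)
  then show "d\<Gamma> y w (r *\<^sub>R a) b = r *\<^sub>R d\<Gamma> y w a b" by (simp add: der_eqI)
qed

lemma dGamma_sym: "y \<in> S \<Longrightarrow> d\<Gamma> y w a b = d\<Gamma> y w b a"
  using der_cong[OF open_S, of y "\<lambda>z. \<Gamma> z a b" "\<lambda>z. \<Gamma> z b a"] sym by metis

lemma linear_dGamma3: "y \<in> S \<Longrightarrow> linear (\<lambda>b. d\<Gamma> y w a b)"
  using linear_dGamma2[of y a w] by (simp add: dGamma_sym[of y a])

lemma smooth_cov_der:
  assumes "smooth_on N F" "smooth_on N Y" "open N" "N \<subseteq> S"
  shows "smooth_on N (\<lambda>y. cov_der \<Gamma> y (Y y) F)"
proof -
  have 1: "smooth_on N (\<lambda>y. \<Gamma> y a b)" for a b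
    by (rule smooth_on_open_subset[OF smooth assms(3,4)])
  have 2: "smooth_on N (\<lambda>y. \<Gamma> y a (F y))" for a
    by (rule smooth_on_linear_app[OF 1 lin2 assms(1,3)]) (use assms in auto)
  have "smooth_on N (\<lambda>y. \<Gamma> y (Y y) (F y))"
    by (rule smooth_on_linear_app[OF 2 lin1 assms(2,3)]) (use assms in auto)
  then show ?thesis unfolding cov_der_def
    by (intro smooth_on_add smooth_on_der_app assms)
qed

text \<open>The torsion vanishes, so \<open>\<nabla>\<^sub>X Y - \<nabla>\<^sub>Y X\<close> stands for the Lie bracket.\<close>

lemma curvature_fields:
  assumes "smooth_on N X" "smooth_on N Y" "smooth_on N Z" and N: "open N" "N \<subseteq> S" "y \<in> N"
  shows "cov_der \<Gamma> y (X y) (\<lambda>z. cov_der \<Gamma> z (Y z) Z) - cov_der \<Gamma> y (Y y) (\<lambda>z. cov_der \<Gamma> z (X z) Z)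
    - cov_der \<Gamma> y (cov_der \<Gamma> y (X y) Y - cov_der \<Gamma> y (Y y) X) Z = R y (X y) (Y y) (Z y)"
proof -
  have yS: "y \<in> S" using N by auto
  note d = smooth_on_has_derivative[OF _ N(1,3)]
  have dd: "der (\<lambda>z. cov_der \<Gamma> z (Y z) Z) y w =
      der (\<lambda>z. der Z z (Y y)) y w + der Z y (der Y y w) + (d\<Gamma> y w (Y y) (Z y) + \<Gamma> y (Y y) (der Z y w) + \<Gamma> y (der Y y w) (Z y))"
    if "smooth_on N Y" for Y w
  proof -
    have 1: "((\<lambda>z. der Z z (Y z)) has_derivative (\<lambda>w. der (\<lambda>z. der Z z (Y y)) y w + der Z y (der Y y w))) (at y)"
      by (rule has_derivative_linear_app[OF N(1,3) smooth_on_linear_der[OF assms(3) N(1)]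
            d[OF smooth_on_der[OF assms(3) N(1)]] d[OF that]])
    show ?thesis unfolding cov_der_def
      using has_derivative_add[OF 1 Gamma_app_has_derivative[OF yS d[OF that] d[OF assms(3)]]]
      by (simp add: der_eqI)
  qed
  have lin: "der Z y (a - b) = der Z y a - der Z y b" "der Z y (a + b) = der Z y a + der Z y b" for a b
    using smooth_on_linear_der[OF assms(3) N(1,3)] by (simp_all add: linear_diff linear_add)
  \<comment> \<open>Symmetry of second derivatives removes the second-order terms in
    \<open>Z\<close>, so that only its value at \<open>y\<close> survives.\<close>
  have cl: "der (\<lambda>z. der Z z (Y y)) y (X y) = der (\<lambda>z. der Z z (X y)) y (Y y)"
    by (rule der_commute[OF assms(3) N(1,3)])
  show ?thesis
    unfolding coord_curv_def
    by (simp add: cov_der_def[of \<Gamma> y] dd[OF assms(1)] dd[OF assms(2)])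
      (simp add: cov_der_def Gamma_simps[OF yS] cl lin sym[OF yS, of "Y y" "X y"] algebra_simps)
qed

lemma R_linear:
  assumes y: "y \<in> S"
  shows "linear (\<lambda>a. R y a b c)" "linear (\<lambda>b. R y a b c)" "linear (\<lambda>c. R y a b c)"
proof -
  show "linear (\<lambda>a. R y a b c)"
    unfolding coord_curv_def
    using lin1[OF y] lin2[OF y] linear_dGamma[OF y] linear_dGamma2[OF y] linear_dGamma3[OF y]
      linear_compose[OF lin1[OF y] lin2[OF y], unfolded o_def]
    by (intro linear_compose_add linear_compose_sub)
  show "linear (\<lambda>b. R y a b c)"
    unfolding coord_curv_def
    using lin1[OF y] lin2[OF y] linear_dGamma[OF y] linear_dGamma2[OF y] linear_dGamma3[OF y]
      linear_compose[OF lin1[OF y] lin2[OF y], unfolded o_def]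
    by (intro linear_compose_add linear_compose_sub)
  show "linear (\<lambda>c. R y a b c)"
    unfolding coord_curv_def
    using lin1[OF y] lin2[OF y] linear_dGamma[OF y] linear_dGamma2[OF y] linear_dGamma3[OF y]
      linear_compose[OF lin2[OF y] lin2[OF y], unfolded o_def]
    by (intro linear_compose_add linear_compose_sub)
qed

lemma R_simps:
  assumes "y \<in> S"
  shows "R y (a + b) c d = R y a c d + R y b c d" "R y c (a + b) d = R y c a d + R y c b d" "R y c d (a + b) = R y c d a + R y c d b"
    "R y (a - b) c d = R y a c d - R y b c d" "R y c (a - b) d = R y c a d - R y c b d" "R y c d (a - b) = R y c d a - R y c d b"
    "R y (- a) c d = - R y a c d" "R y c (- a) d = - R y c a d" "R y c d (- a) = - R y c d a"
    "R y 0 c d = 0" "R y c 0 d = 0" "R y c d 0 = 0"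
    "R y (r *\<^sub>R a) c d = r *\<^sub>R R y a c d" "R y c (r *\<^sub>R a) d = r *\<^sub>R R y c a d" "R y c d (r *\<^sub>R a) = r *\<^sub>R R y c d a"
  using linear_rules[OF R_linear(1)[OF assms]] linear_rules[OF R_linear(2)[OF assms]]
    linear_rules[OF R_linear(3)[OF assms]] by simp_all

lemma smooth_Gamma_Gamma: "smooth_on S (\<lambda>y. \<Gamma> y a (\<Gamma> y b c))"
  by (rule smooth_on_linear_app[OF smooth lin2 smooth open_S])

lemma smooth_R: "smooth_on S (\<lambda>y. R y a b c)"
  unfolding coord_curv_def
  by (intro smooth_on_add smooth_on_diff smooth_on_der smooth smooth_Gamma_Gamma open_S)

lemma R_has_derivative: "y \<in> S \<Longrightarrow> ((\<lambda>z. R z a b c) has_derivative (\<lambda>w. der (\<lambda>z. R z a b c) y w)) (at y)"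
  using smooth_on_has_derivative[OF smooth_R open_S] by simp

lemma R_along_has_derivative:
  assumes N: "open N" "x \<in> N" "\<And>z. z \<in> N \<Longrightarrow> \<pi> z \<in> S" and \<pi>: "(\<pi> has_derivative \<pi>') (at x)"
    and f: "(f has_derivative f') (at x)" and h: "(h has_derivative h') (at x)" and k: "(k has_derivative k') (at x)"
  shows "((\<lambda>z. R (\<pi> z) (f z) (h z) (k z)) has_derivative
    (\<lambda>w. der (\<lambda>z. R z (f x) (h x) (k x)) (\<pi> x) (\<pi>' w) + R (\<pi> x) (f x) (h x) (k' w)
      + R (\<pi> x) (f x) (h' w) (k x) + R (\<pi> x) (f' w) (h x) (k x))) (at x)"
proof -
  have 0: "((\<lambda>z. R (\<pi> z) a b c) has_derivative (\<lambda>w. der (\<lambda>z. R z a b c) (\<pi> x) (\<pi>' w))) (at x)" for a b c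
    by (rule has_derivative_compose[OF \<pi> R_has_derivative[OF N(3)[OF N(2)]]])
  have 1: "((\<lambda>z. R (\<pi> z) a b (k z)) has_derivative
      (\<lambda>w. der (\<lambda>z. R z a b (k x)) (\<pi> x) (\<pi>' w) + R (\<pi> x) a b (k' w))) (at x)" for a b
    by (rule has_derivative_linear_app[OF N(1,2) R_linear(3)[OF N(3)] 0 k])
  have 2: "((\<lambda>z. R (\<pi> z) a (h z) (k z)) has_derivative
      (\<lambda>w. der (\<lambda>z. R z a (h x) (k x)) (\<pi> x) (\<pi>' w) + R (\<pi> x) a (h x) (k' w) + R (\<pi> x) a (h' w) (k x))) (at x)" for a
    by (rule has_derivative_linear_app[OF N(1,2) R_linear(2)[OF N(3)] 1 h])
  show ?thesis
    by (rule has_derivative_linear_app[OF N(1,2) R_linear(1)[OF N(3)] 2 f])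
qed

lemmas R_app_has_derivative =
  R_along_has_derivative[OF open_S _ _ has_derivative_ident, simplified]

lemma smooth_R_app:
  assumes "smooth_on N f" "smooth_on N h" "smooth_on N k" "open N" "N \<subseteq> S"
  shows "smooth_on N (\<lambda>y. R y (f y) (h y) (k y))"
proof -
  have 0: "smooth_on N (\<lambda>y. R y a b c)" for a b c
    by (rule smooth_on_open_subset[OF smooth_R assms(4,5)])
  have 1: "smooth_on N (\<lambda>y. R y a b (k y))" for a b
    by (rule smooth_on_linear_app[OF 0 R_linear(3) assms(3,4)]) (use assms in auto)
  have 2: "smooth_on N (\<lambda>y. R y a (h y) (k y))" for a
    by (rule smooth_on_linear_app[OF 1 R_linear(2) assms(2,4)]) (use assms in auto)
  show ?thesis
    by (rule smooth_on_linear_app[OF 2 R_linear(1) assms(1,4)]) (use assms in auto)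
qed

lemma curvature_deriv_fields:
  assumes "smooth_on N X" "smooth_on N Y" "smooth_on N Z" and N: "open N" "N \<subseteq> S" "y \<in> N"
  shows "cov_der \<Gamma> y w (\<lambda>z. R z (X z) (Y z) (Z z)) - R y (cov_der \<Gamma> y w X) (Y y) (Z y)
    - R y (X y) (cov_der \<Gamma> y w Y) (Z y) - R y (X y) (Y y) (cov_der \<Gamma> y w Z) = dR y w (X y) (Y y) (Z y)"
proof -
  have yS: "y \<in> S" using N by auto
  note d = smooth_on_has_derivative[OF _ N(1,3)]
  show ?thesis
    by (simp add: cov_der_def coord_curv_deriv_def R_simps[OF yS]
        der_eqI[OF R_app_has_derivative[OF yS d[OF assms(1)] d[OF assms(2)] d[OF assms(3)]]])
qed

section \<open>The Bianchi identities\<close>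

lemma R_skew: "R y a b c = - R y b a c"
  by (simp add: coord_curv_def)

lemma Bianchi1: "y \<in> S \<Longrightarrow> R y a b c + R y b c a + R y c a b = 0"
  by (simp add: coord_curv_def sym[of y c a] sym[of y c b] sym[of y b a] dGamma_sym[of y c a]
      dGamma_sym[of y c b] dGamma_sym[of y b a])

lemma der_R:
  assumes y: "y \<in> S"
  shows "der (\<lambda>z. R z a b c) y w = der (\<lambda>z. d\<Gamma> z a b c) y w - der (\<lambda>z. d\<Gamma> z b a c) y w
    + (d\<Gamma> y w a (\<Gamma> y b c) + \<Gamma> y a (d\<Gamma> y w b c)) - (d\<Gamma> y w b (\<Gamma> y a c) + \<Gamma> y b (d\<Gamma> y w a c))"
proof -
  have 1: "((\<lambda>z. d\<Gamma> z a b c) has_derivative (\<lambda>w. der (\<lambda>z. d\<Gamma> z a b c) y w)) (at y)" for a b c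
    using smooth_on_has_derivative[OF smooth_on_der[OF smooth open_S] open_S y] by simp
  have 2: "((\<lambda>z. \<Gamma> z a (\<Gamma> z b c)) has_derivative (\<lambda>w. d\<Gamma> y w a (\<Gamma> y b c) + \<Gamma> y a (d\<Gamma> y w b c))) (at y)" for a b c
    by (rule has_derivative_linear_app[OF open_S y lin2 Gamma_has_derivative[OF y] Gamma_has_derivative[OF y]])
  show ?thesis unfolding coord_curv_def
    using der_eqI[OF has_derivative_diff[OF has_derivative_add[OF has_derivative_diff[OF 1[where a=a and b=b and c=c] 1[where a=b and b=a and c=c]] 2[of a b c]] 2[of b a c]]]
    by simp
qed

text \<open>In the cyclic sum the corrections for the first two slots of \<open>R\<close> cancel in
  pairs, by symmetry of \<open>\<Gamma>\<close> and skewness of \<open>R\<close>. What remains is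
  the cyclic sum of derivatives of \<open>R\<close> and of its commutators with
  \<open>\<Gamma>\<close>; there the second derivatives of \<open>\<Gamma>\<close> cancel by
  \<open>der_commute\<close> and the lower-order terms cancel algebraically.\<close>

lemma Bianchi2:
  assumes y: "y \<in> S"
  shows "dR y w a b c + dR y a b w c + dR y b w a c = 0"
proof -
  have cl: "der (\<lambda>z. d\<Gamma> z a b c) y w = der (\<lambda>z. d\<Gamma> z w b c) y a" for a b c w
    by (rule der_commute[OF smooth open_S y])
  have "dR y w a b c = (der (\<lambda>z. R z a b c) y w + \<Gamma> y w (R y a b c) - R y a b (\<Gamma> y w c))
      - R y (\<Gamma> y w a) b c + R y (\<Gamma> y w b) a c" for w a b
    by (simp add: coord_curv_deriv_def R_skew[of y a "\<Gamma> y w b"])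
  then have "dR y w a b c + dR y a b w c + dR y b w a c =
      (der (\<lambda>z. R z a b c) y w + \<Gamma> y w (R y a b c) - R y a b (\<Gamma> y w c))
    + (der (\<lambda>z. R z b w c) y a + \<Gamma> y a (R y b w c) - R y b w (\<Gamma> y a c))
    + (der (\<lambda>z. R z w a c) y b + \<Gamma> y b (R y w a c) - R y w a (\<Gamma> y b c))"
    by (simp add: sym[OF y, of b w] sym[OF y, of a w] sym[OF y, of b a])
  also have "\<dots> = 0"
    by (simp add: der_R[OF y] cl[where a=a and b=b and w=w] cl[where a=b and b=a and w=w] cl[where a=b and b=w and w=a])
      (simp add: coord_curv_def Gamma_simps[OF y])
  finally show ?thesis .
qed

lemma dR_skew: "y \<in> S \<Longrightarrow> dR y w a b c = - dR y w b a c"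
proof -
  assume y: "y \<in> S"
  have "((\<lambda>z. - R z b a c) has_derivative (\<lambda>w. - der (\<lambda>z. R z b a c) y w)) (at y)"
    by (intro has_derivative_minus R_has_derivative[OF y])
  then have "der (\<lambda>z. R z a b c) y w = - der (\<lambda>z. R z b a c) y w"
    using R_skew[of _ a b c] by (simp add: der_eqI)
  then show ?thesis
    by (simp add: coord_curv_deriv_def R_skew[of y a b] R_skew[of y b "\<Gamma> y w a"] R_skew[of y "\<Gamma> y w b" a] Gamma_simps[OF y])
qed

end

section \<open>The metric and the symmetries of the curvature tensor\<close>

locale coord_levi_civita = coord_connection +
  fixes G :: "'a::euclidean_space \<Rightarrow> 'a \<Rightarrow> 'a \<Rightarrow> real"
  assumes smooth_G: "\<And>a b. smooth_on S (\<lambda>y. G y a b)"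
    and linG: "\<And>y a. y \<in> S \<Longrightarrow> linear (G y a)"
    and symG: "\<And>y a b. y \<in> S \<Longrightarrow> G y a b = G y b a"
    and posG: "\<And>y a. y \<in> S \<Longrightarrow> a \<noteq> 0 \<Longrightarrow> 0 < G y a a"
    and der_G: "\<And>y a b w. y \<in> S \<Longrightarrow> der (\<lambda>z. G z a b) y w = G y (\<Gamma> y w a) b + G y a (\<Gamma> y w b)"
begin

lemma linG1: "y \<in> S \<Longrightarrow> linear (\<lambda>a. G y a b)"
  using linG[of y b] by (simp add: symG[of y _ b])

lemma G_simps:
  assumes "y \<in> S"
  shows "G y (a + b) c = G y a c + G y b c" "G y c (a + b) = G y c a + G y c b"
    "G y (a - b) c = G y a c - G y b c" "G y c (a - b) = G y c a - G y c b"
    "G y (- a) c = - G y a c" "G y c (- a) = - G y c a"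
    "G y 0 c = 0" "G y c 0 = 0"
    "G y (r *\<^sub>R a) c = r * G y a c" "G y c (r *\<^sub>R a) = r * G y c a"
  using linear_rules[OF linG1[OF assms]] linear_rules[OF linG[OF assms]] by simp_all

lemma G_has_derivative:
  assumes "y \<in> S"
  shows "((\<lambda>z. G z a b) has_derivative (\<lambda>w. G y (\<Gamma> y w a) b + G y a (\<Gamma> y w b))) (at y)"
  by (rule has_derivative_eq_rhs[OF smooth_on_has_derivative[OF smooth_G open_S assms]])
    (simp add: fun_eq_iff der_G[OF assms])

lemma G_along_has_derivative:
  assumes N: "open N" "x \<in> N" "\<And>z. z \<in> N \<Longrightarrow> \<pi> z \<in> S" and \<pi>: "(\<pi> has_derivative \<pi>') (at x)"
    and f: "(f has_derivative f') (at x)" and h: "(h has_derivative h') (at x)"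
  shows "((\<lambda>z. G (\<pi> z) (f z) (h z)) has_derivative
    (\<lambda>w. G (\<pi> x) (f' w + \<Gamma> (\<pi> x) (\<pi>' w) (f x)) (h x) + G (\<pi> x) (f x) (h' w + \<Gamma> (\<pi> x) (\<pi>' w) (h x)))) (at x)"
proof -
  have 0: "((\<lambda>z. G (\<pi> z) a b) has_derivative
      (\<lambda>w. G (\<pi> x) (\<Gamma> (\<pi> x) (\<pi>' w) a) b + G (\<pi> x) a (\<Gamma> (\<pi> x) (\<pi>' w) b))) (at x)" for a b
    by (rule has_derivative_compose[OF \<pi> G_has_derivative[OF N(3)[OF N(2)]]])
  have 1: "((\<lambda>z. G (\<pi> z) a (h z)) has_derivative
      (\<lambda>w. G (\<pi> x) (\<Gamma> (\<pi> x) (\<pi>' w) a) (h x) + G (\<pi> x) a (\<Gamma> (\<pi> x) (\<pi>' w) (h x)) + G (\<pi> x) a (h' w))) (at x)" for a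
    by (rule has_derivative_linear_app[OF N(1,2) linG[OF N(3)] 0 h])
  show ?thesis
    by (rule has_derivative_eq_rhs[OF has_derivative_linear_app[OF N(1,2) linG1[OF N(3)] 1 f]], assumption)
      (simp add: fun_eq_iff G_simps[OF N(3)[OF N(2)]])
qed

lemmas G_app_has_derivative =
  G_along_has_derivative[OF open_S _ _ has_derivative_ident, simplified]

text \<open>The function \<open>G z c d\<close> has commuting second derivatives. Computed from
  \<open>der_G\<close>, their difference in the directions \<open>a\<close> and \<open>b\<close> is
  the sum of the two curvature terms.\<close>

lemma R_skew_G:
  assumes y: "y \<in> S"
  shows "G y (R y a b c) d = - G y c (R y a b d)"
proof -
  have 1: "der (\<lambda>z. der (\<lambda>z. G z c d) z v) y w = G y (d\<Gamma> y w v c + \<Gamma> y w (\<Gamma> y v c)) d + G y (\<Gamma> y v c) (\<Gamma> y w d)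
      + G y c (d\<Gamma> y w v d + \<Gamma> y w (\<Gamma> y v d)) + G y (\<Gamma> y w c) (\<Gamma> y v d)" for v w
  proof -
    have a: "((\<lambda>z. G z (\<Gamma> z v c) d) has_derivative (\<lambda>w. G y (d\<Gamma> y w v c + \<Gamma> y w (\<Gamma> y v c)) d + G y (\<Gamma> y v c) (\<Gamma> y w d))) (at y)" for v c d
      using G_app_has_derivative[OF y Gamma_has_derivative[OF y] has_derivative_const] by simp
    have "((\<lambda>z. der (\<lambda>z. G z c d) z v) has_derivative
        (\<lambda>w. G y (d\<Gamma> y w v c + \<Gamma> y w (\<Gamma> y v c)) d + G y (\<Gamma> y v c) (\<Gamma> y w d)
          + (G y (d\<Gamma> y w v d + \<Gamma> y w (\<Gamma> y v d)) c + G y (\<Gamma> y v d) (\<Gamma> y w c)))) (at y)"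
      by (rule has_derivative_transform_within_open[OF has_derivative_add[OF a[of v c d] a[of v d c]] open_S y])
        (simp add: der_G symG[of _ _ d] symG[of _ c])
    then show ?thesis
      by (simp add: der_eqI symG[OF y, of "d\<Gamma> y w v d + \<Gamma> y w (\<Gamma> y v d)" c] symG[OF y, of "\<Gamma> y v d" "\<Gamma> y w c"])
  qed
  show ?thesis
    using der_commute[OF smooth_G open_S y, of c d a b] 
    by (simp add: 1 coord_curv_def G_simps[OF y])
qed

text \<open>The octahedron argument: the first Bianchi identity for the four cyclic shifts of
  \<open>(a, b, c, d)\<close>, combined with skewness in either pair, is a linear system that forces
  the symmetry.\<close>

lemma pair_symmetry:
  assumes y: "y \<in> S"
  shows "G y (R y a b c) d = G y (R y c d a) b"
proof -
  have skew1: "G y (R y a b c) d = - G y (R y b a c) d" for a b c d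
    by (subst R_skew) (simp add: G_simps[OF y])
  have skew2: "G y (R y a b c) d = - G y (R y a b d) c" for a b c d
    using R_skew_G[OF y, of a b c d] symG[OF y, of c "R y a b d"] by linarith
  have B: "G y (R y a b c) d + G y (R y b c a) d + G y (R y c a b) d = 0" for a b c d
    using arg_cong[OF Bianchi1[OF y, of a b c], of "\<lambda>v. G y v d"] by (simp only: G_simps[OF y])
  show ?thesis
    using B[of a b c d] B[of b c d a] B[of c d a b] B[of d a b c]
      skew2[of b c d a] skew2[of c d b a] skew1[of d b c a] skew1[of d a c b] skew2[of a d c b]
      skew1[of a c d b] skew2[of c a d b] skew1[of d a b c] skew2[of a b d c] skew2[of b d a c]
    by linarith
qed

end

section \<open>Manifolds in charts\<close>

text \<open>The model space is arbitrary, since the base and its frame bundle are both instances and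
  share all the chart calculus that follows.\<close>

locale smooth_atlas =
  fixes M :: "('m, 'e::euclidean_space) manifold"
  assumes cdom_subset: "c \<in> atlas M \<Longrightarrow> cdom c \<subseteq> points M"
    and inj_cmap: "c \<in> atlas M \<Longrightarrow> inj_on (cmap c) (cdom c)"
    and open_overlap: "c \<in> atlas M \<Longrightarrow> c' \<in> atlas M \<Longrightarrow> open (cmap c ` (cdom c \<inter> cdom c'))"
    and smooth_trans: "c \<in> atlas M \<Longrightarrow> c' \<in> atlas M \<Longrightarrow>
      smooth_on (cmap c ` (cdom c \<inter> cdom c')) (\<lambda>y. cmap c' (cinv c y))"
    and chart_at_atlas: "p \<in> points M \<Longrightarrow> chart_at M p \<in> atlas M"
    and chart_at_dom: "p \<in> points M \<Longrightarrow> p \<in> cdom (chart_at M p)"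
begin

abbreviation tr where "tr c c' \<equiv> (\<lambda>y. cmap c' (cinv c y))"

definition uncomps :: "('m, 'e) chart \<Rightarrow> 'm \<Rightarrow> 'e \<Rightarrow> 'e" where
  "uncomps c p v = der (tr c (chart_at M p)) (cmap c p) v"

text \<open>For constant \<open>F\<close> these are the coordinate fields of the chart, whose
  covariant derivatives define the Christoffel symbols.\<close>

definition vf :: "('m, 'e) chart \<Rightarrow> ('e \<Rightarrow> 'e) \<Rightarrow> 'm \<Rightarrow> 'e" where
  "vf c F q = uncomps c q (F (cmap c q))"

lemma open_image: "c \<in> atlas M \<Longrightarrow> open (cmap c ` cdom c)"
  using open_overlap[of c c] by simp

lemma cinv_cmap [simp]: "c \<in> atlas M \<Longrightarrow> p \<in> cdom c \<Longrightarrow> cinv c (cmap c p) = p"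
  by (simp add: cinv_def inj_cmap)

lemma cmap_image_Int: "c \<in> atlas M \<Longrightarrow> A \<subseteq> cdom c \<Longrightarrow> B \<subseteq> cdom c \<Longrightarrow> cmap c ` (A \<inter> B) = cmap c ` A \<inter> cmap c ` B"
  using inj_cmap inj_on_image_Int by metis

lemma mopen_image: "mopen M W \<Longrightarrow> c \<in> atlas M \<Longrightarrow> open (cmap c ` (W \<inter> cdom c))"
  unfolding mopen_def by blast

lemma mopen_image_subset: "mopen M W \<Longrightarrow> W \<subseteq> cdom c \<Longrightarrow> c \<in> atlas M \<Longrightarrow> open (cmap c ` W)"
  using mopen_image[of W c] by (simp add: Int_absorb2)

lemma mopen_cdom: "c \<in> atlas M \<Longrightarrow> mopen M (cdom c)"
  unfolding mopen_def using cdom_subset open_overlap by (simp add: Int_commute)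

lemma mopen_Int:
  assumes "mopen M V" "mopen M W"
  shows "mopen M (V \<inter> W)"
  unfolding mopen_def
proof (intro conjI ballI)
  show "V \<inter> W \<subseteq> points M" using assms by (auto simp: mopen_def)
  fix c assume c: "c \<in> atlas M"
  have "cmap c ` (V \<inter> W \<inter> cdom c) = cmap c ` ((V \<inter> cdom c) \<inter> (W \<inter> cdom c))"
    by (rule arg_cong[of _ _ "image (cmap c)"]) auto
  also have "\<dots> = cmap c ` (V \<inter> cdom c) \<inter> cmap c ` (W \<inter> cdom c)"
    by (rule cmap_image_Int[OF c]) auto
  finally show "open (cmap c ` (V \<inter> W \<inter> cdom c))" using assms c mopen_image by (simp add: open_Int)
qed

text \<open>In any other chart the set is read as the preimage of \<open>T\<close> under a
  continuous transition map.\<close>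

lemma mopen_cinv:
  assumes c: "c \<in> atlas M" and T: "open T" "T \<subseteq> cmap c ` cdom c"
  shows "mopen M (cinv c ` T)"
  unfolding mopen_def
proof (intro conjI ballI)
  show "cinv c ` T \<subseteq> points M" using T cdom_subset[OF c] c by fastforce
  fix c' assume c': "c' \<in> atlas M"
  have "cmap c' ` (cinv c ` T \<inter> cdom c') = cmap c' ` (cdom c' \<inter> cdom c) \<inter> tr c' c -` T"
    using c c' T(2) by (auto simp: image_iff Bex_def subset_iff) (metis cinv_cmap, metis cinv_cmap)
  moreover have "open (cmap c' ` (cdom c' \<inter> cdom c) \<inter> tr c' c -` T)"
    by (intro continuous_open_preimage smooth_on_continuous_on smooth_trans c c' open_overlap T)
  ultimately show "open (cmap c' ` (cinv c ` T \<inter> cdom c'))" by simp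
qed

lemma tr_has_derivative:
  assumes "c \<in> atlas M" "c' \<in> atlas M" "p \<in> cdom c" "p \<in> cdom c'"
  shows "(tr c c' has_derivative der (tr c c') (cmap c p)) (at (cmap c p))"
  using assms by (intro smooth_on_has_derivative[OF smooth_trans open_overlap]) auto

lemma der_tr_chain:
  assumes c: "c \<in> atlas M" "c' \<in> atlas M" "c'' \<in> atlas M" and p: "p \<in> cdom c" "p \<in> cdom c'" "p \<in> cdom c''"
  shows "der (tr c' c'') (cmap c' p) (der (tr c c') (cmap c p) v) = der (tr c c'') (cmap c p) v"
proof -
  have "((\<lambda>y. tr c' c'' (tr c c' y)) has_derivative
      (\<lambda>v. der (tr c' c'') (cmap c' p) (der (tr c c') (cmap c p) v))) (at (cmap c p))"
    by (rule has_derivative_compose[where f = "tr c c'", OF tr_has_derivative]) (use c p tr_has_derivative[of c' c''] in simp_all)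
  then have "(tr c c'' has_derivative (\<lambda>v. der (tr c' c'') (cmap c' p) (der (tr c c') (cmap c p) v))) (at (cmap c p))"
    by (rule has_derivative_transform_within_open[OF _ open_overlap[of c c']]) (use c p in auto)
  then show ?thesis by (simp add: der_eqI)
qed

lemma der_tr_self:
  assumes c: "c \<in> atlas M" and p: "p \<in> cdom c"
  shows "der (tr c c) (cmap c p) v = v"
proof -
  have "(tr c c has_derivative (\<lambda>v. v)) (at (cmap c p))"
    by (rule has_derivative_transform_within_open[OF has_derivative_ident open_image[OF c]]) (use c p in auto)
  then show ?thesis by (simp add: der_eqI)
qed

lemma comps_eq: "comps M c p v = der (tr (chart_at M p) c) (cmap (chart_at M p) p) v"
  by (simp add: comps_def o_def)

lemma in_chart:
  assumes "c \<in> atlas M" "p \<in> cdom c"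
  shows "p \<in> points M" "chart_at M p \<in> atlas M" "p \<in> cdom (chart_at M p)"
  using assms cdom_subset chart_at_atlas chart_at_dom by blast+

lemma linear_comps: "c \<in> atlas M \<Longrightarrow> p \<in> cdom c \<Longrightarrow> linear (comps M c p)"
  using has_derivative_linear[OF tr_has_derivative[of "chart_at M p" c p]] in_chart
  by (simp add: comps_eq[abs_def])

lemma linear_uncomps: "c \<in> atlas M \<Longrightarrow> p \<in> cdom c \<Longrightarrow> linear (uncomps c p)"
  using has_derivative_linear[OF tr_has_derivative[of c "chart_at M p" p]] in_chart
  by (simp add: uncomps_def[abs_def])

lemma comps_chart_at: "p \<in> points M \<Longrightarrow> comps M (chart_at M p) p v = v"
  by (simp add: comps_eq der_tr_self chart_at_atlas chart_at_dom)

lemma comps_uncomps [simp]: "c \<in> atlas M \<Longrightarrow> p \<in> cdom c \<Longrightarrow> comps M c p (uncomps c p v) = v"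
  by (simp add: comps_eq uncomps_def der_tr_chain der_tr_self in_chart)

lemma uncomps_comps [simp]: "c \<in> atlas M \<Longrightarrow> p \<in> cdom c \<Longrightarrow> uncomps c p (comps M c p v) = v"
  using in_chart[of c p] by (simp add: comps_eq uncomps_def der_tr_chain der_tr_self)

lemma comps_inject: "c \<in> atlas M \<Longrightarrow> p \<in> cdom c \<Longrightarrow> comps M c p v = comps M c p w \<longleftrightarrow> v = w"
  by (metis uncomps_comps)

lemma comps_change:
  assumes "c \<in> atlas M" "c' \<in> atlas M" "p \<in> cdom c" "p \<in> cdom c'"
  shows "comps M c' p v = der (tr c c') (cmap c p) (comps M c p v)"
  using assms in_chart[of c p] by (simp add: comps_eq der_tr_chain)

lemma local_rep_cmap [simp]: "c \<in> atlas M \<Longrightarrow> p \<in> cdom c \<Longrightarrow> local_rep M c X (cmap c p) = comps M c p (X p)"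
  by (simp add: local_rep_def)

lemma comps_vf [simp]: "c \<in> atlas M \<Longrightarrow> p \<in> cdom c \<Longrightarrow> comps M c p (vf c F p) = F (cmap c p)"
  by (simp add: vf_def)

section \<open>Smooth vector fields and functions in a chart\<close>

lemma smooth_vf_local_rep:
  "smooth_vf M W X \<Longrightarrow> c \<in> atlas M \<Longrightarrow> smooth_on (cmap c ` (W \<inter> cdom c)) (local_rep M c X)"
  by (simp add: smooth_vf_def)

lemma smooth_vf_subset:
  assumes "smooth_vf M W X" "mopen M V" "V \<subseteq> W"
  shows "smooth_vf M V X"
  unfolding smooth_vf_def
proof
  fix c assume c: "c \<in> atlas M"
  show "smooth_on (cmap c ` (V \<inter> cdom c)) (local_rep M c X)"
    by (rule smooth_on_open_subset[OF smooth_vf_local_rep[OF assms(1) c] mopen_image[OF assms(2) c]])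
      (use assms in auto)
qed

lemma smooth_vf_in_chart:
  assumes W: "mopen M W" "W \<subseteq> cdom c" and c: "c \<in> atlas M"
    and X: "smooth_on (cmap c ` W) (local_rep M c X)"
  shows "smooth_vf M W X"
  unfolding smooth_vf_def
proof
  fix c' assume c': "c' \<in> atlas M"
  let ?V = "cmap c ` (W \<inter> cdom c')" and ?V' = "cmap c' ` (W \<inter> cdom c')"
  have Wc: "W \<inter> cdom c' \<inter> cdom c = W \<inter> cdom c'" using W by auto
  have o: "open ?V" "open ?V'"
    using mopen_image[OF mopen_Int[OF W(1) mopen_cdom[OF c']] c] mopen_image[OF W(1) c'] Wc by simp_all
  have "smooth_on ?V (\<lambda>y. der (tr c c') y (local_rep M c X y))"
    by (rule smooth_on_der_app[OF smooth_on_open_subset[OF smooth_trans[OF c c'] o(1)]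
          smooth_on_open_subset[OF X o(1)] o(1)]) (use W in auto)
  moreover have "smooth_on ?V' (tr c' c)"
    by (rule smooth_on_open_subset[OF smooth_trans[OF c' c] o(2)]) (use W in auto)
  ultimately have "smooth_on ?V' (\<lambda>y. der (tr c c') (tr c' c y) (local_rep M c X (tr c' c y)))"
    by (rule smooth_on_compose[where f = "tr c' c" and g = "\<lambda>y. der (tr c c') y (local_rep M c X y)", OF _ _ o(2,1)])
      (use W c c' in auto)
  then show "smooth_on ?V' (local_rep M c' X)"
    by (rule smooth_on_cong[THEN iffD1, rotated]) (use W c c' in \<open>auto simp: subset_iff comps_change[OF c c']\<close>)
qed

lemma smooth_vf_vf:
  assumes c: "c \<in> atlas M" and T: "open T" "T \<subseteq> cmap c ` cdom c" and F: "smooth_on T F"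
  shows "smooth_vf M (cinv c ` T) (vf c F)"
proof (rule smooth_vf_in_chart[OF mopen_cinv[OF c T] _ c])
  show "cinv c ` T \<subseteq> cdom c" using T c by fastforce
  have "cmap c ` cinv c ` T = T" using T c by (force simp: image_image)
  moreover have "smooth_on T (local_rep M c (vf c F))"
    by (rule smooth_on_cong[THEN iffD1, rotated, OF F]) (use T c in auto)
  ultimately show "smooth_on (cmap c ` cinv c ` T) (local_rep M c (vf c F))" by simp
qed

lemma cinv_image_cdom: "c \<in> atlas M \<Longrightarrow> cinv c ` cmap c ` cdom c = cdom c"
  by (force simp: image_image)

lemma smooth_vf_const: "c \<in> atlas M \<Longrightarrow> smooth_vf M (cdom c) (vf c (\<lambda>_. v))"
  using smooth_vf_vf[of c "cmap c ` cdom c" "\<lambda>_. v"] open_image[of c]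
  by (simp add: smooth_on_const cinv_image_cdom)

lemma smooth_fun_in_chart:
  assumes W: "mopen M W" "W \<subseteq> cdom c" and c: "c \<in> atlas M"
    and f: "smooth_on (cmap c ` W) (f \<circ> cinv c)"
  shows "smooth_fun M W f"
  unfolding smooth_fun_def
proof
  fix c' assume c': "c' \<in> atlas M"
  let ?V' = "cmap c' ` (W \<inter> cdom c')"
  have o: "open (cmap c ` W)" "open ?V'"
    using mopen_image_subset[OF W c] mopen_image[OF W(1) c'] by simp_all
  have "smooth_on ?V' (tr c' c)"
    by (rule smooth_on_open_subset[OF smooth_trans[OF c' c] o(2)]) (use W in auto)
  then have "smooth_on ?V' (\<lambda>y. (f \<circ> cinv c) (tr c' c y))"
    by (rule smooth_on_compose[where f = "tr c' c", OF f _ o(2,1)]) (use W c c' in auto)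
  then show "smooth_on ?V' (f \<circ> cinv c')"
    by (rule smooth_on_cong[THEN iffD1, rotated]) (use W c c' in \<open>auto simp: subset_iff\<close>)
qed

lemma dir_deriv_chart:
  assumes c: "c \<in> atlas M" "p \<in> cdom c" and f: "((\<lambda>y. f (cinv c y)) has_derivative f') (at (cmap c p))"
  shows "dir_deriv M f p v = f' (comps M c p v)"
proof -
  let ?a = "chart_at M p"
  note a = in_chart[OF c]
  have "((\<lambda>y. f (cinv c (tr ?a c y))) has_derivative (\<lambda>v. f' (der (tr ?a c) (cmap ?a p) v))) (at (cmap ?a p))"
    by (rule has_derivative_compose[where f = "tr ?a c", OF tr_has_derivative]) (use a c f in simp_all)
  then have "((\<lambda>y. f (cinv ?a y)) has_derivative (\<lambda>v. f' (der (tr ?a c) (cmap ?a p) v))) (at (cmap ?a p))"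
    by (rule has_derivative_transform_within_open[OF _ open_overlap[OF a(2) c(1)]]) (use a c in auto)
  then show ?thesis by (simp add: dir_deriv_def o_def comps_eq der_eqI)
qed

text \<open>The bracket is defined in the preferred chart at \<open>p\<close>. Passing to the chart
  \<open>c\<close> adds the second derivative of the transition map, evaluated on the values of the
  two fields; it is symmetric and so drops out of the difference.\<close>

lemma lie_bracket_chart:
  assumes c: "c \<in> atlas M" and W: "mopen M W" and X: "smooth_vf M W X" and Y: "smooth_vf M W Y" and p: "p \<in> W" "p \<in> cdom c"
  shows "comps M c p (lie_bracket M X Y p) = der (local_rep M c Y) (cmap c p) (comps M c p (X p))
    - der (local_rep M c X) (cmap c p) (comps M c p (Y p))"
proof -
  define a where "a = chart_at M p"
  note a = in_chart[OF c p(2), folded a_def]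
  define V where "V = cmap a ` (W \<inter> cdom a \<inter> cdom c)"
  have "open (cmap a ` ((W \<inter> cdom c) \<inter> cdom a))"
    by (intro mopen_image mopen_Int W mopen_cdom c a)
  then have V: "open V" "cmap a p \<in> V" using a p by (auto simp: V_def Int_ac)
  have tr: "smooth_on V (tr a c)"
    by (rule smooth_on_open_subset[OF smooth_trans[OF a(2) c] V(1)]) (auto simp: V_def)
  have aX: "comps M a p (X p) = X p" for X :: "'m \<Rightarrow> 'e"
    using comps_chart_at[OF a(1)] by (simp add: a_def)
  have key: "der (local_rep M c X) (cmap c p) (comps M c p w)
      = der (\<lambda>y. der (tr a c) y (X p)) (cmap a p) w + comps M c p (der (local_rep M a X) (cmap a p) w)"
    if X: "smooth_vf M W X" for X w
  proof -
    have lX: "(local_rep M a X has_derivative der (local_rep M a X) (cmap a p)) (at (cmap a p))"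
      by (rule smooth_on_has_derivative[OF smooth_vf_local_rep[OF X a(2)] mopen_image[OF W a(2)]]) (use a p in auto)
    have 1: "((\<lambda>y. der (tr a c) y (local_rep M a X y)) has_derivative
       (\<lambda>w. der (\<lambda>y. der (tr a c) y (local_rep M a X (cmap a p))) (cmap a p) w
          + der (tr a c) (cmap a p) (der (local_rep M a X) (cmap a p) w))) (at (cmap a p))"
      by (rule has_derivative_linear_app[where L = "der (tr a c)"
            and L' = "\<lambda>w b. der (\<lambda>y. der (tr a c) y b) (cmap a p) w",
            OF V smooth_on_linear_der[OF tr V(1)] smooth_on_has_derivative[OF smooth_on_der[OF tr V(1)] V] lX])
    have "(local_rep M c X has_derivative der (local_rep M c X) (cmap c p)) (at (cmap c p))"
      by (rule smooth_on_has_derivative[OF smooth_vf_local_rep[OF X c] mopen_image[OF W c]]) (use c p in auto)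
    then have "((\<lambda>y. local_rep M c X (tr a c y)) has_derivative
        (\<lambda>w. der (local_rep M c X) (cmap c p) (der (tr a c) (cmap a p) w))) (at (cmap a p))"
      by (intro has_derivative_compose[where f = "tr a c", OF tr_has_derivative]) (use a c p in simp_all)
    then have 2: "((\<lambda>y. der (tr a c) y (local_rep M a X y)) has_derivative
        (\<lambda>w. der (local_rep M c X) (cmap c p) (der (tr a c) (cmap a p) w))) (at (cmap a p))"
      by (rule has_derivative_transform_within_open[OF _ V])
        (use a c in \<open>auto simp: V_def comps_change[of a c]\<close>)
    show ?thesis
      using has_derivative_unique[OF 1 2, THEN fun_cong, of w] a p
      by (simp add: aX comps_eq[of c] flip: a_def)
  qed
  have "lie_bracket M X Y p = der (local_rep M a Y) (cmap a p) (X p) - der (local_rep M a X) (cmap a p) (Y p)"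
    by (simp add: lie_bracket_def a_def Let_def)
  then show ?thesis
    using key[OF X, of "Y p"] key[OF Y, of "X p"] der_commute[OF tr V, of "X p" "Y p"]
    by (simp add: linear_diff[OF linear_comps[OF c p(2)]])
qed

lemma smooth_vf_add:
  assumes W: "mopen M W" and X: "smooth_vf M W X" and Y: "smooth_vf M W Y"
  shows "smooth_vf M W (\<lambda>q. X q + Y q)"
  unfolding smooth_vf_def
proof
  fix c assume c: "c \<in> atlas M"
  have "smooth_on (cmap c ` (W \<inter> cdom c)) (\<lambda>y. local_rep M c X y + local_rep M c Y y)"
    by (intro smooth_on_add smooth_vf_local_rep X Y mopen_image W c)
  then show "smooth_on (cmap c ` (W \<inter> cdom c)) (local_rep M c (\<lambda>q. X q + Y q))"
    by (rule smooth_on_cong[THEN iffD1, rotated]) (use c in \<open>auto simp: linear_add[OF linear_comps]\<close>)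
qed

lemma smooth_vf_scaleR:
  assumes W: "mopen M W" and f: "smooth_fun M W f" and Y: "smooth_vf M W Y"
  shows "smooth_vf M W (\<lambda>q. f q *\<^sub>R Y q)"
  unfolding smooth_vf_def
proof
  fix c assume c: "c \<in> atlas M"
  have "smooth_on (cmap c ` (W \<inter> cdom c)) (f \<circ> cinv c)" using f c by (simp add: smooth_fun_def)
  then have "smooth_on (cmap c ` (W \<inter> cdom c)) (\<lambda>y. (f \<circ> cinv c) y *\<^sub>R local_rep M c Y y)"
    by (intro smooth_on_scaleR smooth_vf_local_rep Y mopen_image W c)
  then show "smooth_on (cmap c ` (W \<inter> cdom c)) (local_rep M c (\<lambda>q. f q *\<^sub>R Y q))"
    by (rule smooth_on_cong[THEN iffD1, rotated]) (use c in \<open>auto simp: linear_cmul[OF linear_comps]\<close>)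
qed

lemma smooth_vf_zero: "mopen M W \<Longrightarrow> smooth_vf M W (\<lambda>q. 0)"
  unfolding smooth_vf_def
proof
  fix c assume c: "c \<in> atlas M" and W: "mopen M W"
  show "smooth_on (cmap c ` (W \<inter> cdom c)) (local_rep M c (\<lambda>q. 0))"
    by (rule smooth_on_cong[THEN iffD1, rotated, OF smooth_on_const[OF mopen_image[OF W c], of 0]])
      (use c in \<open>auto simp: linear_0[OF linear_comps]\<close>)
qed

lemma smooth_vf_sum:
  assumes W: "mopen M W" and "\<And>i. i \<in> I \<Longrightarrow> smooth_vf M W (X i)"
  shows "smooth_vf M W (\<lambda>q. \<Sum>i\<in>I. X i q)"
  using assms(2)
proof (induction I rule: infinite_finite_induct)
  case (insert i I)
  then show ?case using smooth_vf_add[OF W, of "X i" "\<lambda>q. \<Sum>i\<in>I. X i q"] by simp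
qed (simp_all add: smooth_vf_zero[OF W])

lemma smooth_fun_const: "mopen M W \<Longrightarrow> smooth_fun M W (\<lambda>q. r)"
  unfolding smooth_fun_def by (auto simp: o_def intro!: smooth_on_const mopen_image)

end

section \<open>Connections in charts\<close>

locale connection_atlas = smooth_atlas M for M :: "('m, 'e::euclidean_space) manifold" +
  fixes D :: "'m \<Rightarrow> 'e \<Rightarrow> ('m \<Rightarrow> 'e) \<Rightarrow> 'e"
  assumes conn: "affine_connection M D"
begin

definition christoffel :: "('m, 'e) chart \<Rightarrow> 'e \<Rightarrow> 'e \<Rightarrow> 'e \<Rightarrow> 'e" where
  "christoffel c y v w = (let q = cinv c y in comps M c q (D q (uncomps c q v) (vf c (\<lambda>_. w))))"

lemmas conn_D = conn[unfolded affine_connection_def, THEN spec, THEN mp]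

lemma D_smooth: "mopen M W \<Longrightarrow> smooth_vf M W X \<Longrightarrow> smooth_vf M W Y \<Longrightarrow> smooth_vf M W (\<lambda>p. D p (X p) Y)"
  using conn_D[THEN conjunct1, of W] by simp

lemma D_linear: "mopen M W \<Longrightarrow> smooth_vf M W Y \<Longrightarrow> p \<in> W \<Longrightarrow> linear (\<lambda>v. D p v Y)"
  using conn_D[THEN conjunct2, THEN conjunct1, of W] by simp

lemma D_add: "mopen M W \<Longrightarrow> smooth_vf M W Y \<Longrightarrow> smooth_vf M W Z \<Longrightarrow> p \<in> W \<Longrightarrow>
    D p v (\<lambda>q. Y q + Z q) = D p v Y + D p v Z"
  using conn_D[THEN conjunct2, THEN conjunct2, THEN conjunct1, of W] by simp

lemma D_scaleR: "mopen M W \<Longrightarrow> smooth_fun M W f \<Longrightarrow> smooth_vf M W Y \<Longrightarrow> p \<in> W \<Longrightarrow>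
    D p v (\<lambda>q. f q *\<^sub>R Y q) = dir_deriv M f p v *\<^sub>R Y p + f p *\<^sub>R D p v Y"
  using conn_D[THEN conjunct2, THEN conjunct2, THEN conjunct2, THEN conjunct1, of W] by simp

lemma D_cong: "mopen M W \<Longrightarrow> smooth_vf M W Y \<Longrightarrow> smooth_vf M W Z \<Longrightarrow> (\<And>q. q \<in> W \<Longrightarrow> Y q = Z q) \<Longrightarrow> p \<in> W \<Longrightarrow>
    D p v Y = D p v Z"
  using conn_D[THEN conjunct2, THEN conjunct2, THEN conjunct2, THEN conjunct2, of W, rule_format, of Y Z p v] by simp

lemma dir_deriv_const: "dir_deriv M (\<lambda>q. r) p v = 0"
  by (simp add: dir_deriv_def o_def)

lemma D_zero: "mopen M W \<Longrightarrow> p \<in> W \<Longrightarrow> D p v (\<lambda>q. 0) = 0"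
  using D_scaleR[of W "\<lambda>_. 0" "\<lambda>_. 0" p v] smooth_fun_const smooth_vf_zero by (simp add: dir_deriv_const)

lemma D_sum:
  assumes W: "mopen M W" "p \<in> W" and "\<And>i. i \<in> I \<Longrightarrow> smooth_vf M W (X i)"
  shows "D p v (\<lambda>q. \<Sum>i\<in>I. X i q) = (\<Sum>i\<in>I. D p v (X i))"
  using assms(3)
proof (induction I rule: infinite_finite_induct)
  case (insert i I)
  then show ?case
    using D_add[OF W(1), of "X i" "\<lambda>q. \<Sum>i\<in>I. X i q" p v] W smooth_vf_sum[OF W(1), of I X] by simp
qed (simp_all add: D_zero[OF W])

lemma christoffel_cmap:
  "c \<in> atlas M \<Longrightarrow> p \<in> cdom c \<Longrightarrow> christoffel c (cmap c p) v w = comps M c p (D p (uncomps c p v) (vf c (\<lambda>_. w)))"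
  by (simp add: christoffel_def)

lemma christoffel_lin1:
  assumes c: "c \<in> atlas M" and y: "y \<in> cmap c ` cdom c"
  shows "linear (\<lambda>v. christoffel c y v w)"
proof -
  obtain p where p: "p \<in> cdom c" "y = cmap c p" using y by auto
  show ?thesis
    unfolding p(2) christoffel_cmap[OF c p(1)]
    using linear_compose[OF linear_compose[OF linear_uncomps[OF c p(1)] D_linear[OF mopen_cdom[OF c] smooth_vf_const[OF c] p(1)]]
        linear_comps[OF c p(1)]] by (simp add: o_def)
qed

lemma vf_add: "c \<in> atlas M \<Longrightarrow> q \<in> cdom c \<Longrightarrow> vf c (\<lambda>y. F y + F' y) q = vf c F q + vf c F' q"
  by (simp add: vf_def linear_add[OF linear_uncomps])

lemma vf_scaleR: "c \<in> atlas M \<Longrightarrow> q \<in> cdom c \<Longrightarrow> vf c (\<lambda>y. f y *\<^sub>R F' y) q = f (cmap c q) *\<^sub>R vf c F' q"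
  by (simp add: vf_def linear_cmul[OF linear_uncomps])

lemma christoffel_lin2:
  assumes c: "c \<in> atlas M" and y: "y \<in> cmap c ` cdom c"
  shows "linear (christoffel c y v)"
proof
  obtain p where p: "p \<in> cdom c" "y = cmap c p" using y by auto
  note W = mopen_cdom[OF c] and s = smooth_vf_const[OF c]
  note l = linear_comps[OF c p(1)]
  fix w w' and r :: real
  have "D p u (vf c (\<lambda>_. w + w')) = D p u (\<lambda>q. vf c (\<lambda>_. w) q + vf c (\<lambda>_. w') q)" for u
    by (rule D_cong[OF W s smooth_vf_add[OF W s s] _ p(1)]) (simp add: vf_add c)
  then show "christoffel c y v (w + w') = christoffel c y v w + christoffel c y v w'"
    by (simp add: p(2) christoffel_cmap[OF c p(1)] D_add[OF W s s p(1)] linear_add[OF l])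
  have "D p u (vf c (\<lambda>_. r *\<^sub>R w)) = D p u (\<lambda>q. r *\<^sub>R vf c (\<lambda>_. w) q)" for u
    by (rule D_cong[OF W s smooth_vf_scaleR[OF W smooth_fun_const[OF W] s] _ p(1)]) (simp add: vf_scaleR c)
  then show "christoffel c y v (r *\<^sub>R w) = r *\<^sub>R christoffel c y v w"
    by (simp add: p(2) christoffel_cmap[OF c p(1)] D_scaleR[OF W smooth_fun_const[OF W] s p(1)] linear_cmul[OF l] dir_deriv_const)
qed

lemma christoffel_smooth:
  assumes c: "c \<in> atlas M"
  shows "smooth_on (cmap c ` cdom c) (\<lambda>y. christoffel c y v w)"
proof -
  have "smooth_vf M (cdom c) (\<lambda>p. D p (vf c (\<lambda>_. v) p) (vf c (\<lambda>_. w)))"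
    by (intro D_smooth mopen_cdom smooth_vf_const c)
  from smooth_vf_local_rep[OF this c] show ?thesis
    by (simp add: local_rep_def[abs_def] christoffel_def vf_def)
      (rule smooth_on_cong[THEN iffD1, rotated], assumption, use c in auto)
qed

text \<open>Locality allows \<open>X\<close> to be replaced near \<open>p\<close> by its expansion
  in coordinate fields. The Leibniz rule then yields the derivatives of the components and the
  Christoffel terms.\<close>

lemma D_chart:
  assumes c: "c \<in> atlas M" and W: "mopen M W" and X: "smooth_vf M W X" and p: "p \<in> W" "p \<in> cdom c"
  shows "comps M c p (D p v X) = cov_der (christoffel c) (cmap c p) (comps M c p v) (local_rep M c X)"
proof -
  define V where "V = W \<inter> cdom c"
  have V: "mopen M V" "p \<in> V" "V \<subseteq> cdom c" "V \<subseteq> W"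
    using mopen_Int[OF W mopen_cdom[OF c]] p by (auto simp: V_def)
  define F where "F = local_rep M c X"
  have XV: "smooth_vf M V X" by (rule smooth_vf_subset[OF X V(1,4)])
  have F: "smooth_on (cmap c ` V) F"
    using smooth_vf_local_rep[OF X c] by (simp add: F_def V_def)
  have oV: "open (cmap c ` V)" by (rule mopen_image_subset[OF V(1,3) c])
  have sE: "smooth_vf M V (vf c (\<lambda>_. b))" for b
    by (rule smooth_vf_subset[OF smooth_vf_const[OF c] V(1,3)])
  have sf: "smooth_fun M V (\<lambda>q. F (cmap c q) \<bullet> b)" for b
  proof (rule smooth_fun_in_chart[OF V(1,3) c])
    have "smooth_on (cmap c ` V) (\<lambda>y. F y \<bullet> b)"
      by (rule smooth_on_bounded_linear[OF bounded_linear_inner_left F oV])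
    then show "smooth_on (cmap c ` V) ((\<lambda>q. F (cmap c q) \<bullet> b) \<circ> cinv c)"
      by (rule smooth_on_cong[THEN iffD1, rotated]) (use V c in auto)
  qed
  have "X q = (\<Sum>b\<in>Basis. (F (cmap c q) \<bullet> b) *\<^sub>R vf c (\<lambda>_. b) q)" if "q \<in> V" for q
  proof -
    have q: "q \<in> cdom c" using that V by auto
    then have "X q = uncomps c q (F (cmap c q))" using c by (simp add: F_def)
    then show ?thesis using linear_Basis_expansion[OF linear_uncomps[OF c q], of "F (cmap c q)"] by (simp add: vf_def)
  qed
  then have "D p v X = D p v (\<lambda>q. \<Sum>b\<in>Basis. (F (cmap c q) \<bullet> b) *\<^sub>R vf c (\<lambda>_. b) q)"
    by (rule D_cong[OF V(1) XV smooth_vf_sum[OF V(1) smooth_vf_scaleR[OF V(1) sf sE]] _ V(2)])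
  also have "\<dots> = (\<Sum>b\<in>Basis. dir_deriv M (\<lambda>q. F (cmap c q) \<bullet> b) p v *\<^sub>R vf c (\<lambda>_. b) p
      + (F (cmap c p) \<bullet> b) *\<^sub>R D p v (vf c (\<lambda>_. b)))"
    by (simp add: D_sum[OF V(1,2) smooth_vf_scaleR[OF V(1) sf sE]] D_scaleR[OF V(1) sf sE V(2)])
  finally have 1: "comps M c p (D p v X) = (\<Sum>b\<in>Basis. dir_deriv M (\<lambda>q. F (cmap c q) \<bullet> b) p v *\<^sub>R b
      + (F (cmap c p) \<bullet> b) *\<^sub>R christoffel c (cmap c p) (comps M c p v) b)"
    using linear_comps[OF c p(2)] c p(2) by (simp add: linear_sum linear_add linear_cmul christoffel_cmap)
  have "dir_deriv M (\<lambda>q. F (cmap c q) \<bullet> b) p v = der F (cmap c p) (comps M c p v) \<bullet> b" for b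
  proof (rule dir_deriv_chart[OF c p(2)])
    have "((\<lambda>y. F y \<bullet> b) has_derivative (\<lambda>w. der F (cmap c p) w \<bullet> b)) (at (cmap c p))"
      using smooth_on_has_derivative[OF F oV] V(2)
      by (intro bounded_linear.has_derivative[OF bounded_linear_inner_left]) auto
    then show "((\<lambda>y. F (cmap c (cinv c y)) \<bullet> b) has_derivative (\<lambda>w. der F (cmap c p) w \<bullet> b)) (at (cmap c p))"
      by (rule has_derivative_transform_within_open[OF _ open_image[OF c]]) (use c p in auto)
  qed
  then show ?thesis
    using p c 
    by (simp add: 1 sum.distrib cov_der_def F_def euclidean_representation
        linear_Basis_expansion[OF christoffel_lin2[OF c], of "cmap c p" _ "comps M c p (X p)"])
qed

end

section \<open>The Levi-Civita connection and its curvature in a chart\<close>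

locale levi_civita_atlas = connection_atlas M D
  for M :: "('m, 'e::euclidean_space) manifold" and D :: "'m \<Rightarrow> 'e \<Rightarrow> ('m \<Rightarrow> 'e) \<Rightarrow> 'e" +
  fixes g :: "'m \<Rightarrow> 'e \<Rightarrow> 'e \<Rightarrow> real"
  assumes metric: "riemannian_metric M g"
    and lc: "levi_civita M g D"
begin

definition chart_metric :: "('m, 'e) chart \<Rightarrow> 'e \<Rightarrow> 'e \<Rightarrow> 'e \<Rightarrow> real" where
  "chart_metric c y v w = (let q = cinv c y in g q (uncomps c q v) (uncomps c q w))"

lemma chart_metric_cmap:
  "c \<in> atlas M \<Longrightarrow> p \<in> cdom c \<Longrightarrow> chart_metric c (cmap c p) v w = g p (uncomps c p v) (uncomps c p w)"
  by (simp add: chart_metric_def)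

lemma g_facts:
  assumes "p \<in> points M"
  shows "bilinear (g p)" "g p v w = g p w v" "v \<noteq> 0 \<Longrightarrow> 0 < g p v v"
  using metric[unfolded riemannian_metric_def, THEN conjunct1, rule_format, OF assms] by simp_all

lemma torsion_free: "mopen M W \<Longrightarrow> smooth_vf M W X \<Longrightarrow> smooth_vf M W Y \<Longrightarrow> p \<in> W \<Longrightarrow>
    lie_bracket M X Y p = D p (X p) Y - D p (Y p) X"
  using lc[unfolded levi_civita_def, THEN conjunct2, THEN conjunct1, rule_format, of W X Y p] by simp

lemma metric_compatible: "mopen M W \<Longrightarrow> smooth_vf M W Y \<Longrightarrow> smooth_vf M W Z \<Longrightarrow> p \<in> W \<Longrightarrow>
    dir_deriv M (\<lambda>q. g q (Y q) (Z q)) p v = g p (D p v Y) (Z p) + g p (Y p) (D p v Z)"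
  using lc[unfolded levi_civita_def, THEN conjunct2, THEN conjunct2, rule_format, of W Y Z p v] by simp

lemma local_rep_vf_der:
  assumes c: "c \<in> atlas M" and p: "p \<in> cdom c"
  shows "der (local_rep M c (vf c F)) (cmap c p) = der F (cmap c p)"
  by (rule der_cong[OF open_image[OF c]]) (use c p in auto)

text \<open>All conditions are tested on coordinate fields. These commute, because their local
  representatives are constant, so vanishing torsion becomes symmetry of the Christoffel symbols;
  metric compatibility becomes the formula for the derivative of the metric coefficients.\<close>

lemma coord_levi_civita:
  assumes c: "c \<in> atlas M"
  shows "coord_levi_civita (cmap c ` cdom c) (christoffel c) (chart_metric c)"
proof (intro coord_levi_civita.intro coord_connection.intro coord_levi_civita_axioms.intro)
  let ?S = "cmap c ` cdom c"
  note W = mopen_cdom[OF c] and s = smooth_vf_const[OF c]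
  show "open ?S" by (rule open_image[OF c])
  show "smooth_on ?S (\<lambda>y. christoffel c y a b)" for a b by (rule christoffel_smooth[OF c])
  have "smooth_fun M (cdom c) (\<lambda>p. g p (vf c (\<lambda>_. a) p) (vf c (\<lambda>_. b) p))" for a b
    using metric[unfolded riemannian_metric_def, THEN conjunct2, rule_format, of "cdom c"] W s by simp
  then have "smooth_on ?S ((\<lambda>p. g p (vf c (\<lambda>_. a) p) (vf c (\<lambda>_. b) p)) \<circ> cinv c)" for a b
    using c unfolding smooth_fun_def by (metis Int_absorb)
  then show sm: "smooth_on ?S (\<lambda>y. chart_metric c y a b)" for a b
    by (simp add: chart_metric_def vf_def o_def Let_def)
  {
  fix y assume "y \<in> ?S"
  then obtain p where p: "p \<in> cdom c" "y = cmap c p" by auto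
  have pM: "p \<in> points M" using c p cdom_subset by auto
  note lu = linear_uncomps[OF c p(1)]
  have 1: "christoffel c y a b = christoffel c y b a" for a b
  proof -
    have "comps M c p (lie_bracket M (vf c (\<lambda>_. a)) (vf c (\<lambda>_. b)) p) = 0"
      using lie_bracket_chart[OF c W s s p(1) p(1), of a b] c p(1) by (simp add: local_rep_vf_der)
    then have "comps M c p (D p (vf c (\<lambda>_. a) p) (vf c (\<lambda>_. b))) = comps M c p (D p (vf c (\<lambda>_. b) p) (vf c (\<lambda>_. a)))"
      by (simp add: torsion_free[OF W s s p(1)] linear_diff[OF linear_comps[OF c p(1)]])
    then show ?thesis using c p by (simp add: christoffel_cmap vf_def)
  qed
  have 2: "linear (chart_metric c y a)" for a
    unfolding p(2) chart_metric_cmap[OF c p(1), abs_def]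
    using linear_compose[OF lu] g_facts(1)[OF pM] unfolding bilinear_def o_def by blast
  have 3: "chart_metric c y a b = chart_metric c y b a" for a b
    by (simp add: p(2) chart_metric_cmap[OF c p(1)] g_facts(2)[OF pM])
  have 4: "0 < chart_metric c y a a" if "a \<noteq> 0" for a
  proof -
    have "uncomps c p a \<noteq> 0" using that comps_uncomps[OF c p(1), of a] linear_0[OF linear_comps[OF c p(1)]] by metis
    then show ?thesis using g_facts(3)[OF pM] by (simp add: p(2) chart_metric_cmap[OF c p(1)])
  qed
  have 5: "der (\<lambda>z. chart_metric c z a b) y w = chart_metric c y (christoffel c y w a) b + chart_metric c y a (christoffel c y w b)" for a b w
  proof -
    have "((\<lambda>z. chart_metric c z a b) has_derivative der (\<lambda>z. chart_metric c z a b) y) (at y)"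
      by (rule smooth_on_has_derivative[OF sm open_image[OF c] \<open>y \<in> ?S\<close>])
    then have "((\<lambda>z. g (cinv c z) (vf c (\<lambda>_. a) (cinv c z)) (vf c (\<lambda>_. b) (cinv c z))) has_derivative
        der (\<lambda>z. chart_metric c z a b) y) (at (cmap c p))"
      unfolding p(2)
      by (rule has_derivative_transform_within_open[OF _ open_image[OF c]])
        (use c p in \<open>auto simp: chart_metric_cmap vf_def\<close>)
    then have "der (\<lambda>z. chart_metric c z a b) y (comps M c p (uncomps c p w)) =
        dir_deriv M (\<lambda>q. g q (vf c (\<lambda>_. a) q) (vf c (\<lambda>_. b) q)) p (uncomps c p w)"
      using dir_deriv_chart[OF c p(1), of "\<lambda>q. g q (vf c (\<lambda>_. a) q) (vf c (\<lambda>_. b) q)"] by simp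
    then show ?thesis
      using c p(1) by (simp add: metric_compatible[OF W s s p(1)] p(2) chart_metric_cmap christoffel_cmap)
        (simp add: vf_def)
  qed
  note 1 2 3 4 5
  }
  note pointwise = this
  show "linear (\<lambda>a. christoffel c y a b)" if "y \<in> ?S" for y b by (rule christoffel_lin1[OF c that])
  show "linear (christoffel c y a)" if "y \<in> ?S" for y a by (rule christoffel_lin2[OF c that])
  show "christoffel c y a b = christoffel c y b a" if "y \<in> ?S" for y a b using that by (rule pointwise)
  show "linear (chart_metric c y a)" if "y \<in> ?S" for y a using that by (rule pointwise)
  show "chart_metric c y a b = chart_metric c y b a" if "y \<in> ?S" for y a b using that by (rule pointwise)
  show "0 < chart_metric c y a a" if "y \<in> ?S" "a \<noteq> 0" for y a using that by (rule pointwise)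
  show "der (\<lambda>z. chart_metric c z a b) y w = chart_metric c y (christoffel c y w a) b + chart_metric c y a (christoffel c y w b)"
    if "y \<in> ?S" for y a b w using that by (rule pointwise)
qed

text \<open>Every tangent vector has an extension. Without one, the condition in the definite
  description of \<open>curvature\<close> would hold for every vector and determine nothing.\<close>

lemma extends_chart: "c \<in> atlas M \<Longrightarrow> p \<in> cdom c \<Longrightarrow> extends M p x (vf c (\<lambda>_. comps M c p x))"
  unfolding extends_def using mopen_cdom[of c] smooth_vf_const[of c] by (auto simp: vf_def)

lemma extends_common:
  assumes c: "c \<in> atlas M" "p \<in> cdom c" and "extends M p x X" "extends M p y Y" "extends M p z Z"
  obtains W where "mopen M W" "p \<in> W" "W \<subseteq> cdom c" "smooth_vf M W X" "smooth_vf M W Y" "smooth_vf M W Z"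
proof -
  obtain A B C where *: "mopen M A" "p \<in> A" "smooth_vf M A X" "mopen M B" "p \<in> B" "smooth_vf M B Y"
    "mopen M C" "p \<in> C" "smooth_vf M C Z"
    using assms unfolding extends_def by blast
  let ?W = "A \<inter> B \<inter> C \<inter> cdom c"
  have W: "mopen M ?W" by (intro mopen_Int mopen_cdom c * )
  show thesis
    by (rule that[OF W _ _ smooth_vf_subset[OF *(3) W] smooth_vf_subset[OF *(6) W] smooth_vf_subset[OF *(9) W]])
      (use * c in auto)
qed

lemma local_rep_D:
  assumes "c \<in> atlas M" "mopen M W" "W \<subseteq> cdom c" "smooth_vf M W Y" "y \<in> cmap c ` W"
  shows "local_rep M c (\<lambda>q. D q (X q) Y) y = cov_der (christoffel c) y (local_rep M c X y) (local_rep M c Y)"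
  using assms D_chart[of c W Y] by (auto simp: subset_iff)

lemma cov_der_cong:
  assumes "open S" "y \<in> S" "\<And>z. z \<in> S \<Longrightarrow> F z = F' z"
  shows "cov_der \<Gamma> y v F = cov_der \<Gamma> y v F'"
  using der_cong[OF assms] assms by (simp add: cov_der_def)

text \<open>The right-hand side contains only \<open>x\<close>, \<open>y\<close> and
  \<open>z\<close>: this is the tensoriality on which the definition of \<open>curvature\<close>
  relies.\<close>

lemma curvature_fields_chart:
  assumes c: "c \<in> atlas M" "p \<in> cdom c" and e: "extends M p x X" "extends M p y Y" "extends M p z Z"
  shows "comps M c p (D p x (\<lambda>q. D q (Y q) Z) - D p y (\<lambda>q. D q (X q) Z) - D p (lie_bracket M X Y p) Z)
    = coord_curv (christoffel c) (cmap c p) (comps M c p x) (comps M c p y) (comps M c p z)"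
proof -
  obtain W where W: "mopen M W" "p \<in> W" "W \<subseteq> cdom c" and XYZ: "smooth_vf M W X" "smooth_vf M W Y" "smooth_vf M W Z"
    by (rule extends_common[OF c e])
  have v: "X p = x" "Y p = y" "Z p = z" using e by (auto simp: extends_def)
  interpret coord_levi_civita "cmap c ` cdom c" "christoffel c" "chart_metric c" by (rule coord_levi_civita[OF c(1)])
  let ?N = "cmap c ` W" and ?y = "cmap c p" and ?l = "local_rep M c"
  have N: "open ?N" "?N \<subseteq> cmap c ` cdom c" "?y \<in> ?N"
    using mopen_image_subset[OF W(1,3) c(1)] W by auto
  have sl: "smooth_on ?N (?l X)" if "smooth_vf M W X" for X
    using smooth_vf_local_rep[OF that c(1)] W(3) by (simp add: Int_absorb2)
  have 2: "comps M c p (D p v (\<lambda>q. D q (Y q) Z)) =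
      cov_der (christoffel c) ?y (comps M c p v) (\<lambda>z. cov_der (christoffel c) z (?l Y z) (?l Z))" if "smooth_vf M W Y" for Y v
    by (subst D_chart[OF c(1) W(1) D_smooth[OF W(1) that XYZ(3)] W(2) c(2)])
      (rule cov_der_cong[OF N(1,3)], rule local_rep_D[OF c(1) W(1,3) XYZ(3)])
  show ?thesis
    using curvature_fields[OF sl[OF XYZ(1)] sl[OF XYZ(2)] sl[OF XYZ(3)] N] c
    by (simp add: linear_diff[OF linear_comps[OF c]] 2 XYZ v D_chart[OF c(1) W(1) _ W(2) c(2)] torsion_free[OF W(1) XYZ(1,2) W(2)])
qed

lemma curvature_chart:
  assumes c: "c \<in> atlas M" "p \<in> cdom c"
  shows "comps M c p (curvature M D p x y z) =
    coord_curv (christoffel c) (cmap c p) (comps M c p x) (comps M c p y) (comps M c p z)" (is "_ = ?K")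
proof -
  let ?L = "\<lambda>X Y Z. D p x (\<lambda>q. D q (Y q) Z) - D p y (\<lambda>q. D q (X q) Z) - D p (lie_bracket M X Y p) Z"
  have "curvature M D p x y z = uncomps c p ?K"
    unfolding curvature_def
  proof (rule the_equality, intro allI impI, elim conjE)
    fix X Y Z assume e: "extends M p x X" "extends M p y Y" "extends M p z Z"
    show "uncomps c p ?K = ?L X Y Z"
      unfolding curvature_fields_chart[OF c e, symmetric] by (rule uncomps_comps[OF c])
  next
    fix a assume "\<forall>X Y Z. extends M p x X \<and> extends M p y Y \<and> extends M p z Z \<longrightarrow> a = ?L X Y Z"
    then have "a = ?L (vf c (\<lambda>_. comps M c p x)) (vf c (\<lambda>_. comps M c p y)) (vf c (\<lambda>_. comps M c p z))"
      using extends_chart[OF c] by blast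
    then show "a = uncomps c p ?K"
      using curvature_fields_chart[OF c extends_chart[OF c] extends_chart[OF c] extends_chart[OF c]] uncomps_comps[OF c, of a] by simp
  qed
  then show ?thesis by (simp add: c)
qed

lemma curvature_deriv_fields_chart:
  assumes c: "c \<in> atlas M" "p \<in> cdom c" and e: "extends M p x X" "extends M p y Y" "extends M p z Z"
  shows "comps M c p (D p w (\<lambda>q. curvature M D q (X q) (Y q) (Z q)) - curvature M D p (D p w X) y z
      - curvature M D p x (D p w Y) z - curvature M D p x y (D p w Z))
    = coord_curv_deriv (christoffel c) (cmap c p) (comps M c p w) (comps M c p x) (comps M c p y) (comps M c p z)"
proof -
  obtain W where W: "mopen M W" "p \<in> W" "W \<subseteq> cdom c" and XYZ: "smooth_vf M W X" "smooth_vf M W Y" "smooth_vf M W Z"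
    by (rule extends_common[OF c e])
  have v: "X p = x" "Y p = y" "Z p = z" using e by (auto simp: extends_def)
  interpret coord_levi_civita "cmap c ` cdom c" "christoffel c" "chart_metric c" by (rule coord_levi_civita[OF c(1)])
  let ?N = "cmap c ` W" and ?y = "cmap c p" and ?l = "local_rep M c"
  have N: "open ?N" "?N \<subseteq> cmap c ` cdom c" "?y \<in> ?N"
    using mopen_image_subset[OF W(1,3) c(1)] W by auto
  have sl: "smooth_on ?N (?l X)" if "smooth_vf M W X" for X
    using smooth_vf_local_rep[OF that c(1)] W(3) by (simp add: Int_absorb2)
  let ?F = "\<lambda>z. R z (?l X z) (?l Y z) (?l Z z)"
  have lr: "?l (\<lambda>q. curvature M D q (X q) (Y q) (Z q)) z = ?F z" if "z \<in> ?N" for z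
    using that W(3) c by (auto simp: curvature_chart subset_iff)
  \<comment> \<open>\<open>D_chart\<close> speaks of smooth fields only, so the curvature of three
    smooth fields has to be known to be one before it can be differentiated.\<close>
  have "smooth_on ?N ?F" by (rule smooth_R_app[OF sl sl sl N(1,2)]) (fact XYZ)+
  then have "smooth_on ?N (?l (\<lambda>q. curvature M D q (X q) (Y q) (Z q)))"
    by (rule smooth_on_cong[THEN iffD1, rotated]) (simp add: lr)
  then have "smooth_vf M W (\<lambda>q. curvature M D q (X q) (Y q) (Z q))"
    by (rule smooth_vf_in_chart[OF W(1,3) c(1)])
  from D_chart[OF c(1) W(1) this W(2) c(2)]
  have "comps M c p (D p w (\<lambda>q. curvature M D q (X q) (Y q) (Z q))) = cov_der (christoffel c) ?y (comps M c p w) ?F"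
    using cov_der_cong[OF N(1,3) lr] by simp
  then show ?thesis
    using curvature_deriv_fields[OF sl[OF XYZ(1)] sl[OF XYZ(2)] sl[OF XYZ(3)] N, of "comps M c p w"] c
    by (simp add: linear_diff[OF linear_comps[OF c]] curvature_chart[OF c] v XYZ D_chart[OF c(1) W(1) _ W(2) c(2)])
qed

lemma curvature_deriv_chart:
  assumes c: "c \<in> atlas M" "p \<in> cdom c"
  shows "comps M c p (curvature_deriv M D p w x y z) =
    coord_curv_deriv (christoffel c) (cmap c p) (comps M c p w) (comps M c p x) (comps M c p y) (comps M c p z)" (is "_ = ?K")
proof -
  let ?L = "\<lambda>X Y Z. D p w (\<lambda>q. curvature M D q (X q) (Y q) (Z q)) - curvature M D p (D p w X) y z - curvature M D p x (D p w Y) z - curvature M D p x y (D p w Z)"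
  have "curvature_deriv M D p w x y z = uncomps c p ?K"
    unfolding curvature_deriv_def
  proof (rule the_equality, intro allI impI, elim conjE)
    fix X Y Z assume e: "extends M p x X" "extends M p y Y" "extends M p z Z"
    show "uncomps c p ?K = ?L X Y Z"
      unfolding curvature_deriv_fields_chart[OF c e, symmetric] by (rule uncomps_comps[OF c])
  next
    fix a assume "\<forall>X Y Z. extends M p x X \<and> extends M p y Y \<and> extends M p z Z \<longrightarrow> a = ?L X Y Z"
    then have "a = ?L (vf c (\<lambda>_. comps M c p x)) (vf c (\<lambda>_. comps M c p y)) (vf c (\<lambda>_. comps M c p z))"
      using extends_chart[OF c] by blast
    then show "a = uncomps c p ?K"
      using curvature_deriv_fields_chart[OF c extends_chart[OF c] extends_chart[OF c] extends_chart[OF c]] uncomps_comps[OF c, of a] by simp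
  qed
  then show ?thesis by (simp add: c)
qed

end

section \<open>The frame bundle in coordinates\<close>

type_synonym ('a, 'n) hv = "'a \<times> ('a^'n)"

text \<open>A relation between a function and its derivative in one direction. It carries
  differentiability along, and the value is assembled by unification when product rules are
  chained.\<close>

definition has_dir :: "'b::real_normed_vector \<Rightarrow> 'b \<Rightarrow> ('b \<Rightarrow> 'c::real_normed_vector) \<Rightarrow> 'c \<Rightarrow> bool" where
  "has_dir p A f f' \<longleftrightarrow> (\<exists>d. (f has_derivative d) (at p) \<and> f' = d A)"

lemma has_dir_unique: "has_dir p A f f' \<Longrightarrow> has_dir p A f f'' \<Longrightarrow> f' = f''"
  unfolding has_dir_def using has_derivative_unique by blast

lemma has_dir_eq: "has_dir p A f f' \<Longrightarrow> f' = f'' \<Longrightarrow> has_dir p A f f''"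
  by simp

lemma has_dirI: "(f has_derivative d) (at p) \<Longrightarrow> has_dir p A f (d A)"
  unfolding has_dir_def by blast

lemma has_dir_transform:
  "has_dir p A f f' \<Longrightarrow> open N \<Longrightarrow> p \<in> N \<Longrightarrow> (\<And>q. q \<in> N \<Longrightarrow> f q = h q) \<Longrightarrow> has_dir p A h f'"
  unfolding has_dir_def by (elim exE conjE) (intro exI conjI, rule has_derivative_transform_within_open)

lemma has_dir_const: "has_dir p A (\<lambda>_. k) 0"
  using has_dirI[OF has_derivative_const] .

lemma has_dir_add: "has_dir p A f f' \<Longrightarrow> has_dir p A h h' \<Longrightarrow> has_dir p A (\<lambda>q. f q + h q) (f' + h')"
  unfolding has_dir_def by (elim exE conjE) (intro exI conjI, erule (1) has_derivative_add, simp)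

lemma has_dir_scaleR:
  "has_dir p A f f' \<Longrightarrow> has_dir p A h h' \<Longrightarrow> has_dir p A (\<lambda>q. f q *\<^sub>R h q) (f p *\<^sub>R h' + f' *\<^sub>R h p)"
  unfolding has_dir_def by (elim exE conjE) (intro exI conjI, erule (1) has_derivative_scaleR, simp)

lemma has_dir_mult:
  fixes f h :: "'b::real_normed_vector \<Rightarrow> real"
  shows "has_dir p A f f' \<Longrightarrow> has_dir p A h h' \<Longrightarrow> has_dir p A (\<lambda>q. f q * h q) (f p * h' + f' * h p)"
  using has_dir_scaleR[of p A f f' h h'] by simp

lemma has_dir_sum:
  "(\<And>i. i \<in> I \<Longrightarrow> has_dir p A (f i) (f' i)) \<Longrightarrow> has_dir p A (\<lambda>q. \<Sum>i\<in>I. f i q) (\<Sum>i\<in>I. f' i)"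
proof (induction I rule: infinite_finite_induct)
  case (insert i I)
  then show ?case using has_dir_add[of p A "f i" "f' i" "\<lambda>q. \<Sum>i\<in>I. f i q" "\<Sum>i\<in>I. f' i"] by simp
qed (simp_all add: has_dir_const)

lemma has_dir_compose_real:
  "(\<phi> has_real_derivative \<phi>') (at (f p)) \<Longrightarrow> has_dir p A f f' \<Longrightarrow> has_dir p A (\<lambda>q. \<phi> (f q)) (\<phi>' * f')"
  unfolding has_dir_def has_field_derivative_def
  by (elim exE conjE) (intro exI conjI, erule (1) has_derivative_compose, simp)

section \<open>Covariant derivatives along the bundle projection\<close>

context coord_levi_civita
begin

text \<open>\<open>F'\<close> is the covariant derivative in direction \<open>A\<close> of \<open>F\<close>, a section along the bundle
  projection \<open>fst\<close>.\<close>

definition has_cov :: "('a, 'n::finite) hv \<Rightarrow> ('a, 'n) hv \<Rightarrow> (('a, 'n) hv \<Rightarrow> 'a) \<Rightarrow> 'a \<Rightarrow> bool" where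
  "has_cov p A F F' \<longleftrightarrow> has_dir p A F (F' - \<Gamma> (fst p) (fst A) (F p))"

lemma has_cov_unique: "has_cov p A F F' \<Longrightarrow> has_cov p A F F'' \<Longrightarrow> F' = F''"
  unfolding has_cov_def using has_dir_unique by fastforce

lemma has_cov_eq: "has_cov p A F F' \<Longrightarrow> F' = F'' \<Longrightarrow> has_cov p A F F''"
  by simp

lemma has_cov_transform:
  "has_cov p A F F' \<Longrightarrow> open N \<Longrightarrow> p \<in> N \<Longrightarrow> (\<And>q. q \<in> N \<Longrightarrow> F q = H q) \<Longrightarrow> has_cov p A H F'"
  unfolding has_cov_def using has_dir_transform[of p A F _ N H] by simp

lemma has_covI: "has_dir p A F F' \<Longrightarrow> has_cov p A F (F' + \<Gamma> (fst p) (fst A) (F p))"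
  by (simp add: has_cov_def)

lemma along_fst:
  assumes "fst p \<in> S"
  shows "open (S \<times> UNIV)" "p \<in> S \<times> UNIV" "\<And>z. z \<in> S \<times> UNIV \<Longrightarrow> fst z \<in> S"
    "(fst has_derivative fst) (at p)"
  using assms open_S by (auto simp: mem_Times_iff intro: open_Times bounded_linear_imp_has_derivative bounded_linear_fst)

context
  fixes p A :: "('a, 'n::finite) hv"
  assumes p: "fst p \<in> S"
begin

lemma has_cov_add: "has_cov p A F F' \<Longrightarrow> has_cov p A H H' \<Longrightarrow> has_cov p A (\<lambda>q. F q + H q) (F' + H')"
  unfolding has_cov_def by (drule (1) has_dir_add) (simp add: Gamma_simps[OF p] algebra_simps)

lemma has_cov_scaleR:
  "has_dir p A f f' \<Longrightarrow> has_cov p A F F' \<Longrightarrow> has_cov p A (\<lambda>q. f q *\<^sub>R F q) (f p *\<^sub>R F' + f' *\<^sub>R F p)"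
  unfolding has_cov_def by (drule (1) has_dir_scaleR) (simp add: Gamma_simps[OF p] algebra_simps)

lemma has_cov_sum:
  "(\<And>i. i \<in> I \<Longrightarrow> has_cov p A (F i) (F' i)) \<Longrightarrow> has_cov p A (\<lambda>q. \<Sum>i\<in>I. F i q) (\<Sum>i\<in>I. F' i)"
proof (induction I rule: infinite_finite_induct)
  case (insert i I)
  then show ?case using has_cov_add[of "F i" "F' i" "\<lambda>q. \<Sum>i\<in>I. F i q" "\<Sum>i\<in>I. F' i"] by simp
qed (use p in \<open>simp_all add: has_cov_def has_dir_const Gamma_simps\<close>)

text \<open>The tensor is pulled back from the base, so only \<open>fst A\<close> differentiates it.
  The Christoffel terms of the three arguments and of the value are exactly those in
  \<open>coord_curv_deriv\<close>.\<close>

lemma has_cov_R: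
  assumes "has_cov p A f f'" "has_cov p A h h'" "has_cov p A k k'"
  shows "has_cov p A (\<lambda>q. R (fst q) (f q) (h q) (k q))
    (dR (fst p) (fst A) (f p) (h p) (k p) + R (fst p) f' (h p) (k p) + R (fst p) (f p) h' (k p) + R (fst p) (f p) (h p) k')"
proof -
  obtain df dh dk where d: "(f has_derivative df) (at p)" "(h has_derivative dh) (at p)" "(k has_derivative dk) (at p)"
    and e: "f' = df A + \<Gamma> (fst p) (fst A) (f p)" "h' = dh A + \<Gamma> (fst p) (fst A) (h p)" "k' = dk A + \<Gamma> (fst p) (fst A) (k p)"
    using assms unfolding has_cov_def has_dir_def by (auto simp: algebra_simps)
  show ?thesis
    unfolding has_cov_def e
    by (rule has_dir_eq[OF has_dirI[OF R_along_has_derivative[OF along_fst[OF p] d]]])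
      (simp_all add: coord_curv_deriv_def R_simps[OF p])
qed

lemma has_dir_G:
  assumes "has_cov p A f f'" "has_cov p A h h'"
  shows "has_dir p A (\<lambda>q. G (fst q) (f q) (h q)) (G (fst p) f' (h p) + G (fst p) (f p) h')"
proof -
  obtain df dh where d: "(f has_derivative df) (at p)" "(h has_derivative dh) (at p)"
    and e: "f' = df A + \<Gamma> (fst p) (fst A) (f p)" "h' = dh A + \<Gamma> (fst p) (fst A) (h p)"
    using assms unfolding has_cov_def has_dir_def by (auto simp: algebra_simps)
  show ?thesis
    unfolding e by (rule has_dirI[OF G_along_has_derivative[OF along_fst[OF p] d]])
qed

text \<open>\<open>\<Gamma>\<close> is not a tensor, so a derivative of the symbols remains. It is
  needed because the vertical parts of a vector contain \<open>\<Gamma>\<close>, and its skew part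
  is where the curvature enters the torsion.\<close>

lemma has_cov_Gamma:
  assumes "has_dir p A f f'" "has_dir p A h h'"
  shows "has_cov p A (\<lambda>q. \<Gamma> (fst q) (f q) (h q))
    (d\<Gamma> (fst p) (fst A) (f p) (h p) + \<Gamma> (fst p) (f p) h' + \<Gamma> (fst p) f' (h p) + \<Gamma> (fst p) (fst A) (\<Gamma> (fst p) (f p) (h p)))"
proof -
  obtain df dh where d: "(f has_derivative df) (at p)" "(h has_derivative dh) (at p)" and e: "f' = df A" "h' = dh A"
    using assms unfolding has_dir_def by auto
  show ?thesis
    unfolding e by (rule has_covI[OF has_dirI[OF Gamma_along_has_derivative[OF along_fst[OF p] d]]])
qed

end

lemma has_dir_snd_nth: "has_dir p A (\<lambda>q. snd q $ l) (snd A $ l)"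
  by (rule has_dirI[OF bounded_linear_imp_has_derivative[OF bounded_linear_snd_nth]])

lemma has_cov_base:
  fixes F :: "'a \<Rightarrow> 'a"
  assumes "(F has_derivative F') (at (fst p))"
  shows "has_cov p A (\<lambda>q. F (fst q)) (cov_der \<Gamma> (fst p) (fst A) F)"
proof -
  have "(fst has_derivative fst) (at p)"
    by (intro bounded_linear_imp_has_derivative bounded_linear_fst)
  from has_dirI[OF has_derivative_compose[OF this assms], of A]
  show ?thesis using der_eqI[OF assms] by (simp add: has_cov_def cov_der_def)
qed

text \<open>The affine field with value \<open>c\<close> at \<open>y\<close> that is parallel to
  first order there. Since only the derivative at one point matters, no parallel transport is
  needed.\<close>

definition parallel_ext :: "'a \<Rightarrow> 'a \<Rightarrow> 'a \<Rightarrow> 'a" where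
  "parallel_ext y c z = c - \<Gamma> y (z - y) c"

lemma parallel_ext:
  assumes y: "y \<in> S"
  shows "parallel_ext y c y = c" "(parallel_ext y c has_derivative (\<lambda>w. - \<Gamma> y w c)) (at z)"
    "cov_der \<Gamma> y w (parallel_ext y c) = 0" "open N \<Longrightarrow> smooth_on N (parallel_ext y c)"
proof -
  have bl: "bounded_linear (\<lambda>w. \<Gamma> y w c)" using lin1[OF y] by (simp add: linear_linear)
  show 1: "parallel_ext y c y = c" by (simp add: parallel_ext_def Gamma_simps[OF y])
  show 2: "(parallel_ext y c has_derivative (\<lambda>w. - \<Gamma> y w c)) (at z)" for z
    unfolding parallel_ext_def[abs_def]
    by (auto intro!: derivative_eq_intros bounded_linear.has_derivative[OF bl])
  show "cov_der \<Gamma> y w (parallel_ext y c) = 0" using der_eqI[OF 2[of y]] 1 by (simp add: cov_der_def)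
  show "smooth_on N (parallel_ext y c)" if "open N"
    unfolding parallel_ext_def[abs_def] using that
    by (intro smooth_on_diff smooth_on_const smooth_on_bounded_linear[OF bl] smooth_on_ident)
qed

end

text \<open>The functions \<open>\<alpha>1\<close>, \<open>\<alpha>2\<close>,
  \<open>\<beta>1\<close>, \<open>\<beta>2\<close> are the successive derivatives of
  \<open>\<alpha>\<close> and \<open>\<beta>\<close>. Everything is asked at t > 0, which is where
  the squared lengths of frame vectors lie; the end point with its one-sided derivatives is thereby
  avoided.\<close>

locale frame_coord = coord_levi_civita S \<Gamma> G
  for S :: "'a::euclidean_space set" and \<Gamma> :: "'a \<Rightarrow> 'a \<Rightarrow> 'a \<Rightarrow> 'a" and G :: "'a \<Rightarrow> 'a \<Rightarrow> 'a \<Rightarrow> real" +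
  fixes Fr :: "('a^'n) set"
    and \<Gamma>b :: "('a, 'n) hv \<Rightarrow> ('a, 'n) hv \<Rightarrow> ('a, 'n) hv \<Rightarrow> ('a, 'n) hv"
    and gb :: "('a, 'n) hv \<Rightarrow> ('a, 'n) hv \<Rightarrow> ('a, 'n) hv \<Rightarrow> real"
    and \<alpha> \<beta> \<alpha>1 \<alpha>2 \<beta>1 \<beta>2 :: "real \<Rightarrow> real"
  assumes open_Fr: "open Fr"
    and Fr_nonzero: "u \<in> Fr \<Longrightarrow> u $ l \<noteq> 0"
    and bundle_lc: "coord_levi_civita (S \<times> Fr) \<Gamma>b gb"
    and alpha_pos: "t > 0 \<Longrightarrow> \<alpha> t > 0"
    and alpha_beta_pos: "t > 0 \<Longrightarrow> \<alpha> t + t * \<beta> t > 0"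
    and alpha_deriv: "t > 0 \<Longrightarrow> (\<alpha> has_real_derivative \<alpha>1 t) (at t)"
    and alpha1_deriv: "t > 0 \<Longrightarrow> (\<alpha>1 has_real_derivative \<alpha>2 t) (at t)"
    and beta_deriv: "t > 0 \<Longrightarrow> (\<beta> has_real_derivative \<beta>1 t) (at t)"
    and beta1_deriv: "t > 0 \<Longrightarrow> (\<beta>1 has_real_derivative \<beta>2 t) (at t)"
begin

text \<open>The vectors at a frame are split into a horizontal part in \<open>'a\<close> and \<open>n\<close> vertical parts:
  \<open>lift p (X, \<eta>)\<close> is \<open>X\<^sup>h + \<Sum>\<^sub>l \<eta>\<^sub>l\<^sup>v\<^sup>,\<^sup>l\<close>, and \<open>split p\<close> is its inverse.\<close>

definition lift :: "('a, 'n) hv \<Rightarrow> ('a, 'n) hv \<Rightarrow> ('a, 'n) hv" where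
  "lift p \<zeta> = (fst \<zeta>, \<chi> l. snd \<zeta> $ l - \<Gamma> (fst p) (fst \<zeta>) (snd p $ l))"

definition split :: "('a, 'n) hv \<Rightarrow> ('a, 'n) hv \<Rightarrow> ('a, 'n) hv" where
  "split p A = (fst A, \<chi> l. snd A $ l + \<Gamma> (fst p) (fst A) (snd p $ l))"

abbreviation "\<Omega> \<equiv> S \<times> Fr"

abbreviation r :: "('a, 'n) hv \<Rightarrow> 'n \<Rightarrow> real" where
  "r p l \<equiv> G (fst p) (snd p $ l) (snd p $ l)"

definition vmetric :: "('a, 'n) hv \<Rightarrow> 'n \<Rightarrow> 'a \<Rightarrow> 'a \<Rightarrow> real" where
  "vmetric p l X Y = \<alpha> (r p l) * G (fst p) X Y + \<beta> (r p l) * G (fst p) X (snd p $ l) * G (fst p) Y (snd p $ l)"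

definition adapted_metric :: "('a, 'n) hv \<Rightarrow> ('a, 'n) hv \<Rightarrow> ('a, 'n) hv \<Rightarrow> real" where
  "adapted_metric p \<xi> \<zeta> = G (fst p) (fst \<xi>) (fst \<zeta>) + (\<Sum>l\<in>UNIV. vmetric p l (snd \<xi> $ l) (snd \<zeta> $ l))"

text \<open>The three coefficients are the solution of the linear system recorded in
  \<open>c_identities\<close>, which arises when \<open>vdiff\<close> is inserted into the metric
  condition and the coefficients of the different products of inner products are compared.\<close>

definition c1 :: "real \<Rightarrow> real" where "c1 t = \<alpha>1 t / \<alpha> t"
definition c2 :: "real \<Rightarrow> real" where "c2 t = (\<beta> t - \<alpha>1 t) / (\<alpha> t + t * \<beta> t)"
definition c3 :: "real \<Rightarrow> real" where "c3 t = (\<alpha> t * \<beta>1 t - 2 * \<alpha>1 t * \<beta> t) / (\<alpha> t * (\<alpha> t + t * \<beta> t))"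

text \<open>The difference tensor between the Levi-Civita connection of the bundle and the connection
  that acts on the horizontal and the vertical parts by \<open>\<nabla>\<close>.\<close>

definition vdiff :: "('a, 'n) hv \<Rightarrow> 'n \<Rightarrow> 'a \<Rightarrow> 'a \<Rightarrow> 'a" where
  "vdiff p l X Y = (let u = snd p $ l; y = fst p in
    c1 (r p l) *\<^sub>R (G y X u *\<^sub>R Y + G y Y u *\<^sub>R X) + (c2 (r p l) * G y X Y + c3 (r p l) * (G y X u * G y Y u)) *\<^sub>R u)"

text \<open>Up to sign the adjoint of the curvature term in \<open>diff_v\<close>, by pair symmetry,
  so that the two cancel in the metric condition. Only \<open>\<alpha>\<close> occurs, since R(X,Y)u
  is orthogonal to u and \<open>\<beta>\<close> does not see it.\<close>

definition diff_h :: "('a, 'n) hv \<Rightarrow> ('a, 'n) hv \<Rightarrow> ('a, 'n) hv \<Rightarrow> 'a" where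
  "diff_h p \<xi> \<zeta> = (\<Sum>l\<in>UNIV. (\<alpha> (r p l) / 2) *\<^sub>R
     (R (fst p) (snd p $ l) (snd \<zeta> $ l) (fst \<xi>) + R (fst p) (snd p $ l) (snd \<xi> $ l) (fst \<zeta>)))"

text \<open>The curvature term is skew in the two horizontal arguments, so the factor -1/2 makes its
  antisymmetrization cancel the torsion; \<open>vdiff\<close> is symmetric and leaves it
  alone.\<close>

definition diff_v :: "('a, 'n) hv \<Rightarrow> ('a, 'n) hv \<Rightarrow> ('a, 'n) hv \<Rightarrow> 'n \<Rightarrow> 'a" where
  "diff_v p \<xi> \<zeta> l = - (1/2) *\<^sub>R R (fst p) (fst \<xi>) (fst \<zeta>) (snd p $ l) + vdiff p l (snd \<xi> $ l) (snd \<zeta> $ l)"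

definition diff :: "('a, 'n) hv \<Rightarrow> ('a, 'n) hv \<Rightarrow> ('a, 'n) hv \<Rightarrow> ('a, 'n) hv" where
  "diff p \<xi> \<zeta> = (diff_h p \<xi> \<zeta>, \<chi> l. diff_v p \<xi> \<zeta> l)"

end

text \<open>A second layer, because the condition on \<open>gb\<close> is phrased with
  \<open>lift\<close> and \<open>adapted_metric\<close>, which depend on the data of the
  first.\<close>

locale frame_coord_metric = frame_coord S \<Gamma> G Fr \<Gamma>b gb \<alpha> \<beta> \<alpha>1 \<alpha>2 \<beta>1 \<beta>2
  for S :: "'a::euclidean_space set" and \<Gamma> :: "'a \<Rightarrow> 'a \<Rightarrow> 'a \<Rightarrow> 'a" and G :: "'a \<Rightarrow> 'a \<Rightarrow> 'a \<Rightarrow> real"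
    and Fr :: "('a^'n) set"
    and \<Gamma>b :: "('a, 'n) hv \<Rightarrow> ('a, 'n) hv \<Rightarrow> ('a, 'n) hv \<Rightarrow> ('a, 'n) hv"
    and gb :: "('a, 'n) hv \<Rightarrow> ('a, 'n) hv \<Rightarrow> ('a, 'n) hv \<Rightarrow> real"
    and \<alpha> \<beta> \<alpha>1 \<alpha>2 \<beta>1 \<beta>2 :: "real \<Rightarrow> real" +
  assumes gb_lift: "y \<in> S \<Longrightarrow> u \<in> Fr \<Longrightarrow> gb (y, u) (lift (y, u) \<xi>) (lift (y, u) \<zeta>) = adapted_metric (y, u) \<xi> \<zeta>"
begin

sublocale b: coord_levi_civita \<Omega> \<Gamma>b gb by (rule bundle_lc)

lemma lift_split [simp]: "lift p (split p A) = A"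
  by (simp add: lift_def split_def prod_eq_iff vec_eq_iff)

lemma split_lift [simp]: "split p (lift p A) = A"
  by (simp add: lift_def split_def prod_eq_iff vec_eq_iff)

lemma r_pos: "p \<in> \<Omega> \<Longrightarrow> 0 < r p l"
  using posG Fr_nonzero by (auto simp: mem_Times_iff)

lemma gb_eq: "p \<in> \<Omega> \<Longrightarrow> gb p A B = adapted_metric p (split p A) (split p B)"
  using gb_lift[of "fst p" "snd p" "split p A" "split p B"] by (simp add: mem_Times_iff)

lemma split_add: "p \<in> \<Omega> \<Longrightarrow> split p (A + B) = split p A + split p B"
  and split_diff: "p \<in> \<Omega> \<Longrightarrow> split p (A - B) = split p A - split p B"
  by (auto simp: split_def prod_eq_iff vec_eq_iff Gamma_simps)

text \<open>The covariant derivative of \<open>split p B\<close>, for constant \<open>B\<close>.\<close>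

definition dsplit :: "('a, 'n) hv \<Rightarrow> ('a, 'n) hv \<Rightarrow> ('a, 'n) hv \<Rightarrow> ('a, 'n) hv" where
  "dsplit p A B = (let y = fst p in (\<Gamma> y (fst A) (fst B),
     \<chi> l. d\<Gamma> y (fst A) (fst B) (snd p $ l) + \<Gamma> y (fst B) (snd A $ l)
       + \<Gamma> y (fst A) (snd B $ l + \<Gamma> y (fst B) (snd p $ l))))"

text \<open>Constant fields commute, so this difference is the torsion of the connection acting on
  the parts.\<close>

lemma dsplit_antisym:
  assumes p: "p \<in> \<Omega>"
  shows "dsplit p A B - dsplit p B A = (0, \<chi> l. R (fst p) (fst A) (fst B) (snd p $ l))"
proof -
  have y: "fst p \<in> S" using p by auto
  show ?thesis
    by (simp add: dsplit_def Let_def prod_eq_iff vec_eq_iff coord_curv_def Gamma_simps[OF y] sym[OF y, of "fst A" "fst B"])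
qed

lemma vdiff_sym: "p \<in> \<Omega> \<Longrightarrow> vdiff p l X Y = vdiff p l Y X"
  by (auto simp: vdiff_def Let_def symG[of _ X Y] algebra_simps)

lemma diff_antisym:
  assumes p: "p \<in> \<Omega>"
  shows "diff p \<xi> \<zeta> - diff p \<zeta> \<xi> = (0, \<chi> l. - R (fst p) (fst \<xi>) (fst \<zeta>) (snd p $ l))"
proof -
  have y: "fst p \<in> S" using p by auto
  have "- (1/2) *\<^sub>R v - (1/2) *\<^sub>R v = - v" for v :: 'a
    by (simp flip: scaleR_add_left add: algebra_simps)
  then show ?thesis
    using vdiff_sym[OF p]
    by (simp add: diff_def diff_h_def diff_v_def prod_eq_iff vec_eq_iff add.commute R_skew[of _ "fst \<zeta>" "fst \<xi>"] flip: scaleR_right_distrib)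
qed

lemma has_dir_r:
  assumes p: "p \<in> \<Omega>"
  shows "has_dir p A (\<lambda>q. r q l) (2 * G (fst p) (snd (split p A) $ l) (snd p $ l))"
proof -
  have y: "fst p \<in> S" using p by auto
  have "has_cov p A (\<lambda>q. snd q $ l) (snd (split p A) $ l)"
    by (rule has_cov_eq[OF has_covI[OF has_dir_snd_nth]]) (simp add: split_def)
  then show ?thesis
    by (rule has_dir_eq[OF has_dir_G[OF y]], assumption) (simp add: symG[OF y])
qed

end

section \<open>Connection and curvature of the bundle metric in coordinates\<close>

context frame_coord
begin

text \<open>The covariant derivatives of \<open>vmetric\<close> and of the difference tensor in a direction with parts
  \<open>\<kappa>\<close>. Horizontally only \<open>R\<close> varies, since \<open>G\<close> and the frame vectors are parallel; vertically only
  the frame vectors vary.\<close>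

definition dvmetric :: "('a, 'n) hv \<Rightarrow> 'n \<Rightarrow> 'a \<Rightarrow> 'a \<Rightarrow> 'a \<Rightarrow> real" where
  "dvmetric p l K X Y = (let u = snd p $ l; y = fst p; t = r p l in
     2 * \<alpha>1 t * G y K u * G y X Y + 2 * \<beta>1 t * G y K u * G y X u * G y Y u
     + \<beta> t * (G y X K * G y Y u + G y X u * G y Y K))"

definition dvdiff :: "('a, 'n) hv \<Rightarrow> 'n \<Rightarrow> 'a \<Rightarrow> 'a \<Rightarrow> 'a \<Rightarrow> 'a" where
  "dvdiff p l K X Y = (let u = snd p $ l; y = fst p; t = r p l in
     (2 * deriv c1 t * G y K u) *\<^sub>R (G y X u *\<^sub>R Y + G y Y u *\<^sub>R X) + c1 t *\<^sub>R (G y X K *\<^sub>R Y + G y Y K *\<^sub>R X)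
     + (2 * deriv c2 t * G y K u * G y X Y + 2 * deriv c3 t * G y K u * (G y X u * G y Y u)
        + c3 t * (G y X K * G y Y u + G y X u * G y Y K)) *\<^sub>R u
     + (c2 t * G y X Y + c3 t * (G y X u * G y Y u)) *\<^sub>R K)"

definition ddiff_h :: "('a, 'n) hv \<Rightarrow> ('a, 'n) hv \<Rightarrow> ('a, 'n) hv \<Rightarrow> ('a, 'n) hv \<Rightarrow> 'a" where
  "ddiff_h p \<kappa> \<xi> \<zeta> = (\<Sum>l\<in>UNIV. let u = snd p $ l; y = fst p; t = r p l in
     (\<alpha>1 t * G y (snd \<kappa> $ l) u) *\<^sub>R (R y u (snd \<zeta> $ l) (fst \<xi>) + R y u (snd \<xi> $ l) (fst \<zeta>))
     + (\<alpha> t / 2) *\<^sub>R (dR y (fst \<kappa>) u (snd \<zeta> $ l) (fst \<xi>) + R y (snd \<kappa> $ l) (snd \<zeta> $ l) (fst \<xi>)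
        + (dR y (fst \<kappa>) u (snd \<xi> $ l) (fst \<zeta>) + R y (snd \<kappa> $ l) (snd \<xi> $ l) (fst \<zeta>))))"

definition ddiff_v :: "('a, 'n) hv \<Rightarrow> ('a, 'n) hv \<Rightarrow> ('a, 'n) hv \<Rightarrow> ('a, 'n) hv \<Rightarrow> 'n \<Rightarrow> 'a" where
  "ddiff_v p \<kappa> \<xi> \<zeta> l = (let u = snd p $ l; y = fst p in
     - (1/2) *\<^sub>R (dR y (fst \<kappa>) (fst \<xi>) (fst \<zeta>) u + R y (fst \<xi>) (fst \<zeta>) (snd \<kappa> $ l))
     + dvdiff p l (snd \<kappa> $ l) (snd \<xi> $ l) (snd \<zeta> $ l))"

definition ddiff :: "('a, 'n) hv \<Rightarrow> ('a, 'n) hv \<Rightarrow> ('a, 'n) hv \<Rightarrow> ('a, 'n) hv \<Rightarrow> ('a, 'n) hv" where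
  "ddiff p \<kappa> \<xi> \<zeta> = (ddiff_h p \<kappa> \<xi> \<zeta>, \<chi> l. ddiff_v p \<kappa> \<xi> \<zeta> l)"

lemma c_deriv:
  assumes t: "t > 0"
  shows "(c1 has_real_derivative (\<alpha>2 t * \<alpha> t - (\<alpha>1 t)\<^sup>2) / (\<alpha> t)\<^sup>2) (at t)" (is ?A)
    "(c2 has_real_derivative ((\<beta>1 t - \<alpha>2 t) * (\<alpha> t + t * \<beta> t) - (\<beta> t - \<alpha>1 t) * (\<alpha>1 t + \<beta> t + t * \<beta>1 t)) / (\<alpha> t + t * \<beta> t)\<^sup>2) (at t)" (is ?B)
    "(c3 has_real_derivative deriv c3 t) (at t)"
proof -
  note d = alpha_deriv[OF t] alpha1_deriv[OF t] beta_deriv[OF t] beta1_deriv[OF t]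
  have nz: "\<alpha> t \<noteq> 0" "\<alpha> t + t * \<beta> t \<noteq> 0" using alpha_pos[OF t] alpha_beta_pos[OF t] by auto
  show ?A
    unfolding c1_def[abs_def] using nz
    by (auto intro!: derivative_eq_intros d simp: power2_eq_square)
  show ?B
    unfolding c2_def[abs_def] using nz
    by (auto intro!: derivative_eq_intros d simp: power2_eq_square)
  \<comment> \<open>Differentiability of \<open>c3\<close> is enough: its derivative enters
    \<open>dvdiff\<close> only in a term symmetric in all three arguments, which cancels from the
    curvature.\<close>
  have "\<exists>D. (c3 has_real_derivative D) (at t)"
    unfolding c3_def[abs_def] using nz
    by (intro exI) (rule derivative_eq_intros d refl | simp)+
  then show "(c3 has_real_derivative deriv c3 t) (at t)" using DERIV_imp_deriv by blast
qed

lemmas deriv_c = c_deriv(1,2)[THEN DERIV_imp_deriv]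

end

context frame_coord_metric
begin

lemma has_cov_frame:
  assumes p: "p \<in> \<Omega>"
  shows "has_cov p A (\<lambda>q. snd q $ l) (snd (split p A) $ l)"
  by (rule has_cov_eq[OF has_covI[OF has_dir_snd_nth]]) (simp add: split_def)

lemma fst_in: "p \<in> \<Omega> \<Longrightarrow> fst p \<in> S"
  by auto

lemma open_total: "open \<Omega>"
  using b.open_S .

lemma has_dir_vmetric:
  assumes p: "p \<in> \<Omega>" and f: "has_cov p A f f'" and h: "has_cov p A h h'"
  shows "has_dir p A (\<lambda>q. vmetric q l (f q) (h q))
    (vmetric p l f' (h p) + vmetric p l (f p) h' + dvmetric p l (snd (split p A) $ l) (f p) (h p))"
proof -
  note y = fst_in[OF p]
  note u = has_cov_frame[OF p, of A l]
  have a: "has_dir p A (\<lambda>q. \<alpha> (r q l)) (\<alpha>1 (r p l) * (2 * G (fst p) (snd (split p A) $ l) (snd p $ l)))"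
    by (rule has_dir_compose_real[OF alpha_deriv[OF r_pos[OF p]] has_dir_r[OF p]])
  have b: "has_dir p A (\<lambda>q. \<beta> (r q l)) (\<beta>1 (r p l) * (2 * G (fst p) (snd (split p A) $ l) (snd p $ l)))"
    by (rule has_dir_compose_real[OF beta_deriv[OF r_pos[OF p]] has_dir_r[OF p]])
  show ?thesis
    unfolding vmetric_def
    by (rule has_dir_eq[OF has_dir_add[OF has_dir_mult[OF a has_dir_G[OF y f h]]
            has_dir_mult[OF has_dir_mult[OF b has_dir_G[OF y f u]] has_dir_G[OF y h u]]]])
      (simp add: dvmetric_def vmetric_def Let_def algebra_simps)
qed

lemma has_cov_split:
  assumes p: "p \<in> \<Omega>"
  shows "has_cov p A (\<lambda>q. fst (split q B)) (fst (dsplit p A B))"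
    "has_cov p A (\<lambda>q. snd (split q B) $ l) (snd (dsplit p A B) $ l)"
proof -
  note y = fst_in[OF p]
  show "has_cov p A (\<lambda>q. fst (split q B)) (fst (dsplit p A B))"
    unfolding split_def
    by (rule has_cov_eq, simp, rule has_covI[OF has_dir_const]) (simp add: dsplit_def Let_def)
  have "has_cov p A (\<lambda>q. snd B $ l + \<Gamma> (fst q) (fst B) (snd q $ l)) (snd (dsplit p A B) $ l)"
    by (rule has_cov_eq[OF has_cov_add[OF y has_covI[OF has_dir_const] has_cov_Gamma[OF y has_dir_const has_dir_snd_nth]]])
      (simp add: dsplit_def Let_def Gamma_simps[OF y])
  then show "has_cov p A (\<lambda>q. snd (split q B) $ l) (snd (dsplit p A B) $ l)"
    by (simp add: split_def)
qed

lemma has_dir_adapted_metric: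
  assumes p: "p \<in> \<Omega>"
  shows "has_dir p A (\<lambda>q. adapted_metric q (split q B) (split q C))
    (adapted_metric p (dsplit p A B) (split p C) + adapted_metric p (split p B) (dsplit p A C)
      + (\<Sum>l\<in>UNIV. dvmetric p l (snd (split p A) $ l) (snd (split p B) $ l) (snd (split p C) $ l)))"
  unfolding adapted_metric_def
  by (rule has_dir_eq[OF has_dir_add[OF has_dir_G[OF fst_in[OF p] has_cov_split(1)[OF p] has_cov_split(1)[OF p]]
        has_dir_sum[OF has_dir_vmetric[OF p has_cov_split(2)[OF p] has_cov_split(2)[OF p]]]]])
    (simp add: sum.distrib)

lemma vmetric_simps:
  assumes "p \<in> \<Omega>"
  shows "vmetric p l (X + Y) Z = vmetric p l X Z + vmetric p l Y Z" "vmetric p l Z (X + Y) = vmetric p l Z X + vmetric p l Z Y"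
    "vmetric p l (X - Y) Z = vmetric p l X Z - vmetric p l Y Z" "vmetric p l Z (X - Y) = vmetric p l Z X - vmetric p l Z Y"
    "vmetric p l (k *\<^sub>R X) Z = k * vmetric p l X Z" "vmetric p l Z (k *\<^sub>R X) = k * vmetric p l Z X"
  by (simp_all add: vmetric_def G_simps[OF fst_in[OF assms]] algebra_simps)

lemma adapted_metric_simps:
  assumes "p \<in> \<Omega>"
  shows "adapted_metric p (X + Y) Z = adapted_metric p X Z + adapted_metric p Y Z"
    "adapted_metric p Z (X + Y) = adapted_metric p Z X + adapted_metric p Z Y"
    "adapted_metric p (X - Y) Z = adapted_metric p X Z - adapted_metric p Y Z"
    "adapted_metric p Z (X - Y) = adapted_metric p Z X - adapted_metric p Z Y"
  by (simp_all add: adapted_metric_def vmetric_simps[OF assms] G_simps[OF fst_in[OF assms]] sum.distrib sum_subtractf)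

lemma c_identities:
  assumes "t > 0"
  shows "\<alpha> t * c1 t = \<alpha>1 t" "c2 t * (\<alpha> t + t * \<beta> t) = \<beta> t - \<alpha>1 t"
    "c3 t * (\<alpha> t + t * \<beta> t) + 2 * \<beta> t * c1 t = \<beta>1 t"
proof -
  have nz: "\<alpha> t \<noteq> 0" "\<alpha> t + t * \<beta> t \<noteq> 0" using alpha_pos[OF assms] alpha_beta_pos[OF assms] by auto
  then show "\<alpha> t * c1 t = \<alpha>1 t" "c2 t * (\<alpha> t + t * \<beta> t) = \<beta> t - \<alpha>1 t" by (simp_all add: c1_def c2_def)
  have "c3 t * (\<alpha> t + t * \<beta> t) = (\<alpha> t * \<beta>1 t - 2 * \<alpha>1 t * \<beta> t) / \<alpha> t" using nz by (simp add: c3_def)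
  then show "c3 t * (\<alpha> t + t * \<beta> t) + 2 * \<beta> t * c1 t = \<beta>1 t" using nz by (simp add: c1_def field_simps)
qed

text \<open>The scalar identity behind \<open>vdiff_metric\<close>: \<open>x\<close>,
  \<open>k\<close>, \<open>z\<close> are the inner products of \<open>X\<close>, \<open>K\<close>,
  \<open>Y\<close> with the frame vector, \<open>xz\<close>, \<open>kx\<close>, \<open>kz\<close>
  those among the three vectors, and \<open>t\<close> is the squared length. Grouping by the
  coefficients lets the three assumptions rewrite each group.\<close>

lemma vdiff_metric_real:
  fixes a b :: real
  assumes "a * q1 = a1" "q2 * (a + t * b) = b - a1" "q3 * (a + t * b) + 2 * b * q1 = b1"
  shows "a * (q1 * (x * kz + k * xz) + (q2 * kx + q3 * (k * x)) * z)
      + b * (q1 * (x * k + k * x) + (q2 * kx + q3 * (k * x)) * t) * z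
    + (a * (q1 * (z * kx + k * xz) + (q2 * kz + q3 * (k * z)) * x)
      + b * x * (q1 * (z * k + k * z) + (q2 * kz + q3 * (k * z)) * t))
    = 2 * a1 * k * xz + 2 * b1 * k * x * z + b * (kx * z + x * kz)"
    (is "?lhs = _")
proof -
  have "?lhs = (a * q1) * (x * kz + 2 * k * xz + z * kx) + (q2 * (a + t * b)) * (kx * z + x * kz)
      + 2 * k * x * z * (q3 * (a + t * b) + 2 * b * q1)"
    by (simp add: algebra_simps)
  then show ?thesis unfolding assms by (simp add: algebra_simps)
qed

lemma vdiff_metric:
  assumes p: "p \<in> \<Omega>"
  shows "vmetric p l (vdiff p l K X) Y + vmetric p l X (vdiff p l K Y) = dvmetric p l K X Y"
proof -
  note y = fst_in[OF p]
  note id = c_identities[OF r_pos[OF p, of l]]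
  show ?thesis
    using vdiff_metric_real[OF id, of "G (fst p) X (snd p $ l)" "G (fst p) K Y" "G (fst p) K (snd p $ l)"
      "G (fst p) X Y" "G (fst p) K X" "G (fst p) Y (snd p $ l)"]
    by (simp add: vmetric_def vdiff_def dvmetric_def Let_def G_simps[OF y] symG[OF y, of X K] symG[OF y, of Y K]
      symG[OF y, of X "snd p $ l"] symG[OF y, of Y "snd p $ l"] symG[OF y, of K "snd p $ l"] symG[OF y, of Y X] algebra_simps)
qed

text \<open>By pair symmetry the terms of \<open>diff_h\<close> with a vertical second argument
  cancel against the curvature terms of \<open>diff_v\<close>; its remaining terms cancel each other
  because \<open>R\<close> is skew for the metric. Only \<open>vdiff\<close> is left, and
  \<open>vdiff_metric\<close> applies.\<close>

lemma diff_metric: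
  assumes p: "p \<in> \<Omega>"
  shows "adapted_metric p (diff p \<kappa> \<xi>) \<zeta> + adapted_metric p \<xi> (diff p \<kappa> \<zeta>)
    = (\<Sum>l\<in>UNIV. dvmetric p l (snd \<kappa> $ l) (snd \<xi> $ l) (snd \<zeta> $ l))"
proof -
  note y = fst_in[OF p]
  let ?G = "G (fst p)" and ?R = "R (fst p)"
  have uu: "?G (?R a b u) u = 0" for a b u using R_skew_G[OF y, of a b u u] symG[OF y] by simp
  have vR: "vmetric p l (?R a b (snd p $ l)) Z = \<alpha> (r p l) * ?G (?R a b (snd p $ l)) Z"
    "vmetric p l Z (?R a b (snd p $ l)) = \<alpha> (r p l) * ?G (?R a b (snd p $ l)) Z" for a b Z l
    by (simp_all add: vmetric_def uu symG[OF y, of Z])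
  have pointwise: "\<alpha> (r p l) / 2 * (?G (?R u \<xi>' k) z + ?G (?R u \<kappa>' x) z) + \<alpha> (r p l) / 2 * (?G x (?R u \<zeta>' k) + ?G x (?R u \<kappa>' z))
      + (vmetric p l (- (1/2) *\<^sub>R ?R k x u + vdiff p l \<kappa>' \<xi>') \<zeta>' + vmetric p l \<xi>' (- (1/2) *\<^sub>R ?R k z u + vdiff p l \<kappa>' \<zeta>'))
      = dvmetric p l \<kappa>' \<xi>' \<zeta>'" if "u = snd p $ l" for l u \<xi>' \<zeta>' \<kappa>' k x z
  proof -
    have e: "?G (?R u \<xi>' k) z = ?G (?R k z u) \<xi>'" "?G x (?R u \<zeta>' k) = ?G (?R k x u) \<zeta>'" "?G x (?R u \<kappa>' z) = - ?G (?R u \<kappa>' x) z"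
      using pair_symmetry[OF y, of u \<xi>' k z] pair_symmetry[OF y, of u \<zeta>' k x] R_skew_G[OF y, of u \<kappa>' x z] symG[OF y]
      by simp_all
    show ?thesis
      unfolding that e[unfolded that] vdiff_metric[OF p, symmetric]
      by (simp add: vmetric_simps[OF p] vR algebra_simps)
  qed
  have "adapted_metric p (diff p \<kappa> \<xi>) \<zeta> + adapted_metric p \<xi> (diff p \<kappa> \<zeta>) =
    (\<Sum>l\<in>UNIV. \<alpha> (r p l) / 2 * (?G (?R (snd p $ l) (snd \<xi> $ l) (fst \<kappa>)) (fst \<zeta>) + ?G (?R (snd p $ l) (snd \<kappa> $ l) (fst \<xi>)) (fst \<zeta>))
      + \<alpha> (r p l) / 2 * (?G (fst \<xi>) (?R (snd p $ l) (snd \<zeta> $ l) (fst \<kappa>)) + ?G (fst \<xi>) (?R (snd p $ l) (snd \<kappa> $ l) (fst \<zeta>)))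
      + (vmetric p l (- (1/2) *\<^sub>R ?R (fst \<kappa>) (fst \<xi>) (snd p $ l) + vdiff p l (snd \<kappa> $ l) (snd \<xi> $ l)) (snd \<zeta> $ l)
       + vmetric p l (snd \<xi> $ l) (- (1/2) *\<^sub>R ?R (fst \<kappa>) (fst \<zeta>) (snd p $ l) + vdiff p l (snd \<kappa> $ l) (snd \<zeta> $ l))))"
    unfolding adapted_metric_def diff_def diff_h_def diff_v_def
    by (simp add: linear_sum[OF linG[OF y]] linear_sum[OF linG1[OF y]] G_simps[OF y] sum.distrib)
  also have "\<dots> = (\<Sum>l\<in>UNIV. dvmetric p l (snd \<kappa> $ l) (snd \<xi> $ l) (snd \<zeta> $ l))"
    by (intro sum.cong refl pointwise)
  finally show ?thesis .
qed

text \<open>Definiteness is carried over from \<open>gb\<close> along \<open>lift\<close>.\<close>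

lemma adapted_metric_eq_0:
  assumes p: "p \<in> \<Omega>" and "adapted_metric p X X = 0"
  shows "X = 0"
proof (rule ccontr)
  assume "X \<noteq> 0"
  moreover have "split p 0 = 0" using fst_in[OF p] by (simp add: split_def prod_eq_iff vec_eq_iff Gamma_simps)
  ultimately have "lift p X \<noteq> 0" by (metis split_lift)
  then have "0 < gb p (lift p X) (lift p X)" by (rule b.posG[OF p])
  then show False using assms by (simp add: gb_eq)
qed

text \<open>A tensor that is symmetric in one pair of arguments and skew in another one vanishes, hence
  the torsion-free metric connection is unique.\<close>

lemma split_Gamma_b:
  assumes p: "p \<in> \<Omega>"
  shows "split p (\<Gamma>b p A B) = dsplit p A B + diff p (split p A) (split p B)"
proof -
  define T where "T A B = split p (\<Gamma>b p A B) - (dsplit p A B + diff p (split p A) (split p B))" for A B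
  have "dsplit p A B + diff p (split p A) (split p B) = dsplit p B A + diff p (split p B) (split p A)" for A B
    using dsplit_antisym[OF p, of A B] diff_antisym[OF p, of "split p A" "split p B"]
    by (auto simp: prod_eq_iff vec_eq_iff split_def algebra_simps)
  then have sym: "T A B = T B A" for A B using b.sym[OF p] by (simp add: T_def)
  have skew: "adapted_metric p (T A B) (split p C) = - adapted_metric p (split p B) (T A C)" for A B C
  proof -
    have "has_dir p A (\<lambda>q. gb q B C) (gb p (\<Gamma>b p A B) C + gb p B (\<Gamma>b p A C))"
      using has_dirI[OF b.G_has_derivative[OF p]] .
    then have "has_dir p A (\<lambda>q. adapted_metric q (split q B) (split q C)) (gb p (\<Gamma>b p A B) C + gb p B (\<Gamma>b p A C))"
      by (rule has_dir_transform[OF _ open_total p gb_eq])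
    from has_dir_unique[OF this has_dir_adapted_metric[OF p]] diff_metric[OF p, of "split p A" "split p B" "split p C"]
    show ?thesis by (simp add: gb_eq[OF p] T_def adapted_metric_simps[OF p])
  qed
  have symm: "adapted_metric p X Y = adapted_metric p Y X" for X Y
    by (simp add: adapted_metric_def vmetric_def symG[OF fst_in[OF p], of "fst X"] symG[OF fst_in[OF p], of "snd X $ _" "snd Y $ _"] mult.commute mult.left_commute)
  \<comment> \<open>Three applications of skewness alternating with three of symmetry lead from the
    triple \<open>A\<close>, \<open>B\<close>, \<open>C\<close> back to itself with the sign
    reversed.\<close>
  have "adapted_metric p (T A B) (split p C) = 0" for C
    using skew[of A B C] sym[of A C] skew[of C A B] sym[of C B] skew[of B C A] sym[of B A] symm by (metis add.inverse_inverse equal_neg_zero)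
  from this[of "lift p (T A B)"] have "T A B = 0" using adapted_metric_eq_0[OF p] by simp
  then show ?thesis by (simp add: T_def)
qed

text \<open>\<open>split_Gamma_b\<close> settles constant fields. For varying \<open>F\<close> the
  derivative of \<open>F\<close> joins \<open>dsplit\<close>, and together they are the covariant
  derivatives \<open>h\<close> and \<open>v\<close> of the parts, by uniqueness of those.\<close>

lemma split_cov_der:
  assumes p: "p \<in> \<Omega>" and F: "(F has_derivative F') (at p)"
    and h: "has_cov p A (\<lambda>q. fst (split q (F q))) h"
    and v: "\<And>l. has_cov p A (\<lambda>q. snd (split q (F q)) $ l) (v l)"
  shows "split p (cov_der \<Gamma>b p A F) = (h, \<chi> l. v l) + diff p (split p A) (split p (F p))"
proof -
  note y = fst_in[OF p]
  have dh: "has_dir p A (\<lambda>q. fst (F q)) (fst (F' A))"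
    by (rule has_dirI) (rule bounded_linear.has_derivative[OF bounded_linear_fst F])
  have dv: "has_dir p A (\<lambda>q. snd (F q) $ l) (snd (F' A) $ l)" for l
    by (rule has_dirI) (rule bounded_linear.has_derivative[OF bounded_linear_vec_nth bounded_linear.has_derivative[OF bounded_linear_snd F]])
  have "h = fst (split p (F' A) + dsplit p A (F p))"
    using has_cov_unique[OF h] has_covI[OF dh] by (simp add: split_def dsplit_def Let_def)
  moreover have "v l = snd (split p (F' A) + dsplit p A (F p)) $ l" for l
  proof -
    have "has_cov p A (\<lambda>q. snd (split q (F q)) $ l) (snd (split p (F' A) + dsplit p A (F p)) $ l)"
      unfolding split_def using y
      by (simp, intro has_cov_eq[OF has_cov_add[OF y has_covI[OF dv] has_cov_Gamma[OF y dh has_dir_snd_nth]]])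
        (simp add: dsplit_def Let_def Gamma_simps[OF y])
    then show ?thesis by (rule has_cov_unique[OF v])
  qed
  ultimately have "(h, \<chi> l. v l) = split p (F' A) + dsplit p A (F p)"
    by (simp add: prod_eq_iff vec_eq_iff)
  then show ?thesis
    using der_eqI[OF F] by (simp add: cov_der_def split_add[OF p] split_Gamma_b[OF p])
qed

text \<open>Arguments that are parallel at \<open>p\<close> in the direction \<open>A\<close>
  isolate the derivative of the tensor itself; only the frame vector and its squared length
  vary.\<close>

lemma has_cov_vdiff:
  assumes p: "p \<in> \<Omega>" and X: "has_cov p A X 0" and Y: "has_cov p A Y 0"
  shows "has_cov p A (\<lambda>q. vdiff q l (X q) (Y q)) (dvdiff p l (snd (split p A) $ l) (X p) (Y p))"
proof -
  note y = fst_in[OF p]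
  note u = has_cov_frame[OF p, of A l]
  have c: "has_dir p A (\<lambda>q. c (r q l)) (deriv c (r p l) * (2 * G (fst p) (snd (split p A) $ l) (snd p $ l)))"
    if "(c has_real_derivative deriv c (r p l)) (at (r p l))" for c
    by (rule has_dir_compose_real[OF that has_dir_r[OF p]])
  note d = c_deriv[OF r_pos[OF p, of l]]
  have c1: "(c1 has_real_derivative deriv c1 (r p l)) (at (r p l))" using d(1) DERIV_imp_deriv by metis
  have c2: "(c2 has_real_derivative deriv c2 (r p l)) (at (r p l))" using d(2) DERIV_imp_deriv by metis
  note Xu = has_dir_G[OF y X u] and Yu = has_dir_G[OF y Y u] and XY = has_dir_G[OF y X Y]
  show ?thesis
    unfolding vdiff_def Let_def
    by (rule has_cov_eq[OF has_cov_add[OF y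
        has_cov_scaleR[OF y c[OF c1] has_cov_add[OF y has_cov_scaleR[OF y Xu Y] has_cov_scaleR[OF y Yu X]]]
        has_cov_scaleR[OF y has_dir_add[OF has_dir_mult[OF c[OF c2] XY] has_dir_mult[OF c[OF d(3)] has_dir_mult[OF Xu Yu]]] u]]])
      (simp add: dvdiff_def Let_def G_simps[OF y] algebra_simps)
qed

lemma has_cov_diff_h:
  assumes p: "p \<in> \<Omega>" and X: "has_cov p A (\<lambda>q. fst (X q)) 0" "\<And>l. has_cov p A (\<lambda>q. snd (X q) $ l) 0"
    and Y: "has_cov p A (\<lambda>q. fst (Y q)) 0" "\<And>l. has_cov p A (\<lambda>q. snd (Y q) $ l) 0"
  shows "has_cov p A (\<lambda>q. diff_h q (X q) (Y q)) (ddiff_h p (split p A) (X p) (Y p))"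
proof -
  note y = fst_in[OF p]
  note u = has_cov_frame[OF p, of A]
  have a: "has_dir p A (\<lambda>q. \<alpha> (r q l) / 2) (\<alpha>1 (r p l) * G (fst p) (snd (split p A) $ l) (snd p $ l))" for l
    using has_dir_mult[OF has_dir_compose_real[OF alpha_deriv[OF r_pos[OF p, of l]] has_dir_r[OF p]] has_dir_const[of p A "1/2"]]
    by simp
  show ?thesis
    unfolding diff_h_def
    by (rule has_cov_eq[OF has_cov_sum[OF y has_cov_scaleR[OF y a has_cov_add[OF y
        has_cov_R[OF y u Y(2) X(1)] has_cov_R[OF y u X(2) Y(1)]]]]])
      (simp add: ddiff_h_def Let_def R_simps[OF y] algebra_simps split_def)
qed

lemma has_cov_diff_v:
  assumes p: "p \<in> \<Omega>" and X: "has_cov p A (\<lambda>q. fst (X q)) 0" "\<And>l. has_cov p A (\<lambda>q. snd (X q) $ l) 0"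
    and Y: "has_cov p A (\<lambda>q. fst (Y q)) 0" "\<And>l. has_cov p A (\<lambda>q. snd (Y q) $ l) 0"
  shows "has_cov p A (\<lambda>q. diff_v q (X q) (Y q) l) (ddiff_v p (split p A) (X p) (Y p) l)"
proof -
  note y = fst_in[OF p]
  note u = has_cov_frame[OF p, of A]
  show ?thesis
    unfolding diff_v_def
    by (rule has_cov_eq[OF has_cov_add[OF y has_cov_scaleR[OF y has_dir_const has_cov_R[OF y X(1) Y(1) u]]
        has_cov_vdiff[OF p X(2) Y(2)]]])
      (simp add: ddiff_v_def Let_def R_simps[OF y] split_def)
qed

section \<open>The curvature of the bundle through the difference tensor\<close>

definition par :: "('a, 'n) hv \<Rightarrow> 'a \<Rightarrow> ('a, 'n) hv \<Rightarrow> ('a, 'n) hv" where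
  "par \<zeta> y q = (parallel_ext y (fst \<zeta>) (fst q), \<chi> l. parallel_ext y (snd \<zeta> $ l) (fst q))"

lemma smooth_lift:
  assumes h: "smooth_on \<Omega> (\<lambda>q. fst (\<eta> q))" and v: "\<And>l. smooth_on \<Omega> (\<lambda>q. snd (\<eta> q) $ l)"
  shows "smooth_on \<Omega> (\<lambda>q. lift q (\<eta> q))"
proof -
  note o = open_total
  have 1: "smooth_on \<Omega> (\<lambda>q. \<Gamma> (fst q) a b)" for a b
    by (rule smooth_on_compose[where f = fst, OF smooth smooth_on_fst[OF o] o open_S]) auto
  have 2: "smooth_on \<Omega> (\<lambda>q. \<Gamma> (fst q) a (snd q $ l))" for a l
    by (rule smooth_on_linear_app[OF 1 lin2 smooth_on_snd_nth[OF o] o]) auto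
  have 3: "smooth_on \<Omega> (\<lambda>q. \<Gamma> (fst q) (fst (\<eta> q)) (snd q $ l))" for l
    by (rule smooth_on_linear_app[OF 2 lin1 h o]) auto
  show ?thesis
    unfolding lift_def by (intro smooth_on_Pair smooth_on_vec_lambda smooth_on_diff h v 3 o)
qed

text \<open>All vectors are extended to fields whose parts are parallel at the base point, so that the
  Christoffel symbols drop out.\<close>

theorem split_curvature:
  assumes p: "p \<in> \<Omega>"
  shows "split p (coord_curv \<Gamma>b p (lift p \<xi>) (lift p \<zeta>) (lift p \<theta>)) =
    (R (fst p) (fst \<xi>) (fst \<zeta>) (fst \<theta>), \<chi> l. R (fst p) (fst \<xi>) (fst \<zeta>) (snd \<theta> $ l))
    + ddiff p \<xi> \<zeta> \<theta> - ddiff p \<zeta> \<xi> \<theta> + diff p \<xi> (diff p \<zeta> \<theta>) - diff p \<zeta> (diff p \<xi> \<theta>)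
    - diff p (diff p \<xi> \<zeta> - diff p \<zeta> \<xi>) \<theta>"
proof -
  note y = fst_in[OF p] and o = open_total
  define e where "e \<zeta> q = par \<zeta> (fst p) q" for \<zeta> q :: "('a, 'n) hv"
  define E where "E \<zeta> q = lift q (e \<zeta> q)" for \<zeta> q :: "('a, 'n) hv"
  have e_p: "e \<zeta> p = \<zeta>" for \<zeta> by (simp add: e_def par_def parallel_ext[OF y])
  have fst_E: "fst (E \<zeta> q) = parallel_ext (fst p) (fst \<zeta>) (fst q)" for \<zeta> q by (simp add: E_def lift_def e_def par_def)
  have e_h: "has_cov q A (\<lambda>q. fst (e \<zeta> q)) (cov_der \<Gamma> (fst q) (fst A) (parallel_ext (fst p) (fst \<zeta>)))" for \<zeta> q A
    using has_cov_base[OF parallel_ext(2)[OF y]] by (simp add: e_def par_def)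
  have e_v: "has_cov q A (\<lambda>q. snd (e \<zeta> q) $ l) (cov_der \<Gamma> (fst q) (fst A) (parallel_ext (fst p) (snd \<zeta> $ l)))" for \<zeta> q A l
    using has_cov_base[OF parallel_ext(2)[OF y]] by (simp add: e_def par_def)
  have e0: "has_cov p A (\<lambda>q. fst (e \<zeta> q)) 0" "has_cov p A (\<lambda>q. snd (e \<zeta> q) $ l) 0" for A \<zeta> l
    using e_h[of p A \<zeta>] e_v[of p A \<zeta> l] by (simp_all add: parallel_ext(3)[OF y])
  have "smooth_on \<Omega> (\<lambda>q. parallel_ext (fst p) c (fst q))" for c
    by (rule smooth_on_compose[where f = fst, OF parallel_ext(4)[OF y open_S] smooth_on_fst[OF o] o open_S]) auto
  then have sE: "smooth_on \<Omega> (E \<zeta>)" for \<zeta>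
    unfolding E_def[abs_def] by (intro smooth_lift) (simp_all add: e_def par_def)
  define W where "W \<zeta> \<theta> q = cov_der \<Gamma>b q (E \<zeta> q) (E \<theta>)" for \<zeta> \<theta> q :: "('a, 'n) hv"
  have sW: "smooth_on \<Omega> (W \<zeta> \<theta>)" for \<zeta> \<theta>
    unfolding W_def[abs_def] by (rule b.smooth_cov_der[OF sE sE o order_refl])
  have der: "(F has_derivative der F q) (at q)" if "smooth_on \<Omega> F" "q \<in> \<Omega>" for F :: "('a, 'n) hv \<Rightarrow> ('a, 'n) hv" and q
    by (rule smooth_on_has_derivative[OF that(1) o that(2)])
  \<comment> \<open>The pulled-back contribution to \<open>W\<close>, a covariant derivative taken
    on the base. It vanishes at the base point, but its derivative there does not: the
    antisymmetrized derivatives of \<open>B\<close> give the term \<open>R\<close> in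
    \<open>base\<close>.\<close>
  define B where "B \<zeta> c z = cov_der \<Gamma> z (parallel_ext (fst p) (fst \<zeta>) z) (parallel_ext (fst p) c)" for \<zeta> :: "('a, 'n) hv" and c z
  have sB: "smooth_on S (B \<zeta> c)" for \<zeta> :: "('a, 'n) hv" and c
    unfolding B_def[abs_def] by (rule smooth_cov_der[OF parallel_ext(4)[OF y open_S] parallel_ext(4)[OF y open_S] open_S order_refl])
  have split_W: "split q (cov_der \<Gamma>b q V (E \<theta>)) = (cov_der \<Gamma> (fst q) (fst V) (parallel_ext (fst p) (fst \<theta>)),
      \<chi> l. cov_der \<Gamma> (fst q) (fst V) (parallel_ext (fst p) (snd \<theta> $ l))) + diff q (split q V) (e \<theta> q)" if "q \<in> \<Omega>" for q V \<theta>
    using split_cov_der[OF that der[OF sE that], of V \<theta>, unfolded E_def split_lift, OF e_h e_v]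
    unfolding E_def[abs_def] .
  have W_h: "fst (split q (W \<zeta> \<theta> q)) = B \<zeta> (fst \<theta>) (fst q) + diff_h q (e \<zeta> q) (e \<theta> q)"
    and W_v: "snd (split q (W \<zeta> \<theta> q)) $ l = B \<zeta> (snd \<theta> $ l) (fst q) + diff_v q (e \<zeta> q) (e \<theta> q) l" if "q \<in> \<Omega>" for q \<zeta> \<theta> l
    using split_W[OF that, of "E \<zeta> q" \<theta>] by (simp_all add: W_def B_def fst_E diff_def) (simp_all add: E_def)
  have B0: "B \<zeta> c (fst p) = 0" for \<zeta> :: "('a, 'n) hv" and c by (simp add: B_def parallel_ext(3)[OF y])
  have W_p: "split p (W \<zeta> \<theta> p) = diff p \<zeta> \<theta>" for \<zeta> \<theta>
    using W_h[OF p] W_v[OF p] by (simp add: B0 e_p diff_def prod_eq_iff vec_eq_iff)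
  have covB: "has_cov p A (\<lambda>q. B \<zeta> c (fst q)) (cov_der \<Gamma> (fst p) (fst A) (B \<zeta> c))" for A \<zeta> c
    by (rule has_cov_base[OF smooth_on_has_derivative[OF sB open_S y]])
  have WW: "split p (cov_der \<Gamma>b p (lift p \<xi>) (W \<zeta> \<theta>)) =
      (cov_der \<Gamma> (fst p) (fst \<xi>) (B \<zeta> (fst \<theta>)), \<chi> l. cov_der \<Gamma> (fst p) (fst \<xi>) (B \<zeta> (snd \<theta> $ l)))
      + ddiff p \<xi> \<zeta> \<theta> + diff p \<xi> (diff p \<zeta> \<theta>)" for \<xi> \<zeta>
  proof -
    have fl: "fst (lift p \<xi>) = fst \<xi>" by (simp add: lift_def)
    have h: "has_cov p (lift p \<xi>) (\<lambda>q. fst (split q (W \<zeta> \<theta> q))) (cov_der \<Gamma> (fst p) (fst \<xi>) (B \<zeta> (fst \<theta>)) + ddiff_h p \<xi> \<zeta> \<theta>)"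
      using has_cov_add[OF y covB[of "lift p \<xi>" \<zeta> "fst \<theta>"] has_cov_diff_h[OF p e0 e0]]
      by (intro has_cov_transform[OF _ o p W_h[symmetric]]) (simp_all add: e_p fl)
    have v: "has_cov p (lift p \<xi>) (\<lambda>q. snd (split q (W \<zeta> \<theta> q)) $ l) (cov_der \<Gamma> (fst p) (fst \<xi>) (B \<zeta> (snd \<theta> $ l)) + ddiff_v p \<xi> \<zeta> \<theta> l)" for l
      using has_cov_add[OF y covB[of "lift p \<xi>" \<zeta> "snd \<theta> $ l"] has_cov_diff_v[OF p e0 e0]]
      by (intro has_cov_transform[OF _ o p W_v[symmetric]]) (simp_all add: e_p fl)
    show ?thesis
      using split_cov_der[OF p der[OF sW p] h v] by (simp add: W_p ddiff_def prod_eq_iff vec_eq_iff)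
  qed
  have base: "cov_der \<Gamma> (fst p) (fst \<xi>) (B \<zeta> c) - cov_der \<Gamma> (fst p) (fst \<zeta>) (B \<xi> c) = R (fst p) (fst \<xi>) (fst \<zeta>) c" for c
    using curvature_fields[OF parallel_ext(4)[OF y open_S] parallel_ext(4)[OF y open_S] parallel_ext(4)[OF y open_S] open_S order_refl y, of "fst \<xi>" "fst \<zeta>" c]
    by (simp add: parallel_ext(1,3)[OF y] B_def[abs_def])
  have E_p: "E \<zeta> p = lift p \<zeta>" for \<zeta> by (simp add: E_def e_p)
  have 1: "coord_curv \<Gamma>b p (lift p \<xi>) (lift p \<zeta>) (lift p \<theta>) =
      cov_der \<Gamma>b p (lift p \<xi>) (W \<zeta> \<theta>) - cov_der \<Gamma>b p (lift p \<zeta>) (W \<xi> \<theta>) - cov_der \<Gamma>b p (W \<xi> \<zeta> p - W \<zeta> \<xi> p) (E \<theta>)"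
    using b.curvature_fields[OF sE[of \<xi>] sE[of \<zeta>] sE[of \<theta>] o order_refl p]
    by (simp add: W_def[abs_def] E_p)
  \<comment> \<open>The bracket of the two extended fields. The parts of \<open>E \<theta>\<close>
    are parallel at \<open>p\<close>, so differentiating along it leaves only the difference
    tensor.\<close>
  have 2: "split p (cov_der \<Gamma>b p (W \<xi> \<zeta> p - W \<zeta> \<xi> p) (E \<theta>)) = diff p (diff p \<xi> \<zeta> - diff p \<zeta> \<xi>) \<theta>"
    using split_W[OF p, of "W \<xi> \<zeta> p - W \<zeta> \<xi> p" \<theta>]
    by (simp add: split_diff[OF p] W_p e_p parallel_ext(3)[OF y] prod_eq_iff vec_eq_iff)
  show ?thesis
    unfolding 1 split_diff[OF p] WW 2 base[symmetric] by (simp add: prod_eq_iff vec_eq_iff)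
qed

end

section \<open>Evaluation on horizontal and vertical vectors\<close>

lemma sum_axis:
  fixes f :: "'n::finite \<Rightarrow> 'b::zero \<Rightarrow> 'c::comm_monoid_add"
  assumes "\<And>l. f l 0 = 0"
  shows "(\<Sum>l\<in>UNIV. f l (axis i z $ l)) = f i z"
proof -
  have "f l (axis i z $ l) = (if l = i then f i z else 0)" for l using assms by (simp add: axis_def)
  then show ?thesis by simp
qed

context coord_connection
begin

lemma dR_zero:
  assumes y: "y \<in> S"
  shows "dR y 0 a b c = 0" "dR y w 0 b c = 0" "dR y w a 0 c = 0" "dR y w a b 0 = 0"
proof -
  have z: "der F y w = 0" if "\<And>z. z \<in> S \<Longrightarrow> F z = 0" for F :: "'e \<Rightarrow> 'e"
    using der_cong[OF open_S y, of F "\<lambda>_. 0"] that by simp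
  show "dR y 0 a b c = 0"
    using linear_0[OF has_derivative_linear[OF R_has_derivative[OF y]]]
    by (simp add: coord_curv_deriv_def R_simps[OF y] Gamma_simps[OF y])
  show "dR y w 0 b c = 0" "dR y w a 0 c = 0" "dR y w a b 0 = 0"
    using z[of "\<lambda>z. R z 0 b c"] z[of "\<lambda>z. R z a 0 c"] z[of "\<lambda>z. R z a b 0"] R_simps
    by (simp_all add: coord_curv_deriv_def R_simps[OF y] Gamma_simps[OF y])
qed

lemma R_refl: "R y a a c = 0"
  by (simp add: coord_curv_def)

end

context frame_coord_metric
begin

abbreviation hor :: "'a \<Rightarrow> ('a, 'n) hv" where "hor X \<equiv> (X, 0)"
abbreviation ver :: "'n \<Rightarrow> 'a \<Rightarrow> ('a, 'n) hv" where "ver i X \<equiv> (0, axis i X)"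

context
  fixes p :: "('a, 'n) hv"
  assumes p: "p \<in> \<Omega>"
begin

abbreviation "Rp \<equiv> R (fst p)"
abbreviation "dRp \<equiv> dR (fst p)"
abbreviation "Gp \<equiv> G (fst p)"
abbreviation "u l \<equiv> snd p $ l"

lemmas base_in = fst_in[OF p]

lemma split_scaleR: "split p (k *\<^sub>R A) = k *\<^sub>R split p A"
  by (simp add: split_def prod_eq_iff vec_eq_iff Gamma_simps[OF base_in] algebra_simps)

lemma linear_split: "linear (split p)"
  by (intro linearI split_add p split_scaleR)

lemmas split_simps = linear_add[OF linear_split] linear_diff[OF linear_split] linear_neg[OF linear_split]
  linear_cmul[OF linear_split] linear_sum[OF linear_split]

lemma vdiff_simps:
  "vdiff p l 0 Y = 0" "vdiff p l X 0 = 0" "vdiff p l (- X) Y = - vdiff p l X Y" "vdiff p l X (- Y) = - vdiff p l X Y"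
  "vdiff p l (k *\<^sub>R X) Y = k *\<^sub>R vdiff p l X Y" "vdiff p l X (k *\<^sub>R Y) = k *\<^sub>R vdiff p l X Y"
  by (simp_all add: vdiff_def Let_def G_simps[OF base_in] algebra_simps)

lemma dvdiff_zero: "dvdiff p l 0 X Y = 0" "dvdiff p l K 0 Y = 0" "dvdiff p l K X 0 = 0"
  by (simp_all add: dvdiff_def Let_def G_simps[OF base_in])

lemma diff_hor_hor: "diff p (hor X) (hor Y) = (0, \<chi> l. - (1/2) *\<^sub>R Rp X Y (u l))"
  by (simp add: diff_def diff_h_def diff_v_def R_simps[OF base_in] vdiff_simps)

lemma diff_hor_vert: "diff p (hor X) (0, \<eta>) = hor (\<Sum>l\<in>UNIV. (\<alpha> (r p l) / 2) *\<^sub>R Rp (u l) (\<eta> $ l) X)"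
  "diff p (0, \<eta>) (hor X) = hor (\<Sum>l\<in>UNIV. (\<alpha> (r p l) / 2) *\<^sub>R Rp (u l) (\<eta> $ l) X)"
  by (simp_all add: diff_def diff_h_def diff_v_def R_simps[OF base_in] vdiff_simps zero_vec_def)

lemma diff_hor_ver: "diff p (hor X) (ver i Y) = hor ((\<alpha> (r p i) / 2) *\<^sub>R Rp (u i) Y X)"
  "diff p (ver i Y) (hor X) = hor ((\<alpha> (r p i) / 2) *\<^sub>R Rp (u i) Y X)"
  using sum_axis[of "\<lambda>l Y. (\<alpha> (r p l) / 2) *\<^sub>R Rp (u l) Y X" i Y]
  by (simp_all add: diff_hor_vert R_simps[OF base_in])

lemma diff_vert: "diff p (0, \<eta>) (0, \<theta>) = (0, \<chi> l. vdiff p l (\<eta> $ l) (\<theta> $ l))"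
  by (simp add: diff_def diff_h_def diff_v_def R_simps[OF base_in])

lemma ddiff_hor_hor_hor: "ddiff p (hor K) (hor X) (hor Y) = (0, \<chi> l. - (1/2) *\<^sub>R dRp K X Y (u l))"
  by (simp add: ddiff_def ddiff_h_def ddiff_v_def Let_def R_simps[OF base_in] dR_zero[OF base_in] G_simps[OF base_in] dvdiff_zero)

lemma ddiff_hor_hor_ver: "ddiff p (hor K) (hor X) (ver i Y) = hor ((\<alpha> (r p i) / 2) *\<^sub>R dRp K (u i) Y X)"
  "ddiff p (hor K) (ver i Y) (hor X) = hor ((\<alpha> (r p i) / 2) *\<^sub>R dRp K (u i) Y X)"
  using sum_axis[of "\<lambda>l Y. (\<alpha> (r p l) / 2) *\<^sub>R dRp K (u l) Y X" i Y]
  by (simp_all add: ddiff_def ddiff_h_def ddiff_v_def Let_def R_simps[OF base_in] dR_zero[OF base_in] G_simps[OF base_in] dvdiff_zero zero_vec_def)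

lemma ddiff_hor_ver_ver: "ddiff p (hor K) (ver i X) (ver j Y) = 0"
  by (simp add: ddiff_def ddiff_h_def ddiff_v_def Let_def R_simps[OF base_in] dR_zero[OF base_in] G_simps[OF base_in] dvdiff_zero prod_eq_iff vec_eq_iff)

lemma ddiff_ver_hor_hor: "ddiff p (ver i K) (hor X) (hor Y) = ver i (- (1/2) *\<^sub>R Rp X Y K)"
  by (simp add: ddiff_def ddiff_h_def ddiff_v_def Let_def R_simps[OF base_in] dR_zero[OF base_in] G_simps[OF base_in] dvdiff_zero prod_eq_iff vec_eq_iff axis_def)

lemma ddiff_ver_ver_hor:
  "ddiff p (ver i K) (ver j Y) (hor X) =
    (if i = j then hor ((\<alpha>1 (r p i) * Gp K (u i)) *\<^sub>R Rp (u i) Y X + (\<alpha> (r p i) / 2) *\<^sub>R Rp K Y X) else 0)" (is ?A)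
  "ddiff p (ver i K) (hor X) (ver j Y) =
    (if i = j then hor ((\<alpha>1 (r p i) * Gp K (u i)) *\<^sub>R Rp (u i) Y X + (\<alpha> (r p i) / 2) *\<^sub>R Rp K Y X) else 0)" (is ?B)
proof -
  have "(\<alpha>1 (r p l) * Gp (axis i K $ l) (u l)) *\<^sub>R Rp (u l) (axis j Y $ l) X + (\<alpha> (r p l) / 2) *\<^sub>R Rp (axis i K $ l) (axis j Y $ l) X
      = (if l = i then if i = j then (\<alpha>1 (r p i) * Gp K (u i)) *\<^sub>R Rp (u i) Y X + (\<alpha> (r p i) / 2) *\<^sub>R Rp K Y X else 0 else 0)" for l
    by (simp add: axis_def R_simps[OF base_in] G_simps[OF base_in])
  then show ?A ?B
    by (simp_all add: ddiff_def ddiff_h_def ddiff_v_def Let_def R_simps[OF base_in] dR_zero[OF base_in] dvdiff_zero prod_eq_iff vec_eq_iff)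
qed

lemma ddiff_vert: "ddiff p (0, \<kappa>) (0, \<eta>) (0, \<theta>) = (0, \<chi> l. dvdiff p l (\<kappa> $ l) (\<eta> $ l) (\<theta> $ l))"
  by (simp add: ddiff_def ddiff_h_def ddiff_v_def Let_def R_simps[OF base_in] dR_zero[OF base_in])

lemma R_G_frame: "Gp (Rp a b c) c = 0"
  using R_skew_G[OF base_in, of a b c c] symG[OF base_in, of c "Rp a b c"] by linarith

text \<open>R(X,Y)u is orthogonal to u, which kills one of the \<open>c1\<close> terms and the
  \<open>c3\<close> term. The minus sign comes from moving \<open>R\<close> to the other argument of
  the metric.\<close>

lemma vdiff_R:
  "vdiff p l (Rp X Y (u l)) Z = (\<alpha>1 (r p l) / \<alpha> (r p l) * Gp Z (u l)) *\<^sub>R Rp X Y (u l)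
    - ((\<beta> (r p l) - \<alpha>1 (r p l)) / (\<alpha> (r p l) + r p l * \<beta> (r p l)) * Gp (Rp X Y Z) (u l)) *\<^sub>R u l"
  using R_skew_G[OF base_in, of X Y "u l" Z] symG[OF base_in, of "u l" "Rp X Y Z"]
  by (simp add: vdiff_def Let_def R_G_frame c1_def c2_def)

text \<open>The component of \<open>vdiff\<close> along u is lost because R(u,u) = 0, and the
  \<open>\<alpha>\<close> in front cancels the denominator of \<open>c1\<close>.\<close>

lemma R_vdiff: "(\<alpha> (r p l) / 2) *\<^sub>R Rp (u l) (vdiff p l X Y) Z
    = (\<alpha>1 (r p l) / 2) *\<^sub>R (Gp X (u l) *\<^sub>R Rp (u l) Y Z + Gp Y (u l) *\<^sub>R Rp (u l) X Z)"
  using alpha_pos[OF r_pos[OF p, of l]] by (simp add: vdiff_def Let_def c1_def R_simps[OF base_in] R_refl)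

lemma split_inject: "split p A = split p B \<Longrightarrow> A = B"
  by (metis lift_split)

lemma diff_zero: "diff p 0 \<xi> = 0" "diff p \<xi> 0 = 0"
  by (simp_all add: diff_def diff_h_def diff_v_def R_simps[OF base_in] vdiff_simps prod_eq_iff vec_eq_iff)

lemma diff_ver_ver: "diff p (ver i X) (ver j Y) = (if i = j then ver i (vdiff p i X Y) else 0)"
  by (auto simp: diff_vert prod_eq_iff vec_eq_iff axis_def vdiff_simps)

lemmas Rb_simps = split_curvature[OF p] diff_hor_hor diff_hor_ver diff_ver_ver diff_zero ddiff_hor_hor_hor
  ddiff_hor_hor_ver ddiff_hor_ver_ver ddiff_ver_hor_hor ddiff_ver_ver_hor ddiff_vert
  split_simps prod_eq_iff vec_eq_iff R_simps[OF base_in] fst_sum snd_sum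

lemma half_half: "- ((1/2) *\<^sub>R c) - (1/2) *\<^sub>R c = - c" "(1/2) *\<^sub>R c + (1/2) *\<^sub>R c = (c :: 'a)"
  "(k / 2) *\<^sub>R c + (k / 2) *\<^sub>R c = k *\<^sub>R c" "(k / 2) *\<^sub>R c + ((k / 2) *\<^sub>R c + w) = k *\<^sub>R c + w"
  by (simp_all flip: scaleR_add_left add: algebra_simps)

abbreviation "Rb X Y Z \<equiv> coord_curv \<Gamma>b p X Y Z"
abbreviation "h X \<equiv> lift p (hor X)"
abbreviation "v i X \<equiv> lift p (ver i X)"
abbreviation "a l \<equiv> \<alpha> (r p l)"
abbreviation "a1 l \<equiv> \<alpha>1 (r p l)"
abbreviation "b l \<equiv> \<beta> (r p l)"

lemma axis_nth_if: "axis i x $ l = (if l = i then x else 0)"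
  by (simp add: axis_def)

lemma sum_axis_nth: "(\<Sum>l\<in>UNIV. axis l (f l) $ m) = (f m :: 'a)"
  "(\<Sum>l\<in>UNIV. k *\<^sub>R axis l (f l) $ m) = k *\<^sub>R (f m :: 'a)"
  by (simp_all add: axis_def if_distrib cong: if_cong)

text \<open>The two composition terms meet a curvature half and an \<open>\<alpha>\<close> half,
  hence 1/4. The bracket term meets the full R(X,Y)u, whence the extra factor 2 in the last
  summand.\<close>

lemma curv_hhh:
  "Rb (h X) (h Y) (h Z) = h (Rp X Y Z) + (1/2) *\<^sub>R (\<Sum>l\<in>UNIV. v l (dRp Z X Y (u l)))
    - (1/4) *\<^sub>R (\<Sum>l\<in>UNIV. a l *\<^sub>R h (Rp (u l) (Rp Y Z (u l)) X - Rp (u l) (Rp X Z (u l)) Y - 2 *\<^sub>R Rp (u l) (Rp X Y (u l)) Z))"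
    (is "?lhs = ?rhs")
proof (rule split_inject)
  have B: "dRp X Y Z c - dRp Y X Z c = - dRp Z X Y c" for c
    using Bianchi2[OF base_in, of X Y Z c] dR_skew[OF base_in, of Y Z X c] by (simp add: eq_neg_iff_add_eq_0 algebra_simps)
  have half: "(1/2) *\<^sub>R dRp Y X Z c - (1/2) *\<^sub>R dRp X Y Z c = (1/2) *\<^sub>R dRp Z X Y c" for c
    using B[of c] by (metis minus_diff_eq minus_minus scaleR_right_diff_distrib)
  show "split p ?lhs = split p ?rhs"
    by (simp add: Rb_simps diff_hor_vert sum_axis_nth R_skew[of _ Y X] half half_half scaleR_sum_right
        algebra_simps flip: sum_subtractf sum_negf sum.distrib)
qed

text \<open>The last two terms come from the bracket, whose vertical part -R(X,Y)u is inserted into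
  \<open>vdiff\<close>; \<open>vdiff_R\<close> evaluates it. The other terms see the fibre metric
  only through the factor of \<open>diff_h\<close>.\<close>

lemma curv_hhv:
  "Rb (h X) (h Y) (v i Z) = v i (Rp X Y Z) + (a i / 2) *\<^sub>R h (dRp X (u i) Z Y - dRp Y (u i) Z X)
    - (a i / 4) *\<^sub>R (\<Sum>l\<in>UNIV. v l (Rp X (Rp (u i) Z Y) (u l) - Rp Y (Rp (u i) Z X) (u l)))
    + (a1 i / a i * Gp Z (u i)) *\<^sub>R v i (Rp X Y (u i))
    - ((b i - a1 i) / (a i + r p i * b i) * Gp (Rp X Y Z) (u i)) *\<^sub>R v i (u i)"
  by (rule split_inject) (simp add: Rb_simps diff_vert sum_axis_nth axis_nth_if R_skew[of _ Y X] half_half vdiff_simps vdiff_R G_simps[OF base_in] algebra_simps)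

text \<open>The difference tensor is symmetric on a mixed pair, so there is no bracket term. The
  last correction terms now come from \<open>vdiff\<close> applied to -1/2 R(X,Z)u and are therefore
  half those of \<open>curv_hhv\<close>.\<close>

lemma curv_hvh:
  "Rb (h X) (v i Y) (h Z) = (a i / 2) *\<^sub>R h (dRp X (u i) Y Z) - (1/2) *\<^sub>R v i (Rp Z X Y)
    + (a1 i / (2 * a i) * Gp Y (u i)) *\<^sub>R v i (Rp X Z (u i))
    - (a i / 4) *\<^sub>R (\<Sum>l\<in>UNIV. v l (Rp X (Rp (u i) Y Z) (u l)))
    - ((b i - a1 i) / (2 * (a i + r p i * b i)) * Gp (Rp X Z Y) (u i)) *\<^sub>R v i (u i)"
  by (rule split_inject) (simp add: Rb_simps diff_vert sum_axis_nth axis_nth_if R_skew[of _ Z X] vdiff_sym[OF p, of i Y] vdiff_simps vdiff_R diff_divide_distrib algebra_simps)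

lemma curv_hvv_ne:
  "i \<noteq> j \<Longrightarrow> Rb (h X) (v i Y) (v j Z) = - (a i * a j / 4) *\<^sub>R h (Rp (u i) Y (Rp (u j) Z X))"
  by (rule split_inject) (simp add: Rb_simps vdiff_simps)

text \<open>Differentiating \<open>\<alpha>\<close> in the direction of \<open>Y\<close> contributes
  a full multiple of \<open>a1 i\<close>; \<open>R_vdiff\<close> gives half of it back and supplies
  the term with \<open>Y\<close> and \<open>Z\<close> exchanged.\<close>

lemma curv_hvv:
  "Rb (h X) (v i Y) (v i Z) = (a1 i / 2) *\<^sub>R h (Gp Z (u i) *\<^sub>R Rp (u i) Y X - Gp Y (u i) *\<^sub>R Rp (u i) Z X)
    - ((a i)\<^sup>2 / 4) *\<^sub>R h (Rp (u i) Y (Rp (u i) Z X)) - (a i / 2) *\<^sub>R h (Rp Y Z X)"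
  by (rule split_inject) (simp add: Rb_simps vdiff_simps R_vdiff half_half power2_eq_square algebra_simps)

text \<open>The two vertical derivatives of the difference tensor each contain half of
  \<open>a i\<close> times a curvature term, with \<open>X\<close> and \<open>Y\<close> exchanged;
  skewness adds the halves up.\<close>

lemma curv_vvh:
  "Rb (v i X) (v i Y) (h Z) = a i *\<^sub>R h (Rp X Y Z)
    + ((a i)\<^sup>2 / 4) *\<^sub>R h (Rp (u i) X (Rp (u i) Y Z) - Rp (u i) Y (Rp (u i) X Z))
    + a1 i *\<^sub>R (Gp X (u i) *\<^sub>R h (Rp (u i) Y Z) - Gp Y (u i) *\<^sub>R h (Rp (u i) X Z))"
  by (rule split_inject) (simp add: Rb_simps vdiff_simps vdiff_sym[OF p, of i Y X] R_skew[of _ Y X] half_half power2_eq_square algebra_simps)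

lemma curv_vvh_ne:
  "i \<noteq> j \<Longrightarrow> Rb (v i X) (v j Y) (h Z) = (a i * a j / 4) *\<^sub>R h (Rp (u i) X (Rp (u j) Y Z) - Rp (u j) Y (Rp (u i) X Z))"
  by (rule split_inject) (simp add: Rb_simps vdiff_simps algebra_simps)

text \<open>\<open>vdiff\<close> and \<open>dvdiff\<close> act in each slot of the frame separately,
  the fibre metric being a sum over the slots. In every slot at least one of the three vectors is
  0.\<close>

lemma curv_vvv_ne:
  assumes "\<not> (i = j \<and> j = k)"
  shows "Rb (v i X) (v j Y) (v k Z) = 0"
proof (rule split_inject)
  have z: "dvdiff p l (axis i X $ l) (axis j Y $ l) (axis k Z $ l) = 0" "dvdiff p l (axis j Y $ l) (axis i X $ l) (axis k Z $ l) = 0"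
    "vdiff p l (axis i X $ l) (vdiff p l (axis j Y $ l) (axis k Z $ l)) = 0"
    "vdiff p l (axis j Y $ l) (vdiff p l (axis i X $ l) (axis k Z $ l)) = 0"
    "vdiff p l (vdiff p l (axis i X $ l) (axis j Y $ l) - vdiff p l (axis j Y $ l) (axis i X $ l)) (axis k Z $ l) = 0" for l
    using assms vdiff_sym[OF p, of l "axis i X $ l" "axis j Y $ l"]
    by (auto simp: axis_nth_if dvdiff_zero vdiff_simps)
  show "split p (Rb (v i X) (v j Y) (v k Z)) = split p 0"
    by (simp add: Rb_simps diff_vert z linear_0[OF linear_split])
qed

section \<open>The curvature of the fibre metric\<close>

definition cA :: "'n \<Rightarrow> real" where
  "cA l = (let t = r p l in (3 * (a1 l)\<^sup>2 - 2 * a l * \<alpha>2 t) / (a l)\<^sup>2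
     + (a l * \<beta>1 t - 2 * a1 l * b l) * (a l + t * a1 l) / ((a l)\<^sup>2 * (a l + t * b l)))"

definition cB :: "'n \<Rightarrow> real" where
  "cB l = (a l * b l - 2 * a l * a1 l - (a1 l)\<^sup>2 * r p l) / (a l * (a l + r p l * b l))"

definition cC :: "'n \<Rightarrow> real" where
  "cC l = (let t = r p l in - (2 * \<alpha>2 t) / (a l + t * b l)
     + (3 * a l * (a1 l)\<^sup>2 + 2 * (a1 l)\<^sup>2 * b l * t + (a l)\<^sup>2 * \<beta>1 t
        - a l * (b l)\<^sup>2 + a l * a1 l * \<beta>1 t * t) / (a l * (a l + t * b l)\<^sup>2))"

text \<open>The left-hand sides are the combinations that come out of
  \<open>vdiff_curvature\<close>; this lemma brings them into the form used in the theorem.\<close>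

lemma coefficients:
  "- 2 * deriv c1 (r p l) + c3 (r p l) + (c1 (r p l))\<^sup>2 + r p l * c1 (r p l) * c3 (r p l) = cA l" (is ?A)
  "c2 (r p l) - c1 (r p l) + r p l * c1 (r p l) * c2 (r p l) = cB l" (is ?B)
  "2 * deriv c2 (r p l) - c3 (r p l) + (c2 (r p l))\<^sup>2 + r p l * c2 (r p l) * c3 (r p l) = cC l" (is ?C)
proof -
  define t where "t = r p l"
  have t: "0 < t" by (simp add: t_def r_pos[OF p])
  have 1: "\<alpha> t \<noteq> 0" using alpha_pos[OF t] by simp
  \<comment> \<open>Kept as an atom while denominators are cleared, and expanded afterwards only
    where the remaining polynomial identity needs it.\<close>
  define D where "D = \<alpha> t + t * \<beta> t"
  have D: "D \<noteq> 0" using alpha_beta_pos[OF t] by (simp add: D_def)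
  have b: "t * \<beta> t = D - \<alpha> t" by (simp add: D_def)
  show ?A
    unfolding cA_def Let_def t_def[symmetric] deriv_c[OF t] c3_def c1_def D_def[symmetric]
    using 1 D by (simp add: field_simps power2_eq_square)
  show ?B
    unfolding cB_def Let_def t_def[symmetric] c2_def c1_def D_def[symmetric]
    using 1 D by (simp add: field_simps power2_eq_square) (simp add: D_def algebra_simps)
  show ?C
    unfolding cC_def Let_def t_def[symmetric] deriv_c[OF t] c2_def c3_def D_def[symmetric]
    using 1 D by (simp add: field_simps power2_eq_square) (simp add: D_def algebra_simps)
qed

text \<open>A fibre lies in a vector space, so this is the curvature of the flat connection modified
  by \<open>vdiff\<close>. Terms symmetric in \<open>X\<close> and \<open>Y\<close> cancel, among
  them all those with the derivative of \<open>c3\<close>.\<close>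

lemma vdiff_curvature:
  "dvdiff p l X Y Z - dvdiff p l Y X Z + vdiff p l X (vdiff p l Y Z) - vdiff p l Y (vdiff p l X Z)
    = (cC l * (Gp X (u l) * Gp Y Z - Gp Y (u l) * Gp X Z)) *\<^sub>R u l
    + (cA l * Gp Y (u l) * Gp Z (u l) + cB l * Gp Y Z) *\<^sub>R X - (cA l * Gp X (u l) * Gp Z (u l) + cB l * Gp X Z) *\<^sub>R Y"
proof -
  have two: "(2 * k) *\<^sub>R c = k *\<^sub>R c + k *\<^sub>R c" for k and c :: 'a
    by (simp flip: scaleR_add_left)
  show ?thesis
  unfolding coefficients[symmetric] dvdiff_def vdiff_def Let_def
  by (simp add: G_simps[OF base_in] symG[OF base_in, of Y X] symG[OF base_in, of Z X] symG[OF base_in, of Z Y]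
    symG[OF base_in, of "u l" X] symG[OF base_in, of "u l" Y] symG[OF base_in, of "u l" Z] two algebra_simps power2_eq_square)
qed

lemma curv_vvv:
  "Rb (v i X) (v i Y) (v i Z) = (cC i * (Gp X (u i) * Gp Y Z - Gp Y (u i) * Gp X Z)) *\<^sub>R v i (u i)
    + (cA i * Gp Y (u i) * Gp Z (u i) + cB i * Gp Y Z) *\<^sub>R v i X - (cA i * Gp X (u i) * Gp Z (u i) + cB i * Gp X Z) *\<^sub>R v i Y"
    (is "?lhs = ?rhs")
proof (rule split_inject)
  show "split p ?lhs = split p ?rhs"
    using vdiff_curvature[of i X Y Z] vdiff_sym[OF p, of i Y X]
    by (simp add: Rb_simps diff_vert axis_nth_if vdiff_simps dvdiff_zero)
qed

end

end

section \<open>The frame bundle as a manifold\<close>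

text \<open>Spanning is enough, as n vectors that span an n-dimensional space are distinct and
  independent. The determinant then shows that frames form an open set, so the bundle charts have
  open images.\<close>

lemma is_frame_iff_det:
  fixes u :: "'n::finite frame"
  shows "is_frame u \<longleftrightarrow> det u \<noteq> 0"
proof -
  have "rows u = range (($) u)" by (auto simp: rows_def row_def vec_nth_inverse)
  then have det: "det u \<noteq> 0 \<longleftrightarrow> span (range (($) u)) = UNIV"
    by (metis invertible_det_nz invertible_left_inverse matrix_left_invertible_span_rows)
  moreover have "inj (($) u) \<and> independent (range (($) u))" if *: "span (range (($) u)) = UNIV"
  proof
    have "card (range (($) u)) \<le> CARD('n)" by (rule card_image_le) simp
    moreover have "CARD('n) \<le> card (range (($) u))"
      using span_card_ge_dim[of "range (($) u)" UNIV] * by simp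
    ultimately have c: "card (range (($) u)) = CARD('n)" by simp
    then show "inj (($) u)" by (simp add: eq_card_imp_inj_on)
    show "independent (range (($) u))"
      using card_le_dim_spanning[of "range (($) u)" UNIV] * c by simp
  qed
  ultimately show ?thesis unfolding is_frame_def by blast
qed

lemma open_is_frame: "open (Collect is_frame :: 'n::finite frame set)"
proof -
  have "continuous_on UNIV (det :: 'n frame \<Rightarrow> real)"
    unfolding det_def by (intro continuous_intros)
  then have "open (UNIV \<inter> det -` (- {0}) :: 'n frame set)"
    by (rule continuous_open_preimage) auto
  moreover have "UNIV \<inter> det -` (- {0}) = (Collect is_frame :: 'n frame set)"
    by (auto simp: is_frame_iff_det)
  ultimately show ?thesis by simp
qed

lemma is_frame_nonzero: "is_frame u \<Longrightarrow> u $ l \<noteq> 0"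
  unfolding is_frame_def by (metis dependent_zero rangeI)

lemma is_frame_linear_image:
  fixes u :: "'n::finite frame"
  assumes u: "is_frame u" and f: "linear f" and inv: "\<And>v. f' (f v) = v" "\<And>v. f (f' v) = v"
  shows "is_frame (\<chi> k. f (u $ k))"
proof -
  have inj: "inj f" using inv(1) by (rule inj_on_inverseI)
  have surj: "f ` UNIV = UNIV" using inv(2) by (metis surjI)
  have im: "range (($) (\<chi> k. f (u $ k))) = f ` range (($) u)" by auto
  have "span (f ` range (($) u)) = f ` span (range (($) u))" by (rule span_linear_image[OF f])
  then have "span (range (($) (\<chi> k. f (u $ k)))) = UNIV"
    unfolding im using u surj by (simp add: is_frame_def)
  moreover have "independent (f ` range (($) u))"
    using u by (intro linear_independent_injective_image f) (auto simp: is_frame_def intro: inj_on_subset[OF inj])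
  moreover have "inj (($) (\<chi> k. f (u $ k)))"
    using u inj by (auto simp: is_frame_def inj_def)
  ultimately show ?thesis unfolding is_frame_def im by simp
qed

section \<open>Bundle charts and vertical lifts\<close>

locale frame_manifold = smooth_atlas M for M :: "('m, real^'n) manifold"
begin

abbreviation "fb \<equiv> frame_bundle M"
abbreviation "fc \<equiv> frame_chart M"

lemma fc_simps [simp]:
  "cdom (fc c) = {(x, u). x \<in> cdom c \<and> is_frame u}"
  "cmap (fc c) (x, u) = (cmap c x, \<chi> i. comps M c x (u $ i))"
  by (simp_all add: frame_chart_def)

lemma fb_simps [simp]:
  "(x, u) \<in> points fb \<longleftrightarrow> x \<in> points M \<and> is_frame u"
  "atlas fb = fc ` atlas M" "chart_at fb (x, u) = fc (chart_at M x)"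
  by (simp_all add: frame_bundle_def)

lemma is_frame_comps: "c \<in> atlas M \<Longrightarrow> x \<in> cdom c \<Longrightarrow> is_frame u \<Longrightarrow> is_frame (\<chi> i. comps M c x (u $ i))"
  by (rule is_frame_linear_image[OF _ linear_comps uncomps_comps comps_uncomps])

lemma is_frame_uncomps: "c \<in> atlas M \<Longrightarrow> x \<in> cdom c \<Longrightarrow> is_frame u \<Longrightarrow> is_frame (\<chi> i. uncomps c x (u $ i))"
  by (rule is_frame_linear_image[OF _ linear_uncomps comps_uncomps uncomps_comps])

lemma inj_fc: "c \<in> atlas M \<Longrightarrow> inj_on (cmap (fc c)) (cdom (fc c))"
proof (rule inj_onI)
  fix p q assume c: "c \<in> atlas M" and pq: "p \<in> cdom (fc c)" "q \<in> cdom (fc c)" "cmap (fc c) p = cmap (fc c) q"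
  obtain x u x' u' where e: "p = (x, u)" "q = (x', u')" by (cases p, cases q)
  have "x = x'" using pq inj_cmap[OF c] by (auto simp: e dest: inj_onD)
  moreover have "u $ i = u' $ i" for i
    using pq c \<open>x = x'\<close> comps_inject[OF c, of x "u $ i" "u' $ i"] by (auto simp: e fun_eq_iff dest: vec_lambda_inject[THEN iffD1, rotated 2])
  ultimately show "p = q" by (simp add: e vec_eq_iff)
qed

lemma cinv_fc [simp]:
  assumes "c \<in> atlas M" "x \<in> cdom c" "is_frame w"
  shows "cinv (fc c) (cmap c x, w) = (x, \<chi> i. uncomps c x (w $ i))"
proof -
  have "cinv (fc c) (cmap (fc c) (x, \<chi> i. uncomps c x (w $ i))) = (x, \<chi> i. uncomps c x (w $ i))"
    unfolding cinv_def using assms inj_fc is_frame_uncomps by (intro inv_into_f_f) auto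
  then show ?thesis using assms by simp
qed

lemma fc_image: "c \<in> atlas M \<Longrightarrow> A \<subseteq> cdom c \<Longrightarrow> cmap (fc c) ` {(x, u). x \<in> A \<and> is_frame u} = cmap c ` A \<times> Collect is_frame"
proof (intro subset_antisym subsetI)
  fix z :: "'n frame_tangent" assume c: "c \<in> atlas M" "A \<subseteq> cdom c" and "z \<in> cmap c ` A \<times> Collect is_frame"
  then obtain x w where z: "z = (cmap c x, w)" "x \<in> A" "is_frame w" by auto
  then have "z = cmap (fc c) (x, \<chi> i. uncomps c x (w $ i))" "is_frame (\<chi> i. uncomps c x (w $ i))"
    using c is_frame_uncomps by auto
  then show "z \<in> cmap (fc c) ` {(x, u). x \<in> A \<and> is_frame u}" using z by blast
qed (auto intro!: is_frame_comps)

lemma fc_overlap: "c \<in> atlas M \<Longrightarrow> cmap (fc c) ` (cdom (fc c) \<inter> cdom (fc c')) = cmap c ` (cdom c \<inter> cdom c') \<times> Collect is_frame"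
proof -
  assume c: "c \<in> atlas M"
  have "cdom (fc c) \<inter> cdom (fc c') = {(x, u). x \<in> cdom c \<inter> cdom c' \<and> is_frame u}" by auto
  then show ?thesis using fc_image[OF c, of "cdom c \<inter> cdom c'"] by simp
qed

lemma fc_trans:
  assumes c: "c \<in> atlas M" "c' \<in> atlas M" and z: "z \<in> cmap c ` (cdom c \<inter> cdom c') \<times> Collect is_frame"
  shows "cmap (fc c') (cinv (fc c) z) = (tr c c' (fst z), \<chi> i. der (tr c c') (fst z) (snd z $ i))"
proof -
  obtain x w where "z = (cmap c x, w)" "x \<in> cdom c" "x \<in> cdom c'" "is_frame w" using z by auto
  then show ?thesis using c by (simp add: comps_change[of c c'])
qed

lemma fc_trans_smooth:
  assumes c: "c \<in> atlas M" "c' \<in> atlas M"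
  shows "smooth_on (cmap c ` (cdom c \<inter> cdom c') \<times> Collect is_frame) (\<lambda>z. cmap (fc c') (cinv (fc c) z))"
proof -
  let ?T = "cmap c ` (cdom c \<inter> cdom c')" and ?F = "Collect is_frame :: 'n frame set"
  note oT = open_overlap[OF c]
  have o: "open (?T \<times> ?F)" by (intro open_Times oT open_is_frame)
  note fst = smooth_on_fst[OF o] and snd = smooth_on_snd_nth[OF o]
  have 1: "smooth_on (?T \<times> ?F) (\<lambda>z. tr c c' (fst z))"
    by (rule smooth_on_compose[where f = fst, OF smooth_trans[OF c] fst o oT]) auto
  have 2: "smooth_on (?T \<times> ?F) (\<lambda>z. der (tr c c') (fst z) v)" for v
    by (rule smooth_on_compose[where f = fst, OF smooth_on_der[OF smooth_trans[OF c] oT] fst o oT]) auto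
  have 3: "smooth_on (?T \<times> ?F) (\<lambda>z. der (tr c c') (fst z) (snd z $ i))" for i
    by (rule smooth_on_linear_app[OF 2 smooth_on_linear_der[OF smooth_trans[OF c] oT] snd o]) auto
  have "smooth_on (?T \<times> ?F) (\<lambda>z. (tr c c' (fst z), \<chi> i. der (tr c c') (fst z) (snd z $ i)))"
    by (intro smooth_on_Pair smooth_on_vec_lambda 1 3 o)
  then show ?thesis
    by (rule smooth_on_cong[THEN iffD1, rotated]) (simp add: fc_trans[OF c])
qed

sublocale fb: smooth_atlas fb
proof
  fix k assume "k \<in> atlas fb"
  then obtain c where c: "c \<in> atlas M" "k = fc c" by auto
  show "cdom k \<subseteq> points fb" using c(2) cdom_subset[OF c(1)] by auto
  show "inj_on (cmap k) (cdom k)" using c inj_fc by simp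
  fix k' assume "k' \<in> atlas fb"
  then obtain c' where c': "c' \<in> atlas M" "k' = fc c'" by auto
  show "open (cmap k ` (cdom k \<inter> cdom k'))"
    unfolding c(2) c'(2) fc_overlap[OF c(1)] by (intro open_Times open_overlap c c' open_is_frame)
  show "smooth_on (cmap k ` (cdom k \<inter> cdom k')) (\<lambda>y. cmap k' (cinv k y))"
    unfolding c(2) c'(2) fc_overlap[OF c(1)] by (rule fc_trans_smooth[OF c(1) c'(1)])
next
  fix p assume "p \<in> points fb"
  then obtain x u where "p = (x, u)" "x \<in> points M" "is_frame u" by (cases p) auto
  then show "chart_at fb p \<in> atlas fb" "p \<in> cdom (chart_at fb p)" by (auto intro: chart_at_atlas chart_at_dom)
qed

lemma vlift_eq:
  assumes "x \<in> points M"
  shows "vlift M (x, u) i X = (0, axis i X)"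
proof -
  have "cmap (chart_at fb (x, \<chi> k. if k = i then u $ k + 0 *\<^sub>R X else u $ k)) \<circ> (\<lambda>t. (x, \<chi> k. if k = i then u $ k + t *\<^sub>R X else u $ k))
      = (\<lambda>t. (cmap (chart_at M x) x, u) + t *\<^sub>R (0, axis i X))"
    using assms by (auto simp: fun_eq_iff vec_eq_iff comps_chart_at axis_def)
  moreover have "((\<lambda>t. (cmap (chart_at M x) x, u) + t *\<^sub>R (0, axis i X)) has_vector_derivative (0, axis i X)) (at 0)"
    by (auto intro!: derivative_eq_intros)
  ultimately show ?thesis
    unfolding vlift_def velocity_def by (simp add: vector_derivative_at)
qed

text \<open>Transition maps of bundle charts are linear in the frame vectors, so the defining line
  in a fibre stays a line in every bundle chart.\<close>

lemma comps_vlift: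
  assumes c: "c \<in> atlas M" "x \<in> cdom c" and u: "is_frame u"
  shows "comps fb (fc c) (x, u) (vlift M (x, u) i X) = (0, axis i (comps M c x X))"
proof -
  let ?a = "chart_at M x"
  note a = in_chart[OF c]
  let ?T = "cmap ?a ` (cdom ?a \<inter> cdom c)" and ?F = "Collect is_frame :: 'n frame set"
  have z: "cmap (fc ?a) (x, u) = (cmap ?a x, u)" using a by (simp add: comps_chart_at vec_eq_iff)
  have zT: "(cmap ?a x, u) \<in> ?T \<times> ?F" using a c u by auto
  have oT: "open ?T" by (rule open_overlap[OF a(2) c(1)])
  have o: "open (?T \<times> ?F)" by (intro open_Times oT open_is_frame)
  have d: "(fb.tr (fc ?a) (fc c) has_derivative der (fb.tr (fc ?a) (fc c)) (cmap ?a x, u)) (at (cmap ?a x, u))"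
    by (rule smooth_on_has_derivative[OF fc_trans_smooth[OF a(2) c(1)] o zT])
  define L where "L t = (cmap ?a x, u) + t *\<^sub>R (0, axis i X)" for t :: real
  have dL: "(L has_derivative (\<lambda>t. t *\<^sub>R (0, axis i X))) (at 0)"
    unfolding L_def[abs_def] by (auto intro!: derivative_eq_intros)
  have "((\<lambda>t. fb.tr (fc ?a) (fc c) (L t)) has_derivative (\<lambda>t. der (fb.tr (fc ?a) (fc c)) (cmap ?a x, u) (t *\<^sub>R (0, axis i X)))) (at 0)"
    by (rule has_derivative_compose[where f = L, OF dL]) (use d in \<open>simp add: L_def\<close>)
  moreover have "((\<lambda>t. fb.tr (fc ?a) (fc c) (L t)) has_derivative (\<lambda>t. t *\<^sub>R (0, axis i (comps M c x X)))) (at 0)"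
  proof -
    have cont: "continuous_on UNIV L" unfolding L_def[abs_def] by (intro continuous_intros)
    have oL: "open (L -` (?T \<times> ?F))" using continuous_open_preimage[OF cont open_UNIV o] by simp
    have "((\<lambda>t. (cmap c x, \<chi> k. comps M c x (u $ k)) + t *\<^sub>R (0, axis i (comps M c x X))) has_derivative (\<lambda>t. t *\<^sub>R (0, axis i (comps M c x X)))) (at 0)"
      by (auto intro!: derivative_eq_intros)
    then show ?thesis
    proof (rule has_derivative_transform_within_open[OF _ oL])
      show "0 \<in> L -` (?T \<times> ?F)" using zT by (simp add: L_def)
      fix t assume "t \<in> L -` (?T \<times> ?F)"
      then have "L t \<in> ?T \<times> ?F" by simp
      from fc_trans[OF a(2) c(1) this]
      show "(cmap c x, \<chi> k. comps M c x (u $ k)) + t *\<^sub>R (0, axis i (comps M c x X)) = fb.tr (fc ?a) (fc c) (L t)"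
        using a c linear_comps[OF c]
        by (simp add: L_def vec_eq_iff axis_def linear_add linear_cmul linear_0 flip: comps_eq)
    qed
  qed
  ultimately have "der (fb.tr (fc ?a) (fc c)) (cmap ?a x, u) (0, axis i X) = (0, axis i (comps M c x X))"
    using has_derivative_unique by (metis (no_types, lifting) scaleR_one)
  then show ?thesis
    by (simp add: fb.comps_eq vlift_eq[OF a(1)] z flip: z)
qed

end

section \<open>Horizontal lifts in bundle charts\<close>

locale frame_levi_civita = frame_manifold M + levi_civita_atlas M D g
  for M :: "('m, real^'n) manifold" and D g
begin

text \<open>Read in matching charts of base and bundle, a section is a graph (\<open>F\<close> in
  the proof), and its derivative is immediate. The tangent map is defined in the preferred charts,
  whose graph differs from that in \<open>c\<close> by the transition maps.\<close>

lemma comps_tangent_map: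
  assumes c: "c \<in> atlas M" "x \<in> cdom c" and W: "mopen M W" "x \<in> W"
    and s: "\<And>q. q \<in> W \<Longrightarrow> is_frame (s q)" "\<And>i. smooth_vf M W (\<lambda>q. s q $ i)" "s x = u"
  shows "comps fb (fc c) (x, u) (tangent_map M fb (\<lambda>q. (q, s q)) x X) =
    (comps M c x X, \<chi> i. der (local_rep M c (\<lambda>q. s q $ i)) (cmap c x) (comps M c x X))"
proof -
  let ?a = "chart_at M x"
  note a = in_chart[OF c]
  define F where "F c z = (z, \<chi> i. local_rep M c (\<lambda>q. s q $ i) z)" for c z
  have u: "is_frame u" using s W by auto
  have dF: "(F c has_derivative (\<lambda>v. (v, \<chi> i. der (local_rep M c (\<lambda>q. s q $ i)) (cmap c x) v))) (at (cmap c x))"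
    if c: "c \<in> atlas M" "x \<in> cdom c" for c
  proof -
    have "(local_rep M c (\<lambda>q. s q $ i) has_derivative der (local_rep M c (\<lambda>q. s q $ i)) (cmap c x)) (at (cmap c x))" for i
      by (rule smooth_on_has_derivative[OF smooth_vf_local_rep[OF s(2) c(1)] mopen_image[OF W(1) c(1)]]) (use c W in auto)
    then have "((\<lambda>z. \<Sum>i\<in>UNIV. axis i (local_rep M c (\<lambda>q. s q $ i) z)) has_derivative
        (\<lambda>v. \<Sum>i\<in>UNIV. axis i (der (local_rep M c (\<lambda>q. s q $ i)) (cmap c x) v))) (at (cmap c x))"
      by (intro has_derivative_sum bounded_linear.has_derivative[OF bounded_linear_axis])
    then show ?thesis
      unfolding F_def vec_lambda_sum_axis by (intro has_derivative_Pair has_derivative_ident)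
  qed
  have F: "F c (cmap c q) = cmap (fc c) (q, s q)" if "c \<in> atlas M" "q \<in> cdom c" for c q
    using that by (simp add: F_def)
  have "tangent_map M fb (\<lambda>q. (q, s q)) x X = der (\<lambda>y. cmap (fc ?a) (cinv ?a y, s (cinv ?a y))) (cmap ?a x) X"
    by (simp add: tangent_map_def o_def)
  also have "der (\<lambda>y. cmap (fc ?a) (cinv ?a y, s (cinv ?a y))) (cmap ?a x) = der (F ?a) (cmap ?a x)"
    by (rule der_cong[OF open_image[OF a(2)]]) (use a F in auto)
  finally have t: "tangent_map M fb (\<lambda>q. (q, s q)) x X = der (F ?a) (cmap ?a x) X" .
  have "((\<lambda>y. fb.tr (fc ?a) (fc c) (F ?a y)) has_derivative
      (\<lambda>v. der (fb.tr (fc ?a) (fc c)) (cmap (fc ?a) (x, u)) (der (F ?a) (cmap ?a x) v))) (at (cmap ?a x))"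
  proof (rule has_derivative_compose[where f = "F ?a" and g = "fb.tr (fc ?a) (fc c)"
        and f' = "der (F ?a) (cmap ?a x)" and g' = "der (fb.tr (fc ?a) (fc c)) (cmap (fc ?a) (x, u))"])
    show "(F ?a has_derivative der (F ?a) (cmap ?a x)) (at (cmap ?a x))"
      using dF[OF a(2,3)] der_eqI[OF dF[OF a(2,3)]] by simp
    show "(fb.tr (fc ?a) (fc c) has_derivative der (fb.tr (fc ?a) (fc c)) (cmap (fc ?a) (x, u))) (at (F ?a (cmap ?a x)))"
      unfolding F[OF a(2,3)] s(3) by (rule fb.tr_has_derivative) (use a c u in auto)
  qed
  moreover have "((\<lambda>y. fb.tr (fc ?a) (fc c) (F ?a y)) has_derivative
      (\<lambda>v. der (F c) (cmap c x) (der (tr ?a c) (cmap ?a x) v))) (at (cmap ?a x))"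
  proof (rule has_derivative_transform_within_open)
    show "((\<lambda>y. F c (tr ?a c y)) has_derivative (\<lambda>v. der (F c) (cmap c x) (der (tr ?a c) (cmap ?a x) v))) (at (cmap ?a x))"
      by (rule has_derivative_compose[where f = "tr ?a c" and g = "F c"
            and f' = "der (tr ?a c) (cmap ?a x)" and g' = "der (F c) (cmap c x)", OF tr_has_derivative])
        (use a c dF[OF c] der_eqI[OF dF[OF c]] in simp_all)
    show "open (cmap ?a ` (W \<inter> cdom c \<inter> cdom ?a))"
      by (intro mopen_image mopen_Int mopen_cdom W a c)
    show "cmap ?a x \<in> cmap ?a ` (W \<inter> cdom c \<inter> cdom ?a)" using a c W by auto
    fix y assume "y \<in> cmap ?a ` (W \<inter> cdom c \<inter> cdom ?a)"
    then obtain q where q: "y = cmap ?a q" "q \<in> W" "q \<in> cdom c" "q \<in> cdom ?a" by auto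
    have "cinv (fc ?a) (cmap (fc ?a) (q, s q)) = (q, s q)"
      by (rule fb.cinv_cmap) (use q a s in auto)
    then show "F c (tr ?a c y) = fb.tr (fc ?a) (fc c) (F ?a y)"
      using q a c by (simp add: F del: fc_simps)
  qed
  ultimately have "der (fb.tr (fc ?a) (fc c)) (cmap (fc ?a) (x, u)) (der (F ?a) (cmap ?a x) X) = der (F c) (cmap c x) (der (tr ?a c) (cmap ?a x) X)"
    using has_derivative_unique by metis
  then show ?thesis
    using der_eqI[OF dF[OF c]] by (simp add: fb.comps_eq t comps_eq del: fc_simps)
qed

text \<open>Supplies the witness for the definite description in \<open>hlift\<close>. Affine
  extensions of the frame vectors, parallel at the point, still form a frame nearby because being a
  frame is an open condition.\<close>

lemma parallel_frame_exists:
  assumes c: "c \<in> atlas M" "x \<in> cdom c" and u: "is_frame u"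
  shows "\<exists>W s. mopen M W \<and> x \<in> W \<and> (\<forall>q\<in>W. is_frame (s q)) \<and> (\<forall>i. smooth_vf M W (\<lambda>q. s q $ i)) \<and> s x = u
    \<and> (\<forall>i. D x X (\<lambda>q. s q $ i) = 0)"
proof -
  let ?S = "cmap c ` cdom c" and ?y = "cmap c x"
  interpret coord_levi_civita ?S "christoffel c" "chart_metric c" by (rule coord_levi_civita[OF c(1)])
  have y: "?y \<in> ?S" using c by auto
  define F where "F i = parallel_ext ?y (comps M c x (u $ i))" for i
  have sF: "smooth_on ?S (F i)" for i unfolding F_def by (rule parallel_ext(4)[OF y open_S])
  define T where "T = ?S \<inter> (\<lambda>z. \<chi> i. F i z) -` Collect is_frame"
  have "continuous_on ?S (\<lambda>z. \<chi> i. F i z)"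
    by (rule smooth_on_continuous_on[OF smooth_on_vec_lambda[OF sF open_S]])
  then have "open T" unfolding T_def by (rule continuous_open_preimage[OF _ open_S open_is_frame])
  moreover have "T \<subseteq> ?S" by (auto simp: T_def)
  ultimately have T: "open T" "T \<subseteq> ?S" .
  have Fy: "F i ?y = comps M c x (u $ i)" for i by (simp add: F_def parallel_ext(1)[OF y])
  have yT: "?y \<in> T" using y is_frame_comps[OF c u] by (simp add: T_def Fy)
  define W where "W = cinv c ` T"
  define s where "s q = (\<chi> i. vf c (F i) q)" for q
  have W: "mopen M W" "x \<in> W" "W \<subseteq> cdom c"
    using mopen_cinv[OF c(1) T] yT T c by (auto simp: W_def image_iff intro!: bexI[of _ ?y])
  have sm: "smooth_vf M W (\<lambda>q. s q $ i)" for i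
    unfolding W_def s_def using smooth_vf_vf[OF c(1) T smooth_on_open_subset[OF sF T]] by simp
  have fr: "is_frame (s q)" if q: "q \<in> W" for q
  proof -
    obtain z where z: "z \<in> T" "q = cinv c z" using q by (auto simp: W_def)
    then obtain q' where "z = cmap c q'" "q' \<in> cdom c" using T by auto
    then have "q \<in> cdom c" "is_frame (\<chi> i. F i (cmap c q))" using z c by (auto simp: T_def)
    from is_frame_uncomps[OF c(1) this] show ?thesis by (simp add: s_def vf_def)
  qed
  have sx: "s x = u" using c by (simp add: s_def vf_def Fy vec_eq_iff)
  have "D x X (\<lambda>q. s q $ i) = 0" for i
  proof -
    have "comps M c x (D x X (\<lambda>q. s q $ i)) = cov_der (christoffel c) ?y (comps M c x X) (local_rep M c (\<lambda>q. s q $ i))"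
      by (rule D_chart[OF c(1) W(1) sm W(2) c(2)])
    also have "\<dots> = cov_der (christoffel c) ?y (comps M c x X) (F i)"
      by (simp add: cov_der_def s_def local_rep_vf_der[OF c] c)
    also have "\<dots> = 0" unfolding F_def by (rule parallel_ext(3)[OF y])
    finally show ?thesis using comps_inject[OF c, of _ 0] linear_0[OF linear_comps[OF c]] by simp
  qed
  with W sm fr sx show ?thesis by blast
qed

text \<open>Parallelism at \<open>x\<close> fixes the derivative of the components of
  \<open>s\<close> in direction \<open>X\<close>, so the tangent vector is the same for all
  admissible \<open>s\<close>. This is the source of the minus sign in \<open>lift\<close>.\<close>

lemma comps_hlift:
  assumes c: "c \<in> atlas M" "x \<in> cdom c" and u: "is_frame u"
  shows "comps fb (fc c) (x, u) (hlift M D (x, u) X) =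
    (comps M c x X, \<chi> i. - christoffel c (cmap c x) (comps M c x X) (comps M c x (u $ i)))"
proof -
  let ?R = "(comps M c x X, \<chi> i. - christoffel c (cmap c x) (comps M c x X) (comps M c x (u $ i)))"
  let ?P = "\<lambda>W s. mopen M W \<and> x \<in> W \<and> (\<forall>q\<in>W. is_frame (s q)) \<and> (\<forall>i. smooth_vf M W (\<lambda>q. s q $ i)) \<and> s x = u
    \<and> (\<forall>i. D x X (\<lambda>q. s q $ i) = 0)"
  let ?t = "\<lambda>s. tangent_map M fb (\<lambda>q. (q, s q)) x X"
  have k: "fc c \<in> atlas fb" "(x, u) \<in> cdom (fc c)" using c u by auto
  have tm: "comps fb (fc c) (x, u) (?t s) = ?R" if P: "?P W s" for W s
  proof -
    have P': "mopen M W" "x \<in> W" "\<And>q. q \<in> W \<Longrightarrow> is_frame (s q)" "\<And>i. smooth_vf M W (\<lambda>q. s q $ i)" "s x = u"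
      "\<And>i. D x X (\<lambda>q. s q $ i) = 0" using P by auto
    have "cov_der (christoffel c) (cmap c x) (comps M c x X) (local_rep M c (\<lambda>q. s q $ i)) = 0" for i
      using D_chart[OF c(1) P'(1,4,2) c(2), of X i] P'(6) linear_0[OF linear_comps[OF c]] by simp
    then have "der (local_rep M c (\<lambda>q. s q $ i)) (cmap c x) (comps M c x X) = - christoffel c (cmap c x) (comps M c x X) (comps M c x (u $ i))" for i
      using c P'(5) by (simp add: cov_der_def eq_neg_iff_add_eq_0)
    then show ?thesis using comps_tangent_map[OF c P'(1-5)] by simp
  qed
  obtain W0 s0 where P0: "?P W0 s0" using parallel_frame_exists[OF c u] by blast
  have eq: "?t s = ?t s0" if "?P W s" for W s
    using tm[OF that] tm[OF P0] fb.comps_inject[OF k, of "?t s" "?t s0"] by (simp only: simp_thms)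
  have "hlift M D (x, u) X = (THE a. \<forall>W s. ?P W s \<longrightarrow> a = ?t s)"
    by (simp add: hlift_def)
  also have "\<dots> = ?t s0"
  proof (rule the_equality)
    show "\<forall>W s. ?P W s \<longrightarrow> ?t s0 = ?t s" using eq[symmetric] by blast
    show "a = ?t s0" if "\<forall>W s. ?P W s \<longrightarrow> a = ?t s" for a using that P0 by blast
  qed
  finally show ?thesis using tm[OF P0] by simp
qed

end

lemma smooth_on_has_real_derivative:
  fixes f :: "real \<Rightarrow> real"
  assumes f: "smooth_on T f" and T: "open T"
  shows "smooth_on T (deriv f)" "t \<in> T \<Longrightarrow> (f has_real_derivative deriv f t) (at t)"
proof -
  have d: "(f has_real_derivative der f t 1) (at t)" if "t \<in> T" for t
    unfolding has_field_derivative_def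
  proof (rule has_derivative_eq_rhs[OF smooth_on_has_derivative[OF f T that]], rule ext)
    show "der f t h = der f t 1 * h" for h
      using linear_cmul[OF smooth_on_linear_der[OF f T that], of h 1] by simp
  qed
  then show "t \<in> T \<Longrightarrow> (f has_real_derivative deriv f t) (at t)" using DERIV_imp_deriv by metis
  show "smooth_on T (deriv f)"
    by (rule smooth_on_cong[THEN iffD1, rotated, OF smooth_on_der[OF f T, of 1]]) (use d DERIV_imp_deriv in metis)
qed

theorem proposition3p3:
  fixes M :: "('m, real^'n) manifold"
    and g :: "'m \<Rightarrow> real^'n \<Rightarrow> real^'n \<Rightarrow> real"
    and D :: "'m \<Rightarrow> real^'n \<Rightarrow> ('m \<Rightarrow> real^'n) \<Rightarrow> real^'n"
    and \<alpha> \<beta> :: "real \<Rightarrow> real"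
    and gb :: "'m \<times> 'n frame \<Rightarrow> 'n frame_tangent \<Rightarrow> 'n frame_tangent \<Rightarrow> real"
    and Db :: "'m \<times> 'n frame \<Rightarrow> 'n frame_tangent
                 \<Rightarrow> ('m \<times> 'n frame \<Rightarrow> 'n frame_tangent) \<Rightarrow> 'n frame_tangent"
    and x :: 'm and u :: "'n frame"
    and X Y Z :: "real^'n"
    and i j k :: 'n
  assumes "smooth_manifold M" and "riemannian_metric M g" and "levi_civita M g D"
    and "smooth_on {0..} \<alpha>" and "smooth_on {0..} \<beta>"
    and "\<And>t. t \<ge> 0 \<Longrightarrow> \<alpha> t > 0" and "\<And>t. t \<ge> 0 \<Longrightarrow> \<alpha> t + t * \<beta> t > 0"
    and "frame_metric M g D \<alpha> \<beta> gb" and "levi_civita (frame_bundle M) gb Db"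
    and "(x, u) \<in> points (frame_bundle M)"
  shows "let R = curvature M D x;
             dR = curvature_deriv M D x;
             Rb = curvature (frame_bundle M) Db (x, u);
             h = hlift M D (x, u);
             v = (\<lambda>l V. vlift M (x, u) l V);
             U = (\<lambda>l. v l (u $ l));
             G = g x;
             r = (\<lambda>l. G (u $ l) (u $ l));
             a = (\<lambda>l. \<alpha> (r l));
             b = (\<lambda>l. \<beta> (r l));
             a1 = (\<lambda>l. deriv \<alpha> (r l));
             a2 = (\<lambda>l. deriv (deriv \<alpha>) (r l));
             b1 = (\<lambda>l. deriv \<beta> (r l));
             A = (\<lambda>l. (3 * (a1 l)^2 - 2 * a l * a2 l) / (a l)^2
                    + (a l * b1 l - 2 * a1 l * b l) * (a l + r l * a1 l)
                      / ((a l)^2 * (a l + r l * b l)));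
             B = (\<lambda>l. (a l * b l - 2 * a l * a1 l - (a1 l)^2 * r l) / (a l * (a l + r l * b l)));
             C = (\<lambda>l. - (2 * a2 l) / (a l + r l * b l)
                    + (3 * a l * (a1 l)^2 + 2 * (a1 l)^2 * b l * r l + (a l)^2 * b1 l
                       - a l * (b l)^2 + a l * a1 l * b1 l * r l)
                      / (a l * (a l + r l * b l)^2))
         in
           Rb (h X) (h Y) (h Z) =
             h (R X Y Z) + (1/2) *\<^sub>R (\<Sum>l\<in>UNIV. v l (dR Z X Y (u $ l)))
             - (1/4) *\<^sub>R (\<Sum>l\<in>UNIV. a l *\<^sub>R h (R (u $ l) (R Y Z (u $ l)) X
                 - R (u $ l) (R X Z (u $ l)) Y - 2 *\<^sub>R R (u $ l) (R X Y (u $ l)) Z))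
         \<and> Rb (h X) (h Y) (v i Z) =
             v i (R X Y Z) + (a i / 2) *\<^sub>R h (dR X (u $ i) Z Y - dR Y (u $ i) Z X)
             - (a i / 4) *\<^sub>R (\<Sum>l\<in>UNIV. v l (R X (R (u $ i) Z Y) (u $ l) - R Y (R (u $ i) Z X) (u $ l)))
             + (a1 i / a i * G Z (u $ i)) *\<^sub>R v i (R X Y (u $ i))
             - ((b i - a1 i) / (a i + r i * b i) * G (R X Y Z) (u $ i)) *\<^sub>R U i
         \<and> Rb (h X) (v i Y) (h Z) =
             (a i / 2) *\<^sub>R h (dR X (u $ i) Y Z) - (1/2) *\<^sub>R v i (R Z X Y)
             + (a1 i / (2 * a i) * G Y (u $ i)) *\<^sub>R v i (R X Z (u $ i))
             - (a i / 4) *\<^sub>R (\<Sum>l\<in>UNIV. v l (R X (R (u $ i) Y Z) (u $ l)))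
             - ((b i - a1 i) / (2 * (a i + r i * b i)) * G (R X Z Y) (u $ i)) *\<^sub>R U i
         \<and> (i \<noteq> j \<longrightarrow>
             Rb (h X) (v i Y) (v j Z) = - (a i * a j / 4) *\<^sub>R h (R (u $ i) Y (R (u $ j) Z X)))
         \<and> Rb (h X) (v i Y) (v i Z) =
             (a1 i / 2) *\<^sub>R h (G Z (u $ i) *\<^sub>R R (u $ i) Y X - G Y (u $ i) *\<^sub>R R (u $ i) Z X)
             - ((a i)^2 / 4) *\<^sub>R h (R (u $ i) Y (R (u $ i) Z X)) - (a i / 2) *\<^sub>R h (R Y Z X)
         \<and> Rb (v i X) (v i Y) (h Z) =
             a i *\<^sub>R h (R X Y Z)
             + ((a i)^2 / 4) *\<^sub>R h (R (u $ i) X (R (u $ i) Y Z) - R (u $ i) Y (R (u $ i) X Z))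
             + a1 i *\<^sub>R (G X (u $ i) *\<^sub>R h (R (u $ i) Y Z) - G Y (u $ i) *\<^sub>R h (R (u $ i) X Z))
         \<and> (i \<noteq> j \<longrightarrow>
             Rb (v i X) (v j Y) (h Z) =
               (a i * a j / 4) *\<^sub>R h (R (u $ i) X (R (u $ j) Y Z) - R (u $ j) Y (R (u $ i) X Z)))
         \<and> Rb (v i X) (v i Y) (v i Z) =
             (C i * (G X (u $ i) * G Y Z - G Y (u $ i) * G X Z)) *\<^sub>R U i
             + (A i * G Y (u $ i) * G Z (u $ i) + B i * G Y Z) *\<^sub>R v i X
             - (A i * G X (u $ i) * G Z (u $ i) + B i * G X Z) *\<^sub>R v i Y
         \<and> (card {i, j, k} > 1 \<longrightarrow> Rb (v i X) (v j Y) (v k Z) = 0)"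
proof -
  interpret frame_manifold M
  proof
    fix c assume c: "c \<in> atlas M"
    have sm: "\<forall>c\<in>atlas M. cdom c \<subseteq> points M \<and> inj_on (cmap c) (cdom c) \<and> open (cmap c ` cdom c)"
      using assms(1) unfolding smooth_manifold_def by blast
    show "cdom c \<subseteq> points M" "inj_on (cmap c) (cdom c)" using sm c by auto
    fix c' assume c': "c' \<in> atlas M"
    have "\<forall>c\<in>atlas M. \<forall>c'\<in>atlas M. open (cmap c ` (cdom c \<inter> cdom c')) \<and>
        smooth_on (cmap c ` (cdom c \<inter> cdom c')) (cmap c' \<circ> cinv c)"
      using assms(1) unfolding smooth_manifold_def by blast
    then show "open (cmap c ` (cdom c \<inter> cdom c'))"
      "smooth_on (cmap c ` (cdom c \<inter> cdom c')) (\<lambda>y. cmap c' (cinv c y))"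
      using c c' by (auto simp: o_def)
  next
    fix p assume "p \<in> points M"
    then show "chart_at M p \<in> atlas M" "p \<in> cdom (chart_at M p)"
      using assms(1) unfolding smooth_manifold_def by blast+
  qed
  interpret frame_levi_civita M D g
    using assms(2,3) by unfold_locales (auto simp: levi_civita_def)
  have gbm: "riemannian_metric fb gb" using assms(8) by (simp add: frame_metric_def)
  interpret FB: levi_civita_atlas fb Db gb
    using assms(9) gbm by unfold_locales (auto simp: levi_civita_def)
  have x: "x \<in> points M" and u: "is_frame u" using assms(10) by auto
  \<comment> \<open>In the preferred chart at \<open>x\<close> every tangent vector is its own list
    of components, and likewise for the induced bundle chart at \<open>(x, u)\<close>. The
    coordinate formulas thus become the claimed ones without further conversion.\<close>
  define c where "c = chart_at M x"
  have c: "c \<in> atlas M" "x \<in> cdom c" using x by (auto simp: c_def chart_at_atlas chart_at_dom)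
  define k where "k = fc c"
  have k: "k \<in> atlas fb" "(x, u) \<in> cdom k" using c u by (auto simp: k_def)
  let ?S = "cmap c ` cdom c" and ?F = "Collect is_frame :: 'n frame set"
  have "cmap k ` cdom k = ?S \<times> ?F" using fc_overlap[OF c(1), of c] by (simp add: k_def)
  then have lcb: "coord_levi_civita (?S \<times> ?F) (FB.christoffel k) (FB.chart_metric k)"
    using FB.coord_levi_civita[OF k(1)] by simp
  have smooth: "smooth_on {0<..} \<alpha>" "smooth_on {0<..} \<beta>"
    using assms(4,5) by (auto intro: smooth_on_open_subset)
  note d\<alpha> = smooth_on_has_real_derivative[OF smooth(1)] and d\<beta> = smooth_on_has_real_derivative[OF smooth(2)]
  interpret B: coord_levi_civita ?S "christoffel c" "chart_metric c" by (rule coord_levi_civita[OF c(1)])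
  have fcd: "frame_coord ?S (christoffel c) (chart_metric c) ?F (FB.christoffel k) (FB.chart_metric k)
      \<alpha> \<beta> (deriv \<alpha>) (deriv (deriv \<alpha>)) (deriv \<beta>) (deriv (deriv \<beta>))"
  proof (intro frame_coord.intro frame_coord_axioms.intro B.coord_levi_civita_axioms lcb open_is_frame)
    show "u $ l \<noteq> 0" if "u \<in> ?F" for u l using that is_frame_nonzero by auto
    show "(\<alpha> has_real_derivative deriv \<alpha> t) (at t)" "(deriv \<alpha> has_real_derivative deriv (deriv \<alpha>) t) (at t)"
      "(\<beta> has_real_derivative deriv \<beta> t) (at t)" "(deriv \<beta> has_real_derivative deriv (deriv \<beta>) t) (at t)" if "t > 0" for t
      using that d\<alpha> d\<beta> smooth_on_has_real_derivative(2)[OF d\<alpha>(1)] smooth_on_has_real_derivative(2)[OF d\<beta>(1)] by auto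
  qed (use assms(6,7) B.coord_levi_civita_axioms in auto)
  interpret fcd: frame_coord ?S "christoffel c" "chart_metric c" ?F "FB.christoffel k" "FB.chart_metric k"
      \<alpha> \<beta> "deriv \<alpha>" "deriv (deriv \<alpha>)" "deriv \<beta>" "deriv (deriv \<beta>)"
    by (rule fcd)
  \<comment> \<open>Needed at every frame over the chart domain, and not just at
    \<open>(x, u)\<close>: the metric is differentiated, so its form must be known on an open
    set.\<close>
  have hl: "fcd.lift (cmap k (q, w)) (comps M c q X, 0) = comps fb k (q, w) (hlift M D (q, w) X)"
    if "q \<in> cdom c" "is_frame w" for q w X
    using that comps_hlift[OF c(1) that] by (simp add: fcd.lift_def k_def)
  have vl: "fcd.lift (cmap k (q, w)) (0, axis l (comps M c q X)) = comps fb k (q, w) (vlift M (q, w) l X)"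
    if "q \<in> cdom c" "is_frame w" for q w l X
    using that comps_vlift[OF c(1) that] B.Gamma_simps c(1) by (simp add: fcd.lift_def k_def)
  interpret F: frame_coord_metric ?S "christoffel c" "chart_metric c" ?F "FB.christoffel k" "FB.chart_metric k"
      \<alpha> \<beta> "deriv \<alpha>" "deriv (deriv \<alpha>)" "deriv \<beta>" "deriv (deriv \<beta>)"
  proof (intro frame_coord_metric.intro fcd frame_coord_metric_axioms.intro)
    fix y w \<xi> \<zeta> assume y: "y \<in> ?S" and w: "w \<in> ?F"
    then obtain q where q: "q \<in> cdom c" "y = cmap c q" by auto
    define z where "z = (\<chi> i. uncomps c q (w $ i))"
    have z: "is_frame z" using is_frame_uncomps[OF c(1) q(1)] w by (simp add: z_def)
    have e: "(y, w) = cmap k (q, z)" using c q by (simp add: k_def z_def vec_eq_iff)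
    have qz: "(q, z) \<in> points fb" "(q, z) \<in> cdom k" using q z cdom_subset[OF c(1)] by (auto simp: k_def)
    define H where "H \<xi> = hlift M D (q, z) (uncomps c q (fst \<xi>))" for \<xi> :: "'n frame_tangent"
    define V where "V \<xi> l = vlift M (q, z) l (uncomps c q (snd \<xi> $ l))" for \<xi> :: "'n frame_tangent" and l
    have lin: "linear (comps fb k (q, z))" by (rule fb.linear_comps[OF k(1) qz(2)])
    \<comment> \<open>The bundle metric is prescribed on horizontal and vertical lifts only. Writing
      a general vector as a sum of these reduces its value to the prescribed ones by
      bilinearity.\<close>
    have lift: "fcd.lift (y, w) \<xi> = comps fb k (q, z) (H \<xi> + (\<Sum>l\<in>UNIV. V \<xi> l))" for \<xi>
    proof -
      have "comps fb k (q, z) (H \<xi> + (\<Sum>l\<in>UNIV. V \<xi> l)) =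
          fcd.lift (y, w) (fst \<xi>, 0) + (\<Sum>l\<in>UNIV. fcd.lift (y, w) (0, axis l (snd \<xi> $ l)))"
        using hl[OF q(1) z, of "uncomps c q (fst \<xi>)"] vl[OF q(1) z, of _ "uncomps c q (snd \<xi> $ _)"] c q(1)
        by (simp add: linear_add[OF lin] linear_sum[OF lin] H_def V_def e)
      also have "\<dots> = fcd.lift (y, w) \<xi>"
        using y by (simp add: fcd.lift_def prod_eq_iff vec_eq_iff fst_sum snd_sum B.Gamma_simps axis_def)
      finally show ?thesis by simp
    qed
    have gb1: "linear (gb (q, z) A)" and gb2: "linear (\<lambda>A. gb (q, z) A A')" and symgb: "gb (q, z) A A' = gb (q, z) A' A" for A A'
      using FB.g_facts(1,2)[OF qz(1)] unfolding bilinear_def by blast+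
    have fm: "gb (q, z) (hlift M D (q, z) X) (hlift M D (q, z) Y) = g q X Y"
      "gb (q, z) (hlift M D (q, z) X) (vlift M (q, z) i Y) = 0"
      "i \<noteq> j \<Longrightarrow> gb (q, z) (vlift M (q, z) i X) (vlift M (q, z) j Y) = 0"
      "gb (q, z) (vlift M (q, z) i X) (vlift M (q, z) i Y) = \<alpha> (g q (z $ i) (z $ i)) * g q X Y
           + \<beta> (g q (z $ i) (z $ i)) * g q X (z $ i) * g q Y (z $ i)" for X Y i j
      using assms(8)[unfolded frame_metric_def, THEN conjunct2, THEN bspec, OF qz(1)] unfolding Let_def split by blast+
    have G: "chart_metric c y X Y = g q (uncomps c q X) (uncomps c q Y)" for X Y
      using q c by (simp add: chart_metric_cmap)
    have zi: "z $ i = uncomps c q (w $ i)" for i by (simp add: z_def)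
    have VV: "gb (q, z) (V \<xi> l) (V \<zeta> m) = (if l = m then fcd.vmetric (y, w) l (snd \<xi> $ l) (snd \<zeta> $ l) else 0)" for l m
      by (auto simp: V_def fm fcd.vmetric_def G zi)
    have "FB.chart_metric k (y, w) (fcd.lift (y, w) \<xi>) (fcd.lift (y, w) \<zeta>)
        = gb (q, z) (H \<xi> + (\<Sum>l\<in>UNIV. V \<xi> l)) (H \<zeta> + (\<Sum>l\<in>UNIV. V \<zeta> l))"
      unfolding lift unfolding e FB.chart_metric_cmap[OF k(1) qz(2)] by (simp add: fb.uncomps_comps[OF k(1) qz(2)])
    also have "\<dots> = gb (q, z) (H \<xi>) (H \<zeta>) + (\<Sum>l\<in>UNIV. gb (q, z) (H \<xi>) (V \<zeta> l)) + (\<Sum>l\<in>UNIV. gb (q, z) (V \<xi> l) (H \<zeta>))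
        + (\<Sum>m\<in>UNIV. \<Sum>l\<in>UNIV. gb (q, z) (V \<xi> l) (V \<zeta> m))"
      by (simp add: linear_add[OF gb1] linear_add[OF gb2] linear_sum[OF gb1] linear_sum[OF gb2] sum.distrib)
    also have "\<dots> = fcd.adapted_metric (y, w) \<xi> \<zeta>"
      by (simp add: VV fcd.adapted_metric_def G) (simp add: H_def V_def fm symgb[of "vlift _ _ _ _"])
    finally show "FB.chart_metric k (y, w) (fcd.lift (y, w) \<xi>) (fcd.lift (y, w) \<zeta>) = fcd.adapted_metric (y, w) \<xi> \<zeta>" .
  qed
  define p where "p = cmap k (x, u)"
  have p: "p = (cmap c x, u)" using x by (simp add: p_def k_def c_def comps_chart_at vec_eq_iff)
  have pS: "p \<in> ?S \<times> ?F" using c u by (simp add: p)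
  have id: "comps M c x X = X" for X using x by (simp add: c_def comps_chart_at)
  have idb: "comps fb k (x, u) A = A" for A
    using fb.comps_chart_at[OF assms(10)] by (simp add: k_def c_def)
  have h: "hlift M D (x, u) X = fcd.lift p (X, 0)" for X using hl[OF c(2) u, of X] by (simp add: id idb p_def)
  have v: "vlift M (x, u) l X = fcd.lift p (0, axis l X)" for l X using vl[OF c(2) u, of l X] by (simp add: id idb p_def)
  have R: "curvature M D x X Y Z = coord_curv (christoffel c) (fst p) X Y Z" for X Y Z
    using curvature_chart[OF c, of X Y Z] by (simp add: id p)
  have dR: "curvature_deriv M D x W X Y Z = coord_curv_deriv (christoffel c) (fst p) W X Y Z" for W X Y Z
    using curvature_deriv_chart[OF c, of W X Y Z] by (simp add: id p)
  have Rb: "curvature fb Db (x, u) X Y Z = coord_curv (FB.christoffel k) p X Y Z" for X Y Z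
    using FB.curvature_chart[OF k, of X Y Z] by (simp add: idb p_def)
  have G: "g x X Y = chart_metric c (fst p) X Y" for X Y
    using chart_metric_cmap[OF c, of X Y] uncomps_comps[OF c] by (simp add: p id)
  have su: "u = snd p" by (simp add: p)
  have card: "\<not> (i = j \<and> j = k)" if "card {i, j, k} > 1" for k using that by auto
  show ?thesis
    unfolding Let_def h v R dR Rb G unfolding su
    using F.curv_hhh[OF pS] F.curv_hhv[OF pS] F.curv_hvh[OF pS] F.curv_hvv_ne[OF pS] F.curv_hvv[OF pS]
      F.curv_vvh[OF pS] F.curv_vvh_ne[OF pS] F.curv_vvv[OF pS, unfolded F.cA_def[OF pS] F.cB_def[OF pS] F.cC_def[OF pS] Let_def] F.curv_vvv_ne[OF pS card]
    by (intro conjI impI) assumption+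
qed

end
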